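(* Let $n\geq 1$. Let $J^\alpha f=K_\alpha\ast f$ be a family of operators defined by convolution (in the sense of functions or distributions), where $K_\alpha,f:\mathbb{R}^n\rightarrow\mathbb{R}$, $0<\alpha<n$, $f$ is a Schwartz function, $K_\alpha$ is locally integrable, and $K_\alpha$ has a Fourier transform (in the sense of functions or distributions) that is defined for all $x\neq 0$. Suppose: - Identity: for some $0<\alpha_0<n$, $\widehat{K}_{\alpha_0}(x)=1/|x|^{\alpha_0}$ for all $x\neq 0$ (i.e. $J^{\alpha_0}=\mathcal{I}^{\alpha_0}$); - Index law: $J^{\alpha+\beta}=J^\alpha\circ J^\beta$ on the Schwartz space, for all $\alpha,\beta\in(0,n)$ such that $\alpha+\beta<n$; - Continuity: for all $x\neq 0$, the map $\alpha\mapsto\widehat{K}_\alpha(x)$ from $(0,n)$ to $\mathbb{R}$ is continuous at one point. (This condition is equivalent to: for every Schwartz function $f$ and $x\neq 0$, the map $\alpha\mapsto\widehat{J^\alpha f}(x)$ from $(0,n)$ to $\mathbb{R}$ is continuous at one point.) Then $J^\alpha=\mathcal{I}^\alpha$ is the Riesz potential on the Schwartz space, for all $\alpha\in(0,n)$.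
   Context: The hat denotes the Fourier transform on $\mathbb{R}^n$; $\widehat{K}_\alpha$ is real-valued on $\mathbb{R}^n\setminus\{0\}$. For $0<\alpha<n$, $\mathcal{I}^\alpha$ is the Riesz potential, i.e. convolution with the constant multiple of $|x|^{\alpha-n}$ whose Fourier transform is $1/|x|^\alpha$, so that $\widehat{\mathcal{I}^\alpha f}(x)=\widehat{f}(x)/|x|^\alpha$ for $x\neq 0$ and Schwartz functions $f$. The composition $J^\alpha\circ J^\beta f$ means $K_\alpha\ast(K_\beta\ast f)$, with Fourier transform $\widehat{K}_\alpha\widehat{K}_\beta\widehat{f}$ for $x\neq0$. *)

theory Defs
  imports "HOL-Analysis.Analysis"
begin

primrec iter_partial ::
  "'a::euclidean_space list \<Rightarrow> ('a \<Rightarrow> 'b::real_normed_vector) \<Rightarrow> 'a \<Rightarrow> 'b" where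
  "iter_partial [] f = f"
| "iter_partial (v # vs) f = (\<lambda>x. frechet_derivative (iter_partial vs f) (at x) v)"

definition schwartz :: "('a::euclidean_space \<Rightarrow> 'b::real_normed_vector) \<Rightarrow> bool" where
  "schwartz f \<longleftrightarrow>
     (\<forall>vs. set vs \<subseteq> Basis \<longrightarrow>
        (\<forall>x. iter_partial vs f differentiable (at x)) \<and>
        (\<forall>k. bounded (range (\<lambda>x. norm x ^ k *\<^sub>R iter_partial vs f x))))"

definition schwartz_seminorm ::
  "nat \<Rightarrow> 'a::euclidean_space list \<Rightarrow> ('a \<Rightarrow> 'b::real_normed_vector) \<Rightarrow> real" where
  "schwartz_seminorm k vs f = (SUP x. norm x ^ k * norm (iter_partial vs f x))"

text \<open>Real tempered distributions are total functions on all maps, but only their values on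
  Schwartz functions are meaningful.\<close>

definition tempered_distribution :: "(('a::euclidean_space \<Rightarrow> real) \<Rightarrow> real) \<Rightarrow> bool" where
  "tempered_distribution T \<longleftrightarrow>
     (\<forall>f g a b. schwartz f \<and> schwartz g \<longrightarrow>
        T (\<lambda>x. a * f x + b * g x) = a * T f + b * T g) \<and>
     (\<exists>C N. \<forall>f. schwartz f \<longrightarrow>
        \<bar>T f\<bar> \<le> C * (\<Sum>k\<le>N. \<Sum>vs | set vs \<subseteq> Basis \<and> length vs \<le> N. schwartz_seminorm k vs f))"

definition complex_extension ::
  "(('a \<Rightarrow> real) \<Rightarrow> real) \<Rightarrow> ('a \<Rightarrow> complex) \<Rightarrow> complex" where
  "complex_extension T \<phi> = Complex (T (\<lambda>x. Re (\<phi> x))) (T (\<lambda>x. Im (\<phi> x)))"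

definition locally_integrable :: "('a::euclidean_space \<Rightarrow> real) \<Rightarrow> bool" where
  "locally_integrable K \<longleftrightarrow> (\<forall>S. compact S \<longrightarrow> K absolutely_integrable_on S)"

text \<open>A locally integrable function need not be absolutely integrable against every Schwartz
  function in order to be a tempered distribution (for example \<open>exp x * cos (exp x)\<close> on the line).
  The integral formula is required wherever the integral converges absolutely, in particular for
  all compactly supported smooth functions.  Requiring it only for the latter would be equivalent
  (cut off and use dominated convergence), and as these are dense in the Schwartz space, \<open>T\<close> is
  determined by \<open>K\<close> on all Schwartz functions.\<close>

definition induces ::
  "('a::euclidean_space \<Rightarrow> real) \<Rightarrow> (('a \<Rightarrow> real) \<Rightarrow> real) \<Rightarrow> bool" where
  "induces K T \<longleftrightarrow> locally_integrable K \<and> tempered_distribution T \<and>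
     (\<forall>\<phi>. schwartz \<phi> \<and> integrable lebesgue (\<lambda>x. K x * \<phi> x) \<longrightarrow>
        T \<phi> = (LINT x|lebesgue. K x * \<phi> x))"

definition induced_distribution ::
  "('a::euclidean_space \<Rightarrow> real) \<Rightarrow> ('a \<Rightarrow> real) \<Rightarrow> real" where
  "induced_distribution K = (SOME T. induces K T)"

text \<open>Convolution of \<open>K\<close> with a Schwartz function, \<open>(K * f)(x) = \<langle>K, f(x - \<cdot>)\<rangle>\<close>; this is the
  ordinary convolution integral whenever the latter converges absolutely.\<close>

definition convolution ::
  "('a::euclidean_space \<Rightarrow> real) \<Rightarrow> ('a \<Rightarrow> real) \<Rightarrow> 'a \<Rightarrow> real" where
  "convolution K f = (\<lambda>x. induced_distribution K (\<lambda>y. f (x - y)))"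

definition fourier :: "('a::euclidean_space \<Rightarrow> complex) \<Rightarrow> 'a \<Rightarrow> complex" where
  "fourier \<phi> \<xi> = (LINT x|lebesgue. exp (- \<i> * complex_of_real (x \<bullet> \<xi>)) * \<phi> x)"

text \<open>The Fourier transform of \<open>K\<close>, as a tempered distribution, is the function \<open>k\<close>.  The value of
  \<open>k\<close> at the origin is irrelevant, so \<open>k\<close> may be regarded as defined for nonzero arguments only;
  on the other hand the transform has no part supported at the origin.\<close>

definition has_fourier_transform ::
  "('a::euclidean_space \<Rightarrow> real) \<Rightarrow> ('a \<Rightarrow> complex) \<Rightarrow> bool" where
  "has_fourier_transform K k \<longleftrightarrow> (\<exists>T. induces K T) \<and>
     (\<forall>\<phi>. schwartz \<phi> \<longrightarrow> integrable lebesgue (\<lambda>x. k x * \<phi> x) \<and>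
        complex_extension (induced_distribution K) (fourier \<phi>) = (LINT x|lebesgue. k x * \<phi> x))"

text \<open>\<open>h\<close> is the convolution of \<open>K\<close> with a function \<open>g\<close> that need not be Schwartz, in the sense of
  tempered distributions: the Fourier transform of \<open>h\<close> is the product of those of \<open>K\<close> and \<open>g\<close>.
  The transforms \<open>k\<close> and \<open>l\<close> are unique almost everywhere.\<close>

definition is_convolution ::
  "('a::euclidean_space \<Rightarrow> real) \<Rightarrow> ('a \<Rightarrow> real) \<Rightarrow> ('a \<Rightarrow> real) \<Rightarrow> bool" where
  "is_convolution K g h \<longleftrightarrow>
     (\<exists>k l. has_fourier_transform K k \<and> has_fourier_transform g l \<and>
        has_fourier_transform h (\<lambda>x. k x * l x))"

text \<open>With the above normalisation of the Fourier transform, the constant is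
  \<open>Gamma ((n - \<alpha>) / 2) / (pi powr (n / 2) * 2 powr \<alpha> * Gamma (\<alpha> / 2))\<close>.\<close>

definition riesz_kernel :: "real \<Rightarrow> real ^ 'n \<Rightarrow> real" where
  "riesz_kernel \<alpha> x =
     (THE c. has_fourier_transform
        (\<lambda>y :: real ^ 'n. c * norm y powr (\<alpha> - real CARD('n)))
        (\<lambda>\<xi>. complex_of_real (1 / norm \<xi> powr \<alpha>)))
     * norm x powr (\<alpha> - real CARD('n))"

definition riesz_potential :: "real \<Rightarrow> (real ^ 'n \<Rightarrow> real) \<Rightarrow> real ^ 'n \<Rightarrow> real" where
  "riesz_potential \<alpha> f = convolution (riesz_kernel \<alpha>) f"

end

theory Submission
  imports "HOL-Probability.Characteristic_Functions" "HOL-Probability.Sinc_Integral" Defs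
begin

text \<open>Writing translates of a Schwartz function as Fourier transforms shows that the index law means
  \<open>Khat (\<alpha> + \<beta>) = Khat \<alpha> * Khat \<beta>\<close>, but for each pair \<open>(\<alpha>, \<beta>)\<close> only outside a null set, and there are
  uncountably many pairs.  One therefore fixes \<open>\<alpha>\<close> and uses only exponents in the countable set of rational
  combinations of \<open>\<alpha>\<close> and \<open>\<alpha>\<^sub>0\<close>.  For almost every \<open>x\<close> the function \<open>Khat \<gamma> x * norm x powr \<gamma>\<close> of such
  exponents \<open>\<gamma>\<close> is multiplicative, equals 1 at \<open>\<alpha>\<^sub>0\<close>, and is bounded near the point of continuity; this
  forces it to be 1 at \<open>\<alpha>\<close>.  The Riesz kernel has the same Fourier transform \<open>1 / norm x powr \<alpha>\<close>, as one sees
  by writing powers of the norm as superpositions of Gaussians, and Fourier inversion on the Schwartz space shows that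
  a kernel's Fourier transform determines its convolution with Schwartz functions.\<close>

section \<open>Schwartz functions\<close>

text \<open>The kernels are merely locally integrable, so their pairings with Schwartz functions
  need not converge absolutely, and \<open>is_convolution\<close> asserts no more than the existence
  of some transforms. What can be compared are the functions \<open>k\<close> integrated against
  test functions; hence inversion, invariance of the Schwartz space and uniqueness of transforms
  come before any kernel. In the index law a single test function is enough: the transform of a
  Gaussian has no zeros and cancels. The functional equation is available only for positive
  exponents whose sum stays below \<open>n\<close>, while the argument needs large integer multiples
  of \<open>\<alpha>\<close> of either sign. They are compensated by rational multiples of
  \<open>\<alpha>\<^sub>0\<close>, and dividing all exponents by a large integer keeps the
  intermediate ones in range. The powers of 4 and pi in the Riesz constant come from the transform
  of exp (- t |x|^2), a multiple of exp (- |x|^2 / (4 t)).\<close>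

lemma iter_partial_append: "iter_partial (us @ vs) f = iter_partial us (iter_partial vs f)"
  by (induction us) auto

lemma frechet_derivative_eq: "(f has_derivative f') (at x) \<Longrightarrow> frechet_derivative f (at x) = f'"
  by (rule frechet_derivative_at[symmetric])

text \<open>An iterated partial arises by one more outermost differentiation, so an invariant set
  containing \<open>f\<close> contains them all. Each closure property below thus needs a suitable
  family of functions and one first-order derivative formula, instead of a Leibniz rule for every
  order.\<close>

lemma schwartz_coinduct:
  assumes "f \<in> P"
    and diff: "\<And>f x. f \<in> P \<Longrightarrow> f differentiable (at x)"
    and bdd: "\<And>f k. f \<in> P \<Longrightarrow> bounded (range (\<lambda>x. norm x ^ k *\<^sub>R f x))"
    and partial: "\<And>f b. f \<in> P \<Longrightarrow> b \<in> Basis \<Longrightarrow> (\<lambda>x. frechet_derivative f (at x) b) \<in> P"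
  shows "schwartz f"
proof -
  have "iter_partial vs f \<in> P" if "set vs \<subseteq> Basis" for vs
    using that by (induction vs) (auto simp: assms)
  then show ?thesis
    unfolding schwartz_def using diff bdd by blast
qed

lemma schwartz_differentiable: "schwartz f \<Longrightarrow> f differentiable (at x)"
  unfolding schwartz_def by (drule spec[of _ "[]"]) auto

lemma schwartz_bounded: "schwartz f \<Longrightarrow> bounded (range (\<lambda>x. norm x ^ k *\<^sub>R f x))"
  unfolding schwartz_def by (drule spec[of _ "[]"]) auto

lemma schwartz_bound:
  assumes "schwartz f" obtains B where "B > 0" "\<And>x. norm x ^ k * norm (f x) \<le> B"
  using schwartz_bounded[OF assms, of k] by (auto simp: bounded_pos)

lemma schwartz_partial:
  assumes "schwartz f" "b \<in> Basis"
  shows "schwartz (\<lambda>x. frechet_derivative f (at x) b)"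
  unfolding schwartz_def
proof (intro allI impI)
  fix vs :: "'a list" assume vs: "set vs \<subseteq> Basis"
  \<comment> \<open>The new derivative acts before those in \<open>vs\<close>, so \<open>b\<close>
    stands at the end of the list.\<close>
  have "iter_partial vs (\<lambda>x. frechet_derivative f (at x) b) = iter_partial (vs @ [b]) f"
    by (simp add: iter_partial_append)
  then show "(\<forall>x. iter_partial vs (\<lambda>x. frechet_derivative f (at x) b) differentiable at x) \<and>
      (\<forall>k. bounded (range (\<lambda>x. norm x ^ k *\<^sub>R iter_partial vs (\<lambda>x. frechet_derivative f (at x) b) x)))"
    using assms vs unfolding schwartz_def by (auto dest!: spec[of _ "vs @ [b]"])
qed

lemma schwartz_has_derivative:
  "schwartz f \<Longrightarrow> (f has_derivative frechet_derivative f (at x)) (at x)"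
  using schwartz_differentiable frechet_derivative_works by blast

lemma schwartz_continuous_on: "schwartz f \<Longrightarrow> continuous_on S f"
  by (meson differentiable_imp_continuous_within continuous_at_imp_continuous_on schwartz_differentiable)

lemma schwartz_borel_measurable [measurable_dest]: "schwartz f \<Longrightarrow> f \<in> borel_measurable borel"
  by (intro borel_measurable_continuous_onI schwartz_continuous_on)

text \<open>A bounded linear map commutes with partial derivatives and changes decay bounds by a
  constant. This one argument covers real and imaginary parts, constant multiples and the embedding
  of the reals.\<close>

lemma schwartz_bounded_linear:
  fixes f :: "'a::euclidean_space \<Rightarrow> 'b::real_normed_vector"
    and L :: "'b \<Rightarrow> 'c::real_normed_vector"
  assumes "schwartz f" and L: "bounded_linear L"
  shows "schwartz (\<lambda>x. L (f x))"
proof (rule schwartz_coinduct[of _ "{\<lambda>x. L (f x) | f. schwartz f}"])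
  fix h :: "'a \<Rightarrow> 'c" assume "h \<in> {\<lambda>x. L (f x) | f. schwartz f}"
  then obtain f where f: "schwartz f" and h: "h = (\<lambda>x. L (f x))" by blast
  have d: "(h has_derivative (\<lambda>v. L (frechet_derivative f (at x) v))) (at x)" for x
    unfolding h using bounded_linear.has_derivative[OF L schwartz_has_derivative[OF f]] .
  then show "h differentiable (at x)" for x
    unfolding differentiable_def by blast
  show "bounded (range (\<lambda>x. norm x ^ k *\<^sub>R h x))" for k
  proof -
    have "bounded (L ` range (\<lambda>x. norm x ^ k *\<^sub>R f x))"
      using schwartz_bounded[OF f] L by (rule bounded_linear_image)
    then show ?thesis
      by (simp add: h image_image linear_simps[OF L])
  qed
  fix b :: 'a assume "b \<in> Basis"
  show "(\<lambda>x. frechet_derivative h (at x) b) \<in> {\<lambda>x. L (f x) | f. schwartz f}"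
    unfolding frechet_derivative_eq[OF d]
    by (intro CollectI exI[of _ "\<lambda>x. frechet_derivative f (at x) b"] conjI refl
        schwartz_partial[OF f \<open>b \<in> Basis\<close>])
qed (use assms in blast)

lemma schwartz_add:
  fixes f g :: "'a::euclidean_space \<Rightarrow> 'b::real_normed_vector"
  assumes "schwartz f" "schwartz g"
  shows "schwartz (\<lambda>x. f x + g x)"
proof (rule schwartz_coinduct[of _ "{\<lambda>x. f x + g x | f g. schwartz f \<and> schwartz g}"])
  fix h :: "'a \<Rightarrow> 'b" assume "h \<in> {\<lambda>x. f x + g x | f g. schwartz f \<and> schwartz g}"
  then obtain f g where fg: "schwartz f" "schwartz g" and h: "h = (\<lambda>x. f x + g x)" by blast
  have d: "(h has_derivative (\<lambda>v. frechet_derivative f (at x) v + frechet_derivative g (at x) v)) (at x)" for x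
    unfolding h by (intro has_derivative_add schwartz_has_derivative fg)
  then show "h differentiable (at x)" for x
    unfolding differentiable_def by blast
  show "bounded (range (\<lambda>x. norm x ^ k *\<^sub>R h x))" for k
    using bounded_plus_comp[OF schwartz_bounded[OF fg(1), of k] schwartz_bounded[OF fg(2), of k]]
    by (simp add: h scaleR_add_right)
  fix b :: 'a assume "b \<in> Basis"
  show "(\<lambda>x. frechet_derivative h (at x) b) \<in> {\<lambda>x. f x + g x | f g. schwartz f \<and> schwartz g}"
    unfolding frechet_derivative_eq[OF d]
    by (intro CollectI exI[of _ "\<lambda>x. frechet_derivative f (at x) b"]
        exI[of _ "\<lambda>x. frechet_derivative g (at x) b"] conjI refl
        schwartz_partial[OF fg(1) \<open>b \<in> Basis\<close>] schwartz_partial[OF fg(2) \<open>b \<in> Basis\<close>])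
qed (use assms in blast)

lemma schwartz_cmult:
  fixes c :: "'b::real_normed_algebra"
  shows "schwartz f \<Longrightarrow> schwartz (\<lambda>x. c * f x)"
  by (rule schwartz_bounded_linear[OF _ bounded_linear_mult_right])

lemma schwartz_scaleR: "schwartz f \<Longrightarrow> schwartz (\<lambda>x. c *\<^sub>R f x)"
  by (rule schwartz_bounded_linear[OF _ bounded_linear_scaleR_right])

lemma schwartz_Re: "schwartz f \<Longrightarrow> schwartz (\<lambda>x. Re (f x))"
  by (rule schwartz_bounded_linear[OF _ bounded_linear_Re])

lemma schwartz_Im: "schwartz f \<Longrightarrow> schwartz (\<lambda>x. Im (f x))"
  by (rule schwartz_bounded_linear[OF _ bounded_linear_Im])

lemma schwartz_of_real:
  "schwartz f \<Longrightarrow> schwartz (\<lambda>x. of_real (f x) :: 'b::{real_normed_algebra_1})"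
  by (rule schwartz_bounded_linear[OF _ bounded_linear_of_real])

lemma schwartz_coordinate_mult:
  fixes a :: "'a::euclidean_space" and f :: "'a \<Rightarrow> 'b::real_normed_vector"
  assumes "schwartz f"
  shows "schwartz (\<lambda>x. (x \<bullet> a) *\<^sub>R f x)"
proof -
  \<comment> \<open>Differentiating \<open>(x \<bullet> a) *\<^sub>R f x\<close> leaves a term
    without the coordinate factor, so such products alone are not invariant; the free summand
    \<open>g\<close> absorbs it.\<close>
  define P where "P = {\<lambda>x. (x \<bullet> a) *\<^sub>R f x + g x | f (g :: 'a \<Rightarrow> 'b). schwartz f \<and> schwartz g}"
  have "schwartz (\<lambda>x. (x \<bullet> a) *\<^sub>R f x + 0 *\<^sub>R f x)"
  proof (rule schwartz_coinduct[of _ P])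
    fix h assume "h \<in> P"
    then obtain f g where fg: "schwartz f" "schwartz g" and h: "h = (\<lambda>x. (x \<bullet> a) *\<^sub>R f x + g x)"
      unfolding P_def by blast
    have d: "(h has_derivative (\<lambda>v. ((x \<bullet> a) *\<^sub>R frechet_derivative f (at x) v + (v \<bullet> a) *\<^sub>R f x) +
        frechet_derivative g (at x) v)) (at x)" for x
      unfolding h by (intro has_derivative_add has_derivative_scaleR schwartz_has_derivative fg
          has_derivative_inner_left has_derivative_ident)
    then show "h differentiable (at x)" for x
      unfolding differentiable_def by blast
    show "bounded (range (\<lambda>x. norm x ^ k *\<^sub>R h x))" for k
    proof -
      obtain B where B: "\<And>x. norm x ^ Suc k * norm (f x) \<le> B" by (rule schwartz_bound[OF fg(1), where k = "Suc k"]) blast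
      obtain C where C: "\<And>x. norm x ^ k * norm (g x) \<le> C" by (rule schwartz_bound[OF fg(2), where k = k]) blast
      have "norm (norm x ^ k *\<^sub>R h x) \<le> norm a * B + C" for x
      proof -
        have "norm (norm x ^ k *\<^sub>R h x) \<le> norm x ^ k * (\<bar>x \<bullet> a\<bar> * norm (f x) + norm (g x))"
          unfolding h by (auto intro!: mult_left_mono norm_triangle_le)
        also have "\<dots> \<le> norm x ^ k * ((norm x * norm a) * norm (f x) + norm (g x))"
          by (intro mult_left_mono add_right_mono mult_right_mono Cauchy_Schwarz_ineq2) auto
        also have "\<dots> = norm a * (norm x ^ Suc k * norm (f x)) + norm x ^ k * norm (g x)"
          by (simp add: algebra_simps)
        also have "\<dots> \<le> norm a * B + C"
          by (intro add_mono mult_left_mono B C) auto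
        finally show ?thesis .
      qed
      then show ?thesis by (auto simp: bounded_iff)
    qed
    fix b :: 'a assume b: "b \<in> Basis"
    have "(\<lambda>x. frechet_derivative h (at x) b) = (\<lambda>x. (x \<bullet> a) *\<^sub>R frechet_derivative f (at x) b +
      ((b \<bullet> a) *\<^sub>R f x + frechet_derivative g (at x) b))"
      unfolding frechet_derivative_eq[OF d] by (simp add: add.assoc)
    moreover have "schwartz (\<lambda>x. frechet_derivative f (at x) b)"
      by (rule schwartz_partial[OF fg(1) b])
    moreover have "schwartz (\<lambda>x. (b \<bullet> a) *\<^sub>R f x + frechet_derivative g (at x) b)"
      by (intro schwartz_add schwartz_scaleR schwartz_partial[OF fg(2) b] fg)
    ultimately show "(\<lambda>x. frechet_derivative h (at x) b) \<in> P"
      unfolding P_def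
      by (intro CollectI exI[of _ "\<lambda>x. frechet_derivative f (at x) b"]
          exI[of _ "\<lambda>x. (b \<bullet> a) *\<^sub>R f x + frechet_derivative g (at x) b"] conjI)
  next
    show "(\<lambda>x. (x \<bullet> a) *\<^sub>R f x + 0 *\<^sub>R f x) \<in> P"
      unfolding P_def
      by (intro CollectI exI[of _ f] exI[of _ "\<lambda>x. 0 *\<^sub>R f x"] conjI refl assms schwartz_scaleR)
  qed
  then show ?thesis by simp
qed

text \<open>A derivative of the character is a constant times the character, so the same factor
  survives every differentiation; having modulus 1, it leaves all decay bounds unchanged.\<close>

lemma schwartz_character_mult:
  fixes f :: "'a::euclidean_space \<Rightarrow> complex" and \<xi> :: 'a
  assumes "schwartz f"
  shows "schwartz (\<lambda>x. exp (\<i> * of_real (x \<bullet> \<xi>)) * f x)" (is "schwartz (\<lambda>x. ?e x * f x)")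
proof (rule schwartz_coinduct[of _ "{\<lambda>x. ?e x * f x | f. schwartz f}"])
  fix h assume "h \<in> {\<lambda>x. ?e x * f x | f. schwartz f}"
  then obtain f where f: "schwartz f" and h: "h = (\<lambda>x. ?e x * f x)" by blast
  have d: "(h has_derivative (\<lambda>v. ?e x * (frechet_derivative f (at x) v + \<i> * of_real (v \<bullet> \<xi>) * f x))) (at x)" for x
  proof -
    have "(?e has_derivative (\<lambda>v. ?e x * (\<i> * of_real (v \<bullet> \<xi>)))) (at x)"
      by (rule has_derivative_eq_rhs, rule has_derivative_compose[OF _
            DERIV_exp[unfolded has_field_derivative_def]])
        (auto intro!: derivative_eq_intros)
    from has_derivative_mult[OF this schwartz_has_derivative[OF f]] show ?thesis
      unfolding h by (simp add: algebra_simps)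
  qed
  then show "h differentiable (at x)" for x
    unfolding differentiable_def by blast
  show "bounded (range (\<lambda>x. norm x ^ k *\<^sub>R h x))" for k
    using schwartz_bounded[OF f, of k] by (auto simp: bounded_iff h norm_mult)
  fix b :: 'a assume b: "b \<in> Basis"
  show "(\<lambda>x. frechet_derivative h (at x) b) \<in> {\<lambda>x. ?e x * f x | f. schwartz f}"
    unfolding frechet_derivative_eq[OF d] using schwartz_partial[OF f b] schwartz_cmult[OF f]
    by (intro CollectI exI[of _ "\<lambda>x. frechet_derivative f (at x) b + \<i> * of_real (b \<bullet> \<xi>) * f x"] conjI refl schwartz_add)
qed (use assms in blast)

text \<open>The span of the polynomial multiples of a Gaussian is closed under partial derivatives.\<close>

inductive_set gaussian_polynomials :: "real \<Rightarrow> ('a::euclidean_space \<Rightarrow> real) set" for t where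
  gaussian: "(\<lambda>x. exp (- t * norm x ^ 2)) \<in> gaussian_polynomials t"
| cmult: "f \<in> gaussian_polynomials t \<Longrightarrow> (\<lambda>x. c * f x) \<in> gaussian_polynomials t"
| coordinate: "f \<in> gaussian_polynomials t \<Longrightarrow> (\<lambda>x. (x \<bullet> a) * f x) \<in> gaussian_polynomials t"
| add: "f \<in> gaussian_polynomials t \<Longrightarrow> g \<in> gaussian_polynomials t \<Longrightarrow>
    (\<lambda>x. f x + g x) \<in> gaussian_polynomials t"

lemma gaussian_polynomials_derivative:
  assumes "f \<in> gaussian_polynomials t"
  shows "\<exists>f'. (\<forall>x. (f has_derivative f' x) (at x)) \<and> (\<forall>b. (\<lambda>x. f' x b) \<in> gaussian_polynomials t)"
  using assms
proof induction
  case gaussian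
  have "((\<lambda>x. exp (- t * norm x ^ 2)) has_derivative
      (\<lambda>v. (- 2 * t) * ((x \<bullet> v) * exp (- t * norm x ^ 2)))) (at x)" for x :: 'a
    unfolding power2_norm_eq_inner
    by (rule derivative_eq_intros refl)+ (auto simp: algebra_simps inner_commute)
  then show ?case
    by (intro exI[of _ "\<lambda>x v. (- 2 * t) * ((x \<bullet> v) * exp (- t * norm x ^ 2))"] conjI allI
        gaussian_polynomials.intros)
next
  case (cmult f c)
  then obtain f' where f': "\<And>x. (f has_derivative f' x) (at x)" "\<And>b. (\<lambda>x. f' x b) \<in> gaussian_polynomials t"
    by blast
  then show ?case
    by (intro exI[of _ "\<lambda>x v. c * f' x v"]) (auto intro!: has_derivative_mult_right gaussian_polynomials.cmult)
next
  case (coordinate f a)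
  then obtain f' where f': "\<And>x. (f has_derivative f' x) (at x)" "\<And>b. (\<lambda>x. f' x b) \<in> gaussian_polynomials t"
    by blast
  have "((\<lambda>x. (x \<bullet> a) * f x) has_derivative (\<lambda>v. (x \<bullet> a) * f' x v + (v \<bullet> a) * f x)) (at x)" for x
    by (intro has_derivative_mult f' has_derivative_inner_left has_derivative_ident)
  then show ?case using f' coordinate.hyps
    by (intro exI[of _ "\<lambda>x v. (x \<bullet> a) * f' x v + (v \<bullet> a) * f x"])
      (auto intro!: gaussian_polynomials.intros)
next
  case (add f g)
  then obtain f' g' where f': "\<And>x. (f has_derivative f' x) (at x)" "\<And>b. (\<lambda>x. f' x b) \<in> gaussian_polynomials t"
    and g': "\<And>x. (g has_derivative g' x) (at x)" "\<And>b. (\<lambda>x. g' x b) \<in> gaussian_polynomials t"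
    by blast
  then show ?case
    by (intro exI[of _ "\<lambda>x v. f' x v + g' x v"]) (auto intro!: has_derivative_add gaussian_polynomials.add)
qed

text \<open>The exponent \<open>k\<close> is generalised in the induction because a coordinate
  factor is paid for by one more power of the norm.\<close>

lemma gaussian_polynomials_bound:
  assumes "f \<in> gaussian_polynomials t" "t > 0"
  shows "\<exists>B. \<forall>x. norm x ^ k * \<bar>f x\<bar> \<le> B"
  using assms(1)
proof (induction arbitrary: k)
  case gaussian
  \<comment> \<open>The summand 1 serves the unit ball. Outside, \<open>norm x ^ k\<close> is at
    most \<open>norm x ^ (2 * k)\<close>, and \<open>fact k / t ^ k\<close> comes from comparing
    this with the single term of order \<open>k\<close> in the series of
    \<open>exp (t * norm x ^ 2)\<close>.\<close>
  have "norm x ^ k * exp (- t * norm x ^ 2) \<le> 1 + fact k / t ^ k" for x :: 'a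
  proof (cases "norm x \<le> 1")
    case True
    then have "norm x ^ k * exp (- t * norm x ^ 2) \<le> 1 * 1"
      using \<open>t > 0\<close> by (intro mult_mono power_le_one) auto
    also have "\<dots> \<le> 1 + fact k / t ^ k"
      using \<open>t > 0\<close> by simp
    finally show ?thesis .
  next
    case False
    then have "norm x ^ k \<le> norm x ^ (2 * k)"
      by (intro power_increasing) auto
    also have "\<dots> = (fact k / t ^ k) * ((t * norm x ^ 2) ^ k / fact k)"
      using \<open>t > 0\<close> by (simp add: power_mult power_mult_distrib)
    also have "\<dots> \<le> (fact k / t ^ k) * exp (t * norm x ^ 2)"
      using \<open>t > 0\<close> sum_le_suminf[OF sums_summable[OF exp_converges], of "{k}" "t * norm x ^ 2"]
      by (intro mult_left_mono) (auto simp: exp_def divide_inverse mult.commute)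
    finally have "norm x ^ k * exp (- t * norm x ^ 2) \<le> fact k / t ^ k"
      by (simp add: exp_minus field_simps)
    then show ?thesis by simp
  qed
  then show ?case by auto
next
  case (cmult f c)
  then obtain B where "\<And>x. norm x ^ k * \<bar>f x\<bar> \<le> B" by blast
  then have "\<bar>c\<bar> * (norm x ^ k * \<bar>f x\<bar>) \<le> \<bar>c\<bar> * B" for x
    by (intro mult_left_mono) auto
  then show ?case by (intro exI[of _ "\<bar>c\<bar> * B"]) (auto simp: abs_mult mult_ac)
next
  case (coordinate f a)
  then obtain B where B: "\<And>x. norm x ^ Suc k * \<bar>f x\<bar> \<le> B" by blast
  have "norm x ^ k * \<bar>(x \<bullet> a) * f x\<bar> \<le> norm a * B" for x
  proof -
    have "norm x ^ k * \<bar>(x \<bullet> a) * f x\<bar> \<le> norm x ^ k * ((norm x * norm a) * \<bar>f x\<bar>)"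
      unfolding abs_mult by (intro mult_left_mono mult_right_mono Cauchy_Schwarz_ineq2) auto
    also have "\<dots> = norm a * (norm x ^ Suc k * \<bar>f x\<bar>)" by simp
    also have "\<dots> \<le> norm a * B" by (intro mult_left_mono B) auto
    finally show ?thesis .
  qed
  then show ?case by blast
next
  case (add f g)
  then obtain B C where B: "\<And>x. norm x ^ k * \<bar>f x\<bar> \<le> B" and C: "\<And>x. norm x ^ k * \<bar>g x\<bar> \<le> C"
    by meson
  have "norm x ^ k * \<bar>f x + g x\<bar> \<le> B + C" for x
  proof -
    have "norm x ^ k * \<bar>f x + g x\<bar> \<le> norm x ^ k * (\<bar>f x\<bar> + \<bar>g x\<bar>)"
      by (intro mult_left_mono) auto
    also have "\<dots> \<le> B + C" using B[of x] C[of x] by (simp add: distrib_left)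
    finally show ?thesis .
  qed
  then show ?case by blast
qed

lemma schwartz_gaussian:
  assumes "t > 0"
  shows "schwartz (\<lambda>x::'a::euclidean_space. exp (- t * norm x ^ 2) :: real)"
proof (rule schwartz_coinduct[of _ "gaussian_polynomials t", OF gaussian_polynomials.gaussian])
  fix f :: "'a \<Rightarrow> real" assume f: "f \<in> gaussian_polynomials t"
  then obtain f' where f': "\<And>x. (f has_derivative f' x) (at x)" "\<And>b. (\<lambda>x. f' x b) \<in> gaussian_polynomials t"
    using gaussian_polynomials_derivative by blast
  show "f differentiable (at x)" for x
    using f' unfolding differentiable_def by blast
  show "bounded (range (\<lambda>x. norm x ^ k *\<^sub>R f x))" for k
    using gaussian_polynomials_bound[OF f assms, of k] by (auto simp: bounded_iff abs_mult)
  show "(\<lambda>x. frechet_derivative f (at x) b) \<in> gaussian_polynomials t" for b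
    unfolding frechet_derivative_eq[OF f'(1)] by (rule f')
qed

section \<open>The Fourier transform of integrable functions\<close>

text \<open>\<open>fourier\<close> integrates over the completed measure, while the product-measure
  arguments below take place over \<open>lborel\<close>.\<close>

lemma fourier_lborel:
  assumes "\<phi> \<in> borel_measurable borel"
  shows "fourier \<phi> \<xi> = (LINT x|lborel. exp (- \<i> * complex_of_real (x \<bullet> \<xi>)) * \<phi> x)"
  unfolding fourier_def using assms by (intro integral_completion) measurable

lemma fourier_integrable:
  assumes "integrable lborel (g :: 'a::euclidean_space \<Rightarrow> complex)"
  shows "integrable lborel (\<lambda>x. exp (- \<i> * complex_of_real (x \<bullet> \<xi>)) * g x)"
proof (rule Bochner_Integration.integrable_bound[OF assms])
  show "(\<lambda>x. exp (- \<i> * complex_of_real (x \<bullet> \<xi>)) * g x) \<in> borel_measurable lborel"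
    using borel_measurable_integrable[OF assms] by measurable
qed (auto simp: norm_mult)

lemma norm_fourier_le:
  assumes "integrable lborel (g :: 'a::euclidean_space \<Rightarrow> complex)"
  shows "norm (fourier g \<xi>) \<le> (LINT x|lborel. norm (g x))"
proof -
  have "norm (fourier g \<xi>) = norm (LINT x|lborel. exp (- \<i> * complex_of_real (x \<bullet> \<xi>)) * g x)"
    using borel_measurable_integrable[OF assms] by (subst fourier_lborel) auto
  also have "\<dots> \<le> (LINT x|lborel. norm (exp (- \<i> * complex_of_real (x \<bullet> \<xi>)) * g x))"
    by (rule integral_norm_bound)
  finally show ?thesis by (simp add: norm_mult)
qed

lemma fourier_borel_measurable:
  assumes "g \<in> borel_measurable borel"
  shows "fourier g \<in> borel_measurable borel"
proof -
  have "(\<lambda>\<xi>. LINT x|lborel. exp (- \<i> * complex_of_real (x \<bullet> \<xi>)) * g x) \<in> borel_measurable borel"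
    using assms by measurable
  then show ?thesis
    by (simp add: fourier_lborel[OF assms] cong: measurable_cong)
qed

text \<open>Both sides are iterated integrals of one absolutely integrable function, whose character
  is symmetric in the two variables. The factor \<open>s\<close> covers two uses:
  \<open>s = 1\<close> moves a transform between factors, \<open>s = - 1\<close> produces the
  reflected double transform that inversion undoes.\<close>

lemma fourier_multiplication:
  fixes g u :: "'a::euclidean_space \<Rightarrow> complex" and s :: real
  assumes g: "integrable lborel g" and u: "integrable lborel u"
  shows "(LINT x|lborel. fourier g (s *\<^sub>R x) * u x) = (LINT \<xi>|lborel. g \<xi> * fourier u (s *\<^sub>R \<xi>))"
proof -
  have [measurable]: "g \<in> borel_measurable borel" "u \<in> borel_measurable borel"
    using assms by auto
  let ?F = "\<lambda>(x, \<xi>). exp (- \<i> * complex_of_real (s * (x \<bullet> \<xi>))) * g \<xi> * u x"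
  have "integrable (lborel \<Otimes>\<^sub>M lborel) ?F"
  proof (rule lborel_pair.Fubini_integrable)
    have "integrable lborel (\<lambda>x. norm (u x) * (LINT \<xi>|lborel. norm (g \<xi>)))"
      using u by (intro integrable_mult_left) auto
    then show "integrable lborel (\<lambda>x. LINT \<xi>|lborel. norm (?F (x, \<xi>)))"
      by (simp add: norm_mult mult.commute)
    have "integrable lborel (\<lambda>\<xi>. exp (- \<i> * complex_of_real (\<xi> \<bullet> (s *\<^sub>R x))) * g \<xi> * u x)" for x
      by (intro integrable_mult_left fourier_integrable g)
    then show "AE x in lborel. integrable lborel (\<lambda>\<xi>. ?F (x, \<xi>))"
      by (simp add: inner_commute)
  qed measurable
  then have "(LINT \<xi>|lborel. LINT x|lborel. ?F (x, \<xi>)) = (LINT x|lborel. LINT \<xi>|lborel. ?F (x, \<xi>))"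
    by (intro lborel_pair.Fubini_integral) simp
  moreover have "(LINT x|lborel. ?F (x, \<xi>)) = g \<xi> * fourier u (s *\<^sub>R \<xi>)" for \<xi>
    by (subst fourier_lborel) (simp_all flip: integral_mult_right_zero add: mult_ac)
  moreover have "(LINT \<xi>|lborel. ?F (x, \<xi>)) = fourier g (s *\<^sub>R x) * u x" for x
  proof -
    have "(LINT \<xi>|lborel. ?F (x, \<xi>)) =
        (LINT \<xi>|lborel. (exp (- \<i> * complex_of_real (\<xi> \<bullet> (s *\<^sub>R x))) * g \<xi>) * u x)"
      by (simp add: inner_commute)
    also have "\<dots> = fourier g (s *\<^sub>R x) * u x"
      by (subst integral_mult_left_zero) (simp add: fourier_lborel)
    finally show ?thesis .
  qed
  ultimately show ?thesis by (simp only:)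
qed

section \<open>Affine substitution, product integrals and Gaussian integrals\<close>

lemma lborel_integral_affine:
  fixes f :: "'a::euclidean_space \<Rightarrow> 'b::{banach, second_countable_topology}"
  assumes f [measurable]: "f \<in> borel_measurable borel" and c: "c \<noteq> 0"
  shows "(LINT x|lborel. f x) = \<bar>c\<bar> ^ DIM('a) *\<^sub>R (LINT x|lborel. f (t + c *\<^sub>R x))"
  by (subst lborel_affine[OF c, of t]) (simp add: integral_density integral_distr)

lemma lborel_integrable_affine:
  fixes f :: "'a::euclidean_space \<Rightarrow> 'b::{banach, second_countable_topology}"
  assumes f: "integrable lborel f" and c: "c \<noteq> 0"
  shows "integrable lborel (\<lambda>x. f (t + c *\<^sub>R x))"
proof -
  have [measurable]: "f \<in> borel_measurable borel" using f by auto
  have "integrable (density (distr lborel borel (\<lambda>x. t + c *\<^sub>R x)) (\<lambda>_. \<bar>c\<bar> ^ DIM('a))) f"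
    using f lborel_affine[OF c, of t] by simp
  then have "integrable lborel (\<lambda>x. \<bar>c\<bar> ^ DIM('a) *\<^sub>R f (t + c *\<^sub>R x))"
    by (simp add: integrable_density integrable_distr_eq)
  from integrable_scaleR_right[OF this, of "inverse (\<bar>c\<bar> ^ DIM('a))"] show ?thesis
    using c by simp
qed

lemma
  fixes f :: "'a::euclidean_space \<Rightarrow> real \<Rightarrow> complex"
  assumes f: "\<And>b. b \<in> Basis \<Longrightarrow> integrable lborel (f b)"
  shows lborel_integrable_prod: "integrable lborel (\<lambda>x::'a. \<Prod>b\<in>Basis. f b (x \<bullet> b))"
    and lborel_integral_prod:
      "(LINT x|lborel. (\<Prod>b\<in>Basis. f b (x \<bullet> b))) = (\<Prod>b\<in>Basis. (LINT x|lborel. f b x))"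
proof -
  interpret product_sigma_finite "\<lambda>_::'a. lborel :: real measure" ..
  have [measurable]: "f b \<in> borel_measurable borel" if "b \<in> Basis" for b
    using f[OF that] by auto
  have m [measurable]: "(\<lambda>f. \<Sum>b\<in>Basis. f b *\<^sub>R b) \<in> (\<Pi>\<^sub>M b\<in>(Basis :: 'a set). lborel) \<rightarrow>\<^sub>M borel"
    by measurable
  have m' [measurable]: "(\<lambda>x::'a. \<Prod>b\<in>Basis. f b (x \<bullet> b)) \<in> borel_measurable borel"
    by measurable
  show "integrable lborel (\<lambda>x::'a. \<Prod>b\<in>Basis. f b (x \<bullet> b))"
    by (subst lborel_eq, subst integrable_distr_eq)
      (auto intro!: product_integrable_prod f cong: prod.cong)
  show "(LINT x|lborel. (\<Prod>b\<in>Basis. f b (x \<bullet> b))) = (\<Prod>b\<in>Basis. (LINT x|lborel. f b x))"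
    by (subst lborel_eq, subst integral_distr)
      (auto intro!: product_integral_prod f cong: prod.cong)
qed

lemma
  fixes t \<xi> :: real
  assumes t: "t > 0"
  shows integrable_gaussian_character_real:
      "integrable lborel (\<lambda>x. exp (- \<i> * complex_of_real (x * \<xi>)) * of_real (exp (- t * x ^ 2)))"
    and integral_gaussian_character_real:
      "(LINT x|lborel. exp (- \<i> * complex_of_real (x * \<xi>)) * of_real (exp (- t * x ^ 2))) =
        of_real (sqrt (pi / t) * exp (- (\<xi> ^ 2) / (4 * t)))"
proof -
  \<comment> \<open>Substituting \<open>c * x\<close> turns the weight exp (- y^2 / 2) of the
    standard normal density into exp (- t x^2), so its characteristic function at
    \<open>- \<xi> / c\<close> yields the integral.\<close>
  define c where "c = sqrt (2 * t)"
  have c: "c > 0" "c ^ 2 = 2 * t" using t by (auto simp: c_def)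
  define h where "h x = std_normal_density x *\<^sub>R iexp ((- \<xi> / c) * x)" for x
  have hi: "integrable lborel h"
  proof -
    have "integrable lborel std_normal_density"
      using integrable_std_normal_moment[of 0] by simp
    then show ?thesis
      unfolding h_def by (rule Bochner_Integration.integrable_bound) (auto simp: norm_mult)
  qed
  have hc: "h (0 + c * x) = of_real (1 / sqrt (2 * pi)) *
      (exp (- \<i> * complex_of_real (x * \<xi>)) * of_real (exp (- t * x ^ 2)))" for x
    using c by (simp add: h_def std_normal_density_def scaleR_conv_of_real power_mult_distrib mult_ac)
  have "integrable lborel (\<lambda>x. of_real (sqrt (2 * pi)) * h (0 + c * x))"
    using c hi by (intro integrable_mult_right lborel_integrable_real_affine) auto
  then show "integrable lborel (\<lambda>x. exp (- \<i> * complex_of_real (x * \<xi>)) * of_real (exp (- t * x ^ 2)))"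
    unfolding hc by (simp add: mult.assoc[symmetric] flip: of_real_mult)
  have "of_real (exp (- ((\<xi> / c) ^ 2) / 2)) = (LINT x|lborel. h x)"
    using fun_cong[OF char_std_normal_distribution, of "- \<xi> / c"]
    by (simp add: char_def integral_density h_def mult_ac)
  also have "\<dots> = c *\<^sub>R (LINT x|lborel. h (0 + c * x))"
    using c by (subst lborel_integral_real_affine[of c _ 0]) auto
  also have "\<dots> = of_real (c / sqrt (2 * pi)) *
      (LINT x|lborel. exp (- \<i> * complex_of_real (x * \<xi>)) * of_real (exp (- t * x ^ 2)))"
    unfolding hc by (simp add: scaleR_conv_of_real)
  finally have "(LINT x|lborel. exp (- \<i> * complex_of_real (x * \<xi>)) * of_real (exp (- t * x ^ 2))) =
      of_real (sqrt (2 * pi) / c) * of_real (exp (- ((\<xi> / c) ^ 2) / 2))"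
    using c by (simp add: field_simps)
  also have "sqrt (2 * pi) / c = sqrt (pi / t)"
    using t by (simp add: c_def real_sqrt_divide[symmetric])
  also have "(\<xi> / c) ^ 2 = \<xi> ^ 2 / (2 * t)"
    using c by (simp add: power_divide)
  finally show "(LINT x|lborel. exp (- \<i> * complex_of_real (x * \<xi>)) * of_real (exp (- t * x ^ 2))) =
        of_real (sqrt (pi / t) * exp (- (\<xi> ^ 2) / (4 * t)))"
    by simp
qed

lemma
  fixes \<xi> :: "'a::euclidean_space"
  assumes t: "t > 0"
  shows integrable_gaussian_character:
      "integrable lborel (\<lambda>x. exp (- \<i> * complex_of_real (x \<bullet> \<xi>)) * of_real (exp (- t * norm x ^ 2)))"
    and integral_gaussian_character:
      "(LINT x|lborel. exp (- \<i> * complex_of_real (x \<bullet> \<xi>)) * of_real (exp (- t * norm x ^ 2))) =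
        of_real (sqrt (pi / t) ^ DIM('a) * exp (- (norm \<xi> ^ 2) / (4 * t)))"
proof -
  have sq: "norm x ^ 2 = (\<Sum>b\<in>Basis. (x \<bullet> b) ^ 2)" for x :: 'a
    unfolding power2_norm_eq_inner by (subst euclidean_inner) (simp add: power2_eq_square)
  have *: "exp (- \<i> * complex_of_real (x \<bullet> \<xi>)) * of_real (exp (- t * norm x ^ 2)) =
    (\<Prod>b\<in>Basis. exp (- \<i> * complex_of_real ((x \<bullet> b) * (\<xi> \<bullet> b))) * of_real (exp (- t * (x \<bullet> b) ^ 2)))" for x
    unfolding prod.distrib
    by (simp add: sq sum_distrib_left exp_sum euclidean_inner[of x \<xi>] flip: sum_negf of_real_prod)
  show "integrable lborel (\<lambda>x. exp (- \<i> * complex_of_real (x \<bullet> \<xi>)) * of_real (exp (- t * norm x ^ 2)))"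
    unfolding * by (intro lborel_integrable_prod integrable_gaussian_character_real t)
  show "(LINT x|lborel. exp (- \<i> * complex_of_real (x \<bullet> \<xi>)) * of_real (exp (- t * norm x ^ 2))) =
        of_real (sqrt (pi / t) ^ DIM('a) * exp (- (norm \<xi> ^ 2) / (4 * t)))"
    unfolding *
    apply (subst lborel_integral_prod)
     apply (rule integrable_gaussian_character_real[OF t])
    apply (subst integral_gaussian_character_real[OF t])
    apply (simp add: sq sum_divide_distrib exp_sum prod.distrib flip: sum_negf of_real_prod)
    done
qed

lemma
  assumes t: "t > 0"
  shows integrable_gaussian: "integrable lborel (\<lambda>x::'a::euclidean_space. exp (- t * norm x ^ 2))"
    and integral_gaussian: "(LINT x|lborel. exp (- t * norm (x::'a) ^ 2)) = sqrt (pi / t) ^ DIM('a)"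
proof -
  have "integrable lborel (\<lambda>x::'a. complex_of_real (exp (- t * norm x ^ 2)))"
    using integrable_gaussian_character[OF t, of "0::'a"] by simp
  then show "integrable lborel (\<lambda>x::'a. exp (- t * norm x ^ 2))"
    using integrable_Re by fastforce
  have "complex_of_real (LINT x|lborel. exp (- t * norm (x::'a) ^ 2)) = of_real (sqrt (pi / t) ^ DIM('a))"
    using integral_gaussian_character[OF t, of "0::'a"] by simp
  then show "(LINT x|lborel. exp (- t * norm (x::'a) ^ 2)) = sqrt (pi / t) ^ DIM('a)"
    using of_real_eq_iff by blast
qed

section \<open>Gaussian summation: inversion and uniqueness of the Fourier transform\<close>

lemma gaussian_approximate_identity:
  fixes u :: "'a::euclidean_space \<Rightarrow> complex" and \<delta> :: "nat \<Rightarrow> real"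
  assumes cont: "continuous_on UNIV u" and bdd: "\<And>x. norm (u x) \<le> B" and \<delta>: "\<delta> \<longlonglongrightarrow> 0"
  shows "(\<lambda>m. LINT z|lborel. u (y + \<delta> m *\<^sub>R z) * of_real (exp (- (norm z ^ 2)))) \<longlonglongrightarrow>
    of_real (sqrt pi ^ DIM('a)) * u y"
proof -
  have [measurable]: "u \<in> borel_measurable borel"
    using cont by (rule borel_measurable_continuous_onI)
  \<comment> \<open>In rescaled form the Gaussian weight is fixed and only the argument of
    \<open>u\<close> moves, so a multiple of that weight dominates and continuity at
    \<open>y\<close> gives the pointwise limit.\<close>
  have "(\<lambda>m. LINT z|lborel. u (y + \<delta> m *\<^sub>R z) * of_real (exp (- (norm z ^ 2)))) \<longlonglongrightarrow>
    (LINT z|lborel. u y * of_real (exp (- (norm (z::'a) ^ 2))))"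
  proof (rule integral_dominated_convergence)
    show "integrable lborel (\<lambda>z::'a. B * exp (- (norm z ^ 2)))"
      using integrable_gaussian[of 1, where 'a='a] by simp
    show "AE z in lborel. (\<lambda>m. u (y + \<delta> m *\<^sub>R z) * of_real (exp (- (norm z ^ 2)))) \<longlonglongrightarrow>
        u y * of_real (exp (- (norm z ^ 2)))"
    proof (intro AE_I2 tendsto_mult tendsto_const)
      fix z :: 'a
      have "(\<lambda>m. y + \<delta> m *\<^sub>R z) \<longlonglongrightarrow> y + 0 *\<^sub>R z"
        by (intro tendsto_intros \<delta>)
      then show "(\<lambda>m. u (y + \<delta> m *\<^sub>R z)) \<longlonglongrightarrow> u y"
        using cont by (auto simp: continuous_on_eq_continuous_at intro: isCont_tendsto_compose[of y u])
    qed
    show "AE z in lborel. norm (u (y + \<delta> m *\<^sub>R z) * of_real (exp (- (norm z ^ 2)))) \<le> B * exp (- (norm z ^ 2))" for m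
      using bdd by (auto simp: norm_mult intro!: mult_right_mono)
  qed measurable
  also have "(LINT z|lborel. u y * of_real (exp (- (norm (z::'a) ^ 2)))) = of_real (sqrt pi ^ DIM('a)) * u y"
    using integral_gaussian[of 1, where 'a='a] by simp
  finally show ?thesis .
qed

text \<open>The Gaussian factor makes the inverse transform converge for every integrable
  \<open>g\<close>, and the result is a Gaussian average of \<open>g\<close> around \<open>y\<close>
  at scale \<open>2 * s\<close>. Inversion and uniqueness both rest on this.\<close>

lemma fourier_gaussian_summation:
  fixes g :: "'a::euclidean_space \<Rightarrow> complex"
  assumes g: "integrable lborel g" and s: "s > 0"
  shows "(LINT \<xi>|lborel. fourier g \<xi> * (exp (\<i> * of_real (\<xi> \<bullet> y)) * of_real (exp (- (s ^ 2) * norm \<xi> ^ 2)))) =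
    of_real ((2 * sqrt pi) ^ DIM('a)) * (LINT z|lborel. g (y + (2 * s) *\<^sub>R z) * of_real (exp (- (norm z ^ 2))))"
proof -
  have s2: "s ^ 2 > 0" using s by simp
  have [measurable]: "g \<in> borel_measurable borel" using g by auto
  define u where "u \<xi> = exp (\<i> * complex_of_real (\<xi> \<bullet> y)) * of_real (exp (- (s ^ 2) * norm \<xi> ^ 2))" for \<xi>
  have u: "integrable lborel u"
    using integrable_gaussian_character[OF s2, of "- y"] by (simp add: u_def[abs_def])
  have [measurable]: "u \<in> borel_measurable borel" using u by auto
  have fu: "fourier u x = of_real ((sqrt pi / s) ^ DIM('a) * exp (- (norm (x - y) ^ 2) / (4 * s ^ 2)))" for x
  proof -
    have "fourier u x = (LINT \<xi>|lborel. exp (- \<i> * of_real (\<xi> \<bullet> (x - y))) * of_real (exp (- (s ^ 2) * norm \<xi> ^ 2)))"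
      by (simp add: fourier_lborel u_def inner_diff_right mult.assoc[symmetric] algebra_simps flip: exp_add)
    also have "\<dots> = of_real ((sqrt pi / s) ^ DIM('a) * exp (- (norm (x - y) ^ 2) / (4 * s ^ 2)))"
      unfolding integral_gaussian_character[OF s2] using s by (simp add: real_sqrt_divide)
    finally show ?thesis .
  qed
  have "(LINT \<xi>|lborel. fourier g \<xi> * u \<xi>) = (LINT x|lborel. g x * fourier u x)"
    using fourier_multiplication[OF g u, of 1] by simp
  \<comment> \<open>The substitution brings \<open>fourier u\<close>, a Gaussian centred at
    \<open>y\<close>, to standard form. Its Jacobian cancels the powers of \<open>s\<close> in the
    coefficient of \<open>fourier u\<close> and leaves \<open>2 * sqrt pi\<close> per
    dimension.\<close>
  also have "\<dots> = (2 * s) ^ DIM('a) *\<^sub>R (LINT z|lborel. g (y + (2 * s) *\<^sub>R z) * fourier u (y + (2 * s) *\<^sub>R z))"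
    using s by (subst lborel_integral_affine[of _ "2 * s" y])
      (auto intro!: borel_measurable_times fourier_borel_measurable)
  also have "\<dots> = (2 * s) ^ DIM('a) *\<^sub>R (LINT z|lborel. of_real ((sqrt pi / s) ^ DIM('a)) *
      (g (y + (2 * s) *\<^sub>R z) * of_real (exp (- (norm z ^ 2)))))"
    using s by (simp add: fu power_mult_distrib mult_ac)
  also have "\<dots> = of_real ((2 * s) ^ DIM('a) * (sqrt pi / s) ^ DIM('a)) *
      (LINT z|lborel. g (y + (2 * s) *\<^sub>R z) * of_real (exp (- (norm z ^ 2))))"
    by (subst integral_mult_right_zero) (simp add: scaleR_conv_of_real)
  also have "(2 * s) ^ DIM('a) * (sqrt pi / s) ^ DIM('a) = (2 * sqrt pi) ^ DIM('a)"
    unfolding power_mult_distrib[symmetric] using s by simp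
  finally show ?thesis by (simp add: u_def)
qed

text \<open>The regularised inverse transform is sent to the limit in two ways: dominated by
  \<open>fourier f\<close>, and as an average of \<open>f\<close> shrinking to \<open>y\<close>. The
  constant multiplies \<open>2 * sqrt pi\<close> from the summation formula by the one-dimensional
  Gaussian mass \<open>sqrt pi\<close>, per dimension.\<close>

theorem fourier_inversion:
  fixes f :: "'a::euclidean_space \<Rightarrow> complex"
  assumes f: "integrable lborel f" and cont: "continuous_on UNIV f" and bdd: "\<And>x. norm (f x) \<le> B"
    and F: "integrable lborel (fourier f)"
  shows "fourier (fourier f) (- y) = of_real ((2 * pi) ^ DIM('a)) * f y"
proof -
  have [measurable]: "f \<in> borel_measurable borel" "fourier f \<in> borel_measurable borel"
    using f F by auto
  define s where "s m = 1 / real (Suc m)" for m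
  have s: "s m > 0" for m by (simp add: s_def)
  have s0: "s \<longlonglongrightarrow> 0" unfolding s_def using LIMSEQ_inverse_real_of_nat by (simp add: inverse_eq_divide)
  let ?L = "\<lambda>m. LINT \<xi>|lborel. fourier f \<xi> * (exp (\<i> * of_real (\<xi> \<bullet> y)) * of_real (exp (- (s m ^ 2) * norm \<xi> ^ 2)))"
  \<comment> \<open>Writing \<open>0 ^ 2\<close> makes the limit literally the integrand at
    parameter 0.\<close>
  have "?L \<longlonglongrightarrow> (LINT \<xi>|lborel. fourier f \<xi> * (exp (\<i> * of_real (\<xi> \<bullet> y)) * of_real (exp (- (0 ^ 2) * norm \<xi> ^ 2))))"
  proof (rule integral_dominated_convergence)
    show "integrable lborel (\<lambda>\<xi>. norm (fourier f \<xi>))" using F by simp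
    show "AE \<xi> in lborel. norm (fourier f \<xi> * (exp (\<i> * of_real (\<xi> \<bullet> y)) * of_real (exp (- (s m ^ 2) * norm \<xi> ^ 2))))
        \<le> norm (fourier f \<xi>)" for m
      by (auto simp: norm_mult intro!: mult_left_le)
    show "AE \<xi> in lborel. (\<lambda>m. fourier f \<xi> * (exp (\<i> * of_real (\<xi> \<bullet> y)) * of_real (exp (- (s m ^ 2) * norm \<xi> ^ 2)))) \<longlonglongrightarrow>
        fourier f \<xi> * (exp (\<i> * of_real (\<xi> \<bullet> y)) * of_real (exp (- (0 ^ 2) * norm \<xi> ^ 2)))"
      by (intro AE_I2 tendsto_intros s0)
  qed measurable
  moreover have "?L \<longlonglongrightarrow> of_real ((2 * sqrt pi) ^ DIM('a)) * (of_real (sqrt pi ^ DIM('a)) * f y)"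
    unfolding fourier_gaussian_summation[OF f s]
    using tendsto_mult[OF tendsto_const[of 2] s0]
    by (intro tendsto_mult tendsto_const gaussian_approximate_identity[OF cont bdd]) auto
  ultimately have "(LINT \<xi>|lborel. fourier f \<xi> * (exp (\<i> * of_real (\<xi> \<bullet> y)) * of_real (exp (- (0 ^ 2) * norm \<xi> ^ 2)))) =
      of_real ((2 * sqrt pi) ^ DIM('a)) * (of_real (sqrt pi ^ DIM('a)) * f y)"
    by (rule LIMSEQ_unique)
  also have "\<dots> = of_real ((2 * (sqrt pi * sqrt pi)) ^ DIM('a)) * f y"
    unfolding power_mult_distrib by (simp del: real_sqrt_mult_self)
  also have "sqrt pi * sqrt pi = pi" by simp
  finally show ?thesis
    by (subst fourier_lborel) (simp_all add: mult.commute)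
qed

text \<open>All Gaussian averages of \<open>g\<close> vanish by the summation formula. By Fubini and
  a translation, pairing \<open>g\<close> with an average of \<open>w\<close> equals pairing an
  average of \<open>g\<close> with \<open>w\<close>, hence is 0; as the scale shrinks, the averages
  of \<open>w\<close> tend boundedly to a multiple of \<open>w\<close>.\<close>

lemma fourier_eq_zero_imp_integral_zero:
  fixes g w :: "'a::euclidean_space \<Rightarrow> complex"
  assumes g: "integrable lborel g" and zero: "\<And>\<xi>. fourier g \<xi> = 0"
    and cont: "continuous_on UNIV w" and bdd: "\<And>x. norm (w x) \<le> B"
  shows "(LINT x|lborel. g x * w x) = 0"
proof -
  have [measurable]: "g \<in> borel_measurable borel" "w \<in> borel_measurable borel"
    using g borel_measurable_continuous_onI[OF cont] by auto
  have B: "B \<ge> 0" using bdd[of 0] norm_ge_zero order_trans by blast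
  define \<delta> where "\<delta> m = 1 / real (Suc m)" for m
  have \<delta>: "\<delta> m > 0" for m by (simp add: \<delta>_def)
  have \<delta>0: "\<delta> \<longlonglongrightarrow> 0" unfolding \<delta>_def using LIMSEQ_inverse_real_of_nat by (simp add: inverse_eq_divide)
  define W where "W m x = (LINT z|lborel. w (x + \<delta> m *\<^sub>R z) * of_real (exp (- (norm z ^ 2))))" for m x
  have [measurable]: "W m \<in> borel_measurable borel" for m
    unfolding W_def by measurable
  have ig: "integrable lborel (\<lambda>z::'a. exp (- (norm z ^ 2)))"
    using integrable_gaussian[of 1, where 'a='a] by simp
  have W: "norm (W m x) \<le> B * sqrt pi ^ DIM('a)" for m x
  proof -
    have "norm (W m x) \<le> (LINT z|lborel. norm (w (x + \<delta> m *\<^sub>R z) * of_real (exp (- (norm z ^ 2)))))"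
      unfolding W_def by (rule integral_norm_bound)
    also have "\<dots> \<le> (LINT z|lborel. B * exp (- (norm (z::'a) ^ 2)))"
      using bdd ig B by (intro integral_mono') (auto simp: norm_mult intro!: mult_right_mono)
    also have "\<dots> = B * sqrt pi ^ DIM('a)"
      using integral_gaussian[of 1, where 'a='a] by simp
    finally show ?thesis .
  qed
  have gW: "(LINT x|lborel. g x * W m x) = 0" for m
  proof -
    let ?e = "\<lambda>z::'a. complex_of_real (exp (- (norm z ^ 2)))"
    let ?F = "\<lambda>(z, x). g x * (w (x + \<delta> m *\<^sub>R z) * ?e z)"
    let ?G = "\<lambda>(z, x). g (x + (- \<delta> m) *\<^sub>R z) * (w x * ?e z)"
    have F: "integrable (lborel \<Otimes>\<^sub>M lborel) ?F" and G: "integrable (lborel \<Otimes>\<^sub>M lborel) ?G"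
    proof -
      \<comment> \<open>One estimate serves both double integrals: \<open>c = 0\<close> for
        \<open>?F\<close> and \<open>c = - \<delta> m\<close> for \<open>?G\<close>, the factor
        \<open>w\<close> costing \<open>B\<close>.\<close>
      have bound: "integrable (lborel \<Otimes>\<^sub>M lborel) (\<lambda>(z, x). g (x + c *\<^sub>R z) * ?e z)" for c :: real
      proof (rule lborel_pair.Fubini_integrable)
        have "integrable lborel (\<lambda>z::'a. (LINT x|lborel. norm (g x)) * exp (- (norm z ^ 2)))"
          using ig by simp
        also have "(\<lambda>z. (LINT x|lborel. norm (g x)) * exp (- (norm z ^ 2))) =
            (\<lambda>z. LINT x|lborel. norm (case (z, x) of (z, x) \<Rightarrow> g (x + c *\<^sub>R z) * ?e z))"
        proof
          fix z :: 'a
          show "(LINT x|lborel. norm (g x)) * exp (- (norm z ^ 2)) =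
              (LINT x|lborel. norm (case (z, x) of (z, x) \<Rightarrow> g (x + c *\<^sub>R z) * ?e z))"
            using lborel_integral_affine[of "\<lambda>x. norm (g x)" 1 "c *\<^sub>R z"]
            by (simp add: norm_mult add.commute)
        qed
        finally show "integrable lborel
            (\<lambda>z. LINT x|lborel. norm (case (z, x) of (z, x) \<Rightarrow> g (x + c *\<^sub>R z) * ?e z))" .
        show "AE z in lborel. integrable lborel (\<lambda>x. case (z, x) of (z, x) \<Rightarrow> g (x + c *\<^sub>R z) * ?e z)"
        proof (intro AE_I2, unfold prod.case, rule integrable_mult_left)
          fix z :: 'a
          show "integrable lborel (\<lambda>x. g (x + c *\<^sub>R z))"
            using lborel_integrable_affine[OF g, of 1 "c *\<^sub>R z"] by (simp add: add.commute)
        qed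
      qed measurable
      show "integrable (lborel \<Otimes>\<^sub>M lborel) ?F"
      proof (rule Bochner_Integration.integrable_bound)
        show "integrable (lborel \<Otimes>\<^sub>M lborel) (\<lambda>p. of_real B * (case p of (z, x) \<Rightarrow> g (x + 0 *\<^sub>R z) * ?e z))"
          by (intro integrable_mult_right bound)
        show "AE p in lborel \<Otimes>\<^sub>M lborel. norm (?F p) \<le>
            norm (of_real B * (case p of (z, x) \<Rightarrow> g (x + 0 *\<^sub>R z) * ?e z))"
          using bdd B
          by (intro AE_I2) (auto simp: case_prod_unfold norm_mult mult.left_commute[of B]
              intro!: mult_left_mono mult_right_mono)
      qed measurable
      show "integrable (lborel \<Otimes>\<^sub>M lborel) ?G"
      proof (rule Bochner_Integration.integrable_bound)
        show "integrable (lborel \<Otimes>\<^sub>M lborel)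
            (\<lambda>p. of_real B * (case p of (z, x) \<Rightarrow> g (x + (- \<delta> m) *\<^sub>R z) * ?e z))"
          by (intro integrable_mult_right bound)
        show "AE p in lborel \<Otimes>\<^sub>M lborel. norm (?G p) \<le>
            norm (of_real B * (case p of (z, x) \<Rightarrow> g (x + (- \<delta> m) *\<^sub>R z) * ?e z))"
          using bdd B
          by (intro AE_I2) (auto simp: case_prod_unfold norm_mult mult.left_commute[of B]
              intro!: mult_left_mono mult_right_mono)
      qed measurable
    qed
    have "(LINT x|lborel. g x * W m x) = (LINT x|lborel. LINT z|lborel. ?F (z, x))"
      unfolding W_def by simp
    also have "\<dots> = (LINT z|lborel. LINT x|lborel. ?F (z, x))"
      using lborel_pair.Fubini_integral[of "\<lambda>z x. ?F (z, x)"] F by simp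
    also have "\<dots> = (LINT z|lborel. LINT x|lborel. ?G (z, x))"
    proof (rule Bochner_Integration.integral_cong[OF refl])
      fix z :: 'a
      show "(LINT x|lborel. ?F (z, x)) = (LINT x|lborel. ?G (z, x))"
        by (subst lborel_integral_affine[of _ 1 "- \<delta> m *\<^sub>R z"]) (simp_all add: algebra_simps)
    qed
    also have "\<dots> = (LINT x|lborel. LINT z|lborel. ?G (z, x))"
      using lborel_pair.Fubini_integral[of "\<lambda>z x. ?G (z, x)"] G by simp
    also have "\<dots> = (LINT x|(lborel :: 'a measure). 0)"
    proof (rule Bochner_Integration.integral_cong[OF refl])
      fix x :: 'a
      \<comment> \<open>The summation formula averages at scale \<open>2 * s\<close>, hence
        \<open>s = \<delta> m / 2\<close>; the reflection of \<open>z\<close> afterwards matches the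
        sign left by the translation.\<close>
      have "0 = (LINT z|lborel. g (x + \<delta> m *\<^sub>R z) * ?e z)"
        using fourier_gaussian_summation[OF g, of "\<delta> m / 2" x] \<delta>[of m] by (simp add: zero)
      also have "\<dots> = (LINT z|lborel. g (x + (- \<delta> m) *\<^sub>R z) * ?e z)"
        by (subst lborel_integral_affine[of _ "- 1" 0]) simp_all
      finally have "(LINT z|lborel. w x * (g (x + (- \<delta> m) *\<^sub>R z) * ?e z)) = 0"
        by simp
      then show "(LINT z|lborel. ?G (z, x)) = 0" by (simp add: mult_ac)
    qed
    finally show ?thesis by simp
  qed
  have "(\<lambda>m. LINT x|lborel. g x * W m x) \<longlonglongrightarrow> (LINT x|lborel. g x * (of_real (sqrt pi ^ DIM('a)) * w x))"
  proof (rule integral_dominated_convergence)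
    show "integrable lborel (\<lambda>x. norm (g x) * (B * sqrt pi ^ DIM('a)))"
      using g by (intro integrable_mult_left) auto
    show "AE x in lborel. (\<lambda>m. g x * W m x) \<longlonglongrightarrow> g x * (of_real (sqrt pi ^ DIM('a)) * w x)"
      unfolding W_def
      by (intro AE_I2 tendsto_mult tendsto_const gaussian_approximate_identity[OF cont bdd \<delta>0])
    show "AE x in lborel. norm (g x * W m x) \<le> norm (g x) * (B * sqrt pi ^ DIM('a))" for m
      using W by (auto simp: norm_mult intro!: mult_left_mono)
  qed measurable
  then have "(LINT x|lborel. g x * (of_real (sqrt pi ^ DIM('a)) * w x)) = 0"
    unfolding gW by (simp add: LIMSEQ_const_iff)
  also have "(LINT x|lborel. g x * (of_real (sqrt pi ^ DIM('a)) * w x)) =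
      of_real (sqrt pi ^ DIM('a)) * (LINT x|lborel. g x * w x)"
    by (subst integral_mult_right_zero[symmetric]) (simp add: mult_ac)
  finally show ?thesis by simp
qed

text \<open>Closed sets are stable under intersection and generate the Borel sets, and the sets over
  which \<open>g\<close> integrates to 0 are preserved by complements and countable disjoint unions.
  Testing on the sets where \<open>g\<close> is positive or negative then finishes.\<close>

lemma AE_zero_of_closed_integrals:
  fixes g :: "'a::euclidean_space \<Rightarrow> real"
  assumes g: "integrable lborel g"
    and zero: "\<And>F. closed F \<Longrightarrow> (LINT x|lborel. indicator F x * g x) = 0"
  shows "AE x in lborel. g x = 0"
proof -
  have [measurable]: "g \<in> borel_measurable borel" using g by auto
  have int: "integrable lborel (\<lambda>x. indicator A x * g x)" if "A \<in> sets borel" for A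
    using integrable_mult_indicator[of A lborel g] that g by simp
  have *: "(LINT x|lborel. indicator A x * g x) = 0" if "A \<in> sets borel" for A
  proof -
    have "Int_stable (Collect closed :: 'a set set)"
      by (auto simp: Int_stable_def)
    moreover have "Collect closed \<subseteq> Pow (UNIV :: 'a set)" by simp
    moreover have "A \<in> sigma_sets UNIV (Collect closed)"
      using that unfolding borel_eq_closed by simp
    ultimately show ?thesis
    proof (induction rule: sigma_sets_induct_disjoint)
      case (basic A)
      then show ?case using zero by simp
    next
      case empty
      then show ?case by simp
    next
      case (compl A)
      then have A [measurable]: "A \<in> sets borel" by (simp add: borel_eq_closed)
      have "(LINT x|lborel. indicator (UNIV - A) x * g x) =
          (LINT x|lborel. indicator UNIV x * g x - indicator A x * g x)"
        by (intro Bochner_Integration.integral_cong) (auto simp: indicator_def)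
      also have "\<dots> = 0"
        using compl(2) zero[of UNIV] int[of UNIV] int[OF A] by (subst Bochner_Integration.integral_diff) simp_all
      finally show ?case .
    next
      case (union A)
      then have A [measurable]: "A i \<in> sets borel" for i by (auto simp: borel_eq_closed)
      have "(LINT x:(\<Union>i. A i)|lborel. g x) = (\<Sum>i. LINT x:A i|lborel. g x)"
        using union(1) int[of "\<Union>i. A i"]
        by (intro lebesgue_integral_countable_add) (auto simp: disjoint_family_on_def set_integrable_def)
      then show ?case
        using union(3) by (simp add: set_lebesgue_integral_def)
    qed
  qed
  have "AE x in lborel. indicator {x. g x > 0} x * g x = 0"
    using *[of "{x. g x > 0}"] int[of "{x. g x > 0}"]
    by (subst integral_nonneg_eq_0_iff_AE[symmetric]) (auto simp: indicator_def)
  moreover have "AE x in lborel. - (indicator {x. g x < 0} x * g x) = 0"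
    using *[of "{x. g x < 0}"] int[of "{x. g x < 0}"]
    by (subst integral_nonneg_eq_0_iff_AE[symmetric]) (auto simp: indicator_def)
  ultimately show ?thesis
    by eventually_elim (auto simp: indicator_def split: if_splits intro: antisym)
qed

text \<open>Vanishing of the integrals against bounded continuous functions passes to indicators of
  closed sets, which are pointwise limits of cut-off distance functions.\<close>

theorem fourier_eq_zero_imp_AE_zero:
  fixes g :: "'a::euclidean_space \<Rightarrow> complex"
  assumes g: "integrable lborel g" and zero: "\<And>\<xi>. fourier g \<xi> = 0"
  shows "AE x in lborel. g x = 0"
proof -
  have [measurable]: "g \<in> borel_measurable borel" using g by auto
  have *: "(LINT x|lborel. of_real (indicator F x) * g x) = 0" if F: "closed F" for F :: "'a set"
  \<comment> \<open>\<open>infdist x {}\<close> is 0 by convention, so for the empty set the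
    cut-offs would be constantly 1.\<close>
  proof (cases "F = {}")
    case False
    have [measurable]: "F \<in> sets borel" using F by simp
    define w where "w m x = complex_of_real (max 0 (1 - real m * infdist x F))" for m x
    have w1: "norm (w m x) \<le> 1" for m x
      using infdist_nonneg[of x F] by (auto simp: w_def)
    have cw: "continuous_on UNIV (w m)" for m
      unfolding w_def by (intro continuous_intros)
    then have [measurable]: "w m \<in> borel_measurable borel" for m
      by (rule borel_measurable_continuous_onI)
    have "(\<lambda>m. LINT x|lborel. g x * w m x) \<longlonglongrightarrow> (LINT x|lborel. of_real (indicator F x) * g x)"
    proof (rule integral_dominated_convergence)
      show "integrable lborel (\<lambda>x. norm (g x))" using g by simp
      show "AE x in lborel. norm (g x * w m x) \<le> norm (g x)" for m
        using w1 by (auto simp: norm_mult intro!: mult_left_le)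
      show "AE x in lborel. (\<lambda>m. g x * w m x) \<longlonglongrightarrow> of_real (indicator F x) * g x"
      proof (intro AE_I2)
        fix x
        show "(\<lambda>m. g x * w m x) \<longlonglongrightarrow> of_real (indicator F x) * g x"
        proof (cases "x \<in> F")
          case True
          then show ?thesis by (simp add: w_def)
        next
          case False
          then have d: "infdist x F > 0"
            using F \<open>F \<noteq> {}\<close> infdist_pos_not_in_closed by blast
          have "eventually (\<lambda>m. w m x = 0) sequentially"
          proof -
            have "eventually (\<lambda>m. real m \<ge> 1 / infdist x F) sequentially"
              by real_asymp
            then show ?thesis
              by eventually_elim (use d in \<open>auto simp: w_def field_simps max_def\<close>)
          qed
          then have "eventually (\<lambda>m. g x * w m x = 0) sequentially"
            by eventually_elim simp
          then show ?thesis
            using False by (simp add: tendsto_eventually)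
        qed
      qed
    qed measurable
    then show ?thesis
      unfolding fourier_eq_zero_imp_integral_zero[OF g zero cw w1] by (simp add: LIMSEQ_const_iff)
  qed simp
  have int: "integrable lborel (\<lambda>x. of_real (indicator F x) * g x)" if "closed F" for F
    using integrable_mult_indicator[of F lborel g] that g by (simp add: scaleR_conv_of_real)
  have "AE x in lborel. Re (g x) = 0"
  proof (rule AE_zero_of_closed_integrals)
    show "(LINT x|lborel. indicator F x * Re (g x)) = 0" if "closed F" for F
      using arg_cong[OF *[OF that], of Re] int[OF that] by (subst (asm) integral_Re[symmetric]) auto
  qed (use g in auto)
  moreover have "AE x in lborel. Im (g x) = 0"
  proof (rule AE_zero_of_closed_integrals)
    show "(LINT x|lborel. indicator F x * Im (g x)) = 0" if "closed F" for F
      using arg_cong[OF *[OF that], of Im] int[OF that] by (subst (asm) integral_Im[symmetric]) auto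
  qed (use g in auto)
  ultimately show ?thesis
    by eventually_elim (simp add: complex_eq_iff)
qed

section \<open>The Fourier transform on the Schwartz space\<close>

text \<open>Each factor \<open>1 + norm x ^ 2\<close> is at least
  \<open>1 + (x \<bullet> b) ^ 2\<close> for its own basis vector \<open>b\<close>, so the power
  dominates a product of one-variable functions with integrable reciprocals. This is the dominating
  weight for Schwartz functions below.\<close>

lemma integrable_inverse_japanese:
  "integrable lborel (\<lambda>x::'a::euclidean_space. 1 / (1 + norm x ^ 2) ^ DIM('a))"
proof (rule Bochner_Integration.integrable_bound)
  have "integrable lborel (\<lambda>t::real. inverse (1 + t ^ 2))"
    using integrable_inverse_1_plus_square by (simp add: einterval_def set_integrable_def)
  then have "integrable lborel (\<lambda>t::real. complex_of_real (inverse (1 + t ^ 2)))"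
    by (rule integrable_of_real)
  then show "integrable lborel (\<lambda>x::'a. \<Prod>b\<in>Basis. complex_of_real (inverse (1 + (x \<bullet> b) ^ 2)))"
    by (rule lborel_integrable_prod)
  have "1 / (1 + norm x ^ 2) ^ DIM('a) \<le> (\<Prod>b\<in>Basis. inverse (1 + (x \<bullet> b) ^ 2))" for x :: 'a
  proof -
    have "(\<Prod>b\<in>Basis. 1 + (x \<bullet> b) ^ 2) \<le> (\<Prod>b\<in>(Basis :: 'a set). 1 + norm x ^ 2)"
    proof (rule prod_mono)
      fix b :: 'a assume "b \<in> Basis"
      then show "0 \<le> 1 + (x \<bullet> b) ^ 2 \<and> 1 + (x \<bullet> b) ^ 2 \<le> 1 + norm x ^ 2"
        using power_mono[OF Basis_le_norm[of b x], of 2] by simp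
    qed
    moreover have "(\<Prod>b\<in>(Basis :: 'a set). 1 + (x \<bullet> b) ^ 2) > 0"
      by (intro prod_pos) (simp add: add_pos_nonneg)
    ultimately show ?thesis
      by (simp add: prod_inversef[unfolded o_def] divide_inverse le_imp_inverse_le)
  qed
  then show "AE x::'a in lborel. norm (1 / (1 + norm x ^ 2) ^ DIM('a)) \<le>
      norm (\<Prod>b\<in>Basis. complex_of_real (inverse (1 + (x \<bullet> b) ^ 2)))"
    by (simp add: norm_mult norm_power prod_norm[symmetric] norm_inverse abs_of_nonneg flip: of_real_add of_real_power del: of_real_add of_real_power)
qed simp

lemma japanese_power_le: "(1 + r ^ 2) ^ N \<le> 2 ^ N * (1 + r ^ (2 * N))" if "r \<ge> 0" for r :: real
proof -
  have "(1 + r ^ 2) ^ N \<le> (2 * max 1 (r ^ 2)) ^ N"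
    by (intro power_mono) auto
  also have "\<dots> = 2 ^ N * max 1 (r ^ 2) ^ N"
    by (simp add: power_mult_distrib)
  also have "max 1 (r ^ 2) ^ N \<le> 1 + r ^ (2 * N)"
    using that by (auto simp: max_def power_mult)
  finally show ?thesis by simp
qed

text \<open>The bounds of order \<open>k\<close> and \<open>k + 2 * N\<close> together control
  multiplication by \<open>(1 + norm x ^ 2) ^ N\<close>; the choice \<open>N = DIM('a)\<close> gives
  integrability.\<close>

lemma schwartz_decay:
  fixes f :: "'a::euclidean_space \<Rightarrow> 'b::real_normed_vector"
  assumes "schwartz f"
  obtains B where "B > 0" "\<And>x. norm x ^ k * norm (f x) \<le> B * (1 / (1 + norm x ^ 2) ^ N)"
proof -
  obtain B where B: "B > 0" "\<And>x. norm x ^ k * norm (f x) \<le> B"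
    using schwartz_bound[OF assms, of k] by blast
  obtain C where C: "C > 0" "\<And>x. norm x ^ (k + 2 * N) * norm (f x) \<le> C"
    using schwartz_bound[OF assms, of "k + 2 * N"] by blast
  have "norm x ^ k * norm (f x) \<le> 2 ^ N * (B + C) * (1 / (1 + norm x ^ 2) ^ N)" for x
  proof -
    have "(1 + norm x ^ 2) ^ N * (norm x ^ k * norm (f x)) \<le> 2 ^ N * (1 + norm x ^ (2 * N)) * (norm x ^ k * norm (f x))"
      by (intro mult_right_mono japanese_power_le) auto
    also have "\<dots> = 2 ^ N * (norm x ^ k * norm (f x) + norm x ^ (k + 2 * N) * norm (f x))"
      by (simp add: algebra_simps power_add)
    also have "\<dots> \<le> 2 ^ N * (B + C)"
      by (intro mult_left_mono add_mono B C) auto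
    finally show ?thesis
      by (simp add: field_simps add_pos_nonneg)
  qed
  with B(1) C(1) show ?thesis by (intro that[of "2 ^ N * (B + C)"]) auto
qed

lemma schwartz_integrable_norm_power:
  fixes f :: "'a::euclidean_space \<Rightarrow> 'b::{banach, second_countable_topology}"
  assumes f: "schwartz f"
  shows "integrable lborel (\<lambda>x. norm x ^ k * norm (f x))"
proof -
  have [measurable]: "f \<in> borel_measurable borel" by (rule schwartz_borel_measurable[OF f])
  obtain B where "B > 0" "\<And>x. norm x ^ k * norm (f x) \<le> B * (1 / (1 + norm x ^ 2) ^ DIM('a))"
    by (rule schwartz_decay[OF f]) blast
  then show ?thesis
    by (intro Bochner_Integration.integrable_bound[OF integrable_mult_right[OF integrable_inverse_japanese, of B]]) auto
qed

lemma schwartz_integrable: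
  fixes f :: "'a::euclidean_space \<Rightarrow> 'b::{banach, second_countable_topology}"
  assumes f: "schwartz f"
  shows "integrable lborel f"
proof -
  have [measurable]: "f \<in> borel_measurable borel" by (rule schwartz_borel_measurable[OF f])
  show ?thesis
    by (rule Bochner_Integration.integrable_bound[OF schwartz_integrable_norm_power[OF f, of 0]]) auto
qed

text \<open>Difference quotients in direction \<open>b\<close> integrate to 0 by translation
  invariance, and they converge to the partial derivative under a common integrable bound.\<close>

lemma schwartz_integral_partial_eq_0:
  fixes f :: "'a::euclidean_space \<Rightarrow> complex"
  assumes f: "schwartz f" and b: "b \<in> Basis"
  shows "(LINT x|lborel. frechet_derivative f (at x) b) = 0"
proof -
  let ?D = "\<lambda>x. frechet_derivative f (at x) b"
  have D: "schwartz ?D" by (rule schwartz_partial[OF f b])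
  have [measurable]: "f \<in> borel_measurable borel" "?D \<in> borel_measurable borel"
    by (rule schwartz_borel_measurable[OF f] schwartz_borel_measurable[OF D])+
  obtain B where B: "B > 0" "\<And>x. norm x ^ 0 * norm (?D x) \<le> B * (1 / (1 + norm x ^ 2) ^ DIM('a))"
    by (rule schwartz_decay[OF D]) blast
  define h where "h m = 1 / real (Suc m)" for m
  have h: "h m > 0" "h m \<le> 1" for m by (auto simp: h_def)
  have h0: "h \<longlonglongrightarrow> 0" unfolding h_def using LIMSEQ_inverse_real_of_nat by (simp add: inverse_eq_divide)
  define q where "q m x = (1 / h m) *\<^sub>R (f (x + h m *\<^sub>R b) - f x)" for m x
  have deriv: "((\<lambda>\<theta>. f (x + \<theta> *\<^sub>R b)) has_derivative (\<lambda>s. s *\<^sub>R ?D (x + \<theta> *\<^sub>R b))) (at \<theta> within S)" for x \<theta> S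
  proof -
    have "((\<lambda>\<theta>. f (x + \<theta> *\<^sub>R b)) has_derivative (\<lambda>s. frechet_derivative f (at (x + \<theta> *\<^sub>R b)) (s *\<^sub>R b))) (at \<theta> within S)"
      by (rule has_derivative_compose[OF _ schwartz_has_derivative[OF f]])
        (auto intro!: derivative_eq_intros)
    then show ?thesis
      using linear_cmul[OF has_derivative_linear[OF schwartz_has_derivative[OF f]]] by simp
  qed
  \<comment> \<open>By the mean value inequality the quotient is bounded by the derivative on a
    segment of length at most 1. There \<open>1 + norm x ^ 2\<close> is at most 3 times its value at
    the intermediate point, whence \<open>3 ^ DIM('a)\<close>.\<close>
  have qbound: "norm (q m x) \<le> 3 ^ DIM('a) * B * (1 / (1 + norm x ^ 2) ^ DIM('a))" for m x
  proof -
    have D_le: "norm (?D (x + \<theta> *\<^sub>R b)) \<le> 3 ^ DIM('a) * B * (1 / (1 + norm x ^ 2) ^ DIM('a))"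
      if \<theta>: "\<theta> \<in> {0..h m}" for \<theta>
    proof -
      let ?y = "x + \<theta> *\<^sub>R b"
      have "norm x \<le> norm ?y + norm (\<theta> *\<^sub>R b)"
        using norm_triangle_ineq4[of ?y "\<theta> *\<^sub>R b"] by simp
      then have "norm x \<le> norm ?y + 1"
        using \<theta> h(2)[of m] b by simp
      then have "norm x ^ 2 \<le> (norm ?y + 1) ^ 2"
        by (intro power_mono) auto
      also have "\<dots> \<le> 2 * norm ?y ^ 2 + 2"
        using sum_squares_bound[of "norm ?y" 1] by (simp add: power2_sum)
      finally have le: "norm x ^ 2 \<le> 2 * norm ?y ^ 2 + 2" .
      have "1 + r \<le> 3 * (1 + s)" if "r \<le> 2 * s + 2" "0 \<le> s" for r s :: real
        using that by simp
      from this[OF le] have "1 + norm x ^ 2 \<le> 3 * (1 + norm ?y ^ 2)" by simp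
      then have "(1 + norm x ^ 2) ^ DIM('a) \<le> (3 * (1 + norm ?y ^ 2)) ^ DIM('a)"
        by (intro power_mono) auto
      then have "1 / (1 + norm ?y ^ 2) ^ DIM('a) \<le> 3 ^ DIM('a) * (1 / (1 + norm x ^ 2) ^ DIM('a))"
        unfolding power_mult_distrib by (simp add: field_simps add_pos_nonneg)
      then have "B * (1 / (1 + norm ?y ^ 2) ^ DIM('a)) \<le> B * (3 ^ DIM('a) * (1 / (1 + norm x ^ 2) ^ DIM('a)))"
        using B(1) by (intro mult_left_mono) auto
      then show ?thesis using B(2)[of ?y] by (simp add: mult_ac)
    qed
    have "norm (f (x + h m *\<^sub>R b) - f (x + 0 *\<^sub>R b)) \<le>
        (3 ^ DIM('a) * B * (1 / (1 + norm x ^ 2) ^ DIM('a))) * norm (h m - 0)"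
    proof (rule differentiable_bound[of "{0..h m}" _ "\<lambda>\<theta> s. s *\<^sub>R ?D (x + \<theta> *\<^sub>R b)"])
      show "onorm (\<lambda>s. s *\<^sub>R ?D (x + \<theta> *\<^sub>R b)) \<le> 3 ^ DIM('a) * B * (1 / (1 + norm x ^ 2) ^ DIM('a))"
        if "\<theta> \<in> {0..h m}" for \<theta>
        using mult_left_mono[OF D_le[OF that] abs_ge_zero] by (intro onorm_le) (simp add: mult.commute)
    qed (use deriv h(1)[of m] in auto)
    moreover have "norm (q m x) = norm (f (x + h m *\<^sub>R b) - f (x + 0 *\<^sub>R b)) / h m"
      using h(1)[of m] by (simp add: q_def)
    ultimately show ?thesis
      using pos_divide_le_eq[THEN iffD2, OF h(1)[of m]] h(1)[of m] by (metis abs_of_pos diff_zero real_norm_def)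
  qed
  have qint: "(LINT x|lborel. q m x) = 0" for m
  proof -
    have i: "integrable lborel f" by (rule schwartz_integrable[OF f])
    have i': "integrable lborel (\<lambda>x. f (x + h m *\<^sub>R b))"
      using lborel_integrable_affine[OF i, of 1 "h m *\<^sub>R b"] by (simp add: add.commute)
    have "(LINT x|lborel. f (x + h m *\<^sub>R b)) = (LINT x|lborel. f x)"
      using lborel_integral_affine[of f 1 "h m *\<^sub>R b"] by (simp add: add.commute)
    then show ?thesis
      unfolding q_def using i i' by (simp add: Bochner_Integration.integral_diff)
  qed
  have "(\<lambda>m. LINT x|lborel. q m x) \<longlonglongrightarrow> (LINT x|lborel. ?D x)"
  proof (rule integral_dominated_convergence)
    show "q m \<in> borel_measurable lborel" for m unfolding q_def by measurable
    show "integrable lborel (\<lambda>x::'a. 3 ^ DIM('a) * B * (1 / (1 + norm x ^ 2) ^ DIM('a)))"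
      by (intro integrable_mult_right integrable_inverse_japanese)
    show "AE x in lborel. norm (q m x) \<le> 3 ^ DIM('a) * B * (1 / (1 + norm x ^ 2) ^ DIM('a))" for m
      using qbound by simp
    have "(\<lambda>m. q m x) \<longlonglongrightarrow> ?D x" for x
    proof -
      have lim: "((\<lambda>s. norm (f (x + s *\<^sub>R b) - f x - s *\<^sub>R ?D x) / norm s) \<longlongrightarrow> 0) (at 0)"
        using deriv[of x 0 UNIV] by (simp add: has_derivative_at)
      have eq: "norm (f (x + s *\<^sub>R b) - f x - s *\<^sub>R ?D x) / norm s =
          norm ((f (x + s *\<^sub>R b) - f x) /\<^sub>R s - ?D x)" if "s \<noteq> 0" for s
      proof -
        have "(f (x + s *\<^sub>R b) - f x) /\<^sub>R s - ?D x = (f (x + s *\<^sub>R b) - f x - s *\<^sub>R ?D x) /\<^sub>R s"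
          using that by (simp add: scaleR_diff_right)
        then show ?thesis by (simp add: divide_inverse_commute)
      qed
      have "eventually (\<lambda>s. norm (f (x + s *\<^sub>R b) - f x - s *\<^sub>R ?D x) / norm s =
          norm ((f (x + s *\<^sub>R b) - f x) /\<^sub>R s - ?D x)) (at 0)"
        unfolding eventually_at_filter using eq by (intro always_eventually) blast
      with lim have "((\<lambda>s. norm ((f (x + s *\<^sub>R b) - f x) /\<^sub>R s - ?D x)) \<longlongrightarrow> 0) (at 0)"
        by (rule Lim_transform_eventually)
      then have "((\<lambda>s. (f (x + s *\<^sub>R b) - f x) /\<^sub>R s) \<longlongrightarrow> ?D x) (at 0)"
        by (rule LIM_zero_cancel[OF tendsto_norm_zero_cancel])
      moreover have "filterlim h (at 0) sequentially"
        using h0 by (auto simp: filterlim_at h_def)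
      ultimately have "(\<lambda>m. (f (x + h m *\<^sub>R b) - f x) /\<^sub>R h m) \<longlonglongrightarrow> ?D x"
        by (rule filterlim_compose)
      then show ?thesis by (simp add: q_def inverse_eq_divide)
    qed
    then show "AE x in lborel. (\<lambda>m. q m x) \<longlonglongrightarrow> ?D x" by simp
  qed measurable
  then show ?thesis by (simp add: qint LIMSEQ_const_iff)
qed

text \<open>The derivative of \<open>f\<close> times the character of frequency
  \<open>- \<xi>\<close> has integral 0, and the product rule splits this integral into the two
  terms compared here.\<close>

lemma fourier_partial:
  fixes f :: "'a::euclidean_space \<Rightarrow> complex"
  assumes f: "schwartz f" and b: "b \<in> Basis"
  shows "fourier (\<lambda>x. frechet_derivative f (at x) b) \<xi> = \<i> * of_real (\<xi> \<bullet> b) * fourier f \<xi>"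
proof -
  let ?D = "\<lambda>x. frechet_derivative f (at x) b"
  have D: "schwartz ?D" by (rule schwartz_partial[OF f b])
  have [measurable]: "f \<in> borel_measurable borel" "?D \<in> borel_measurable borel"
    by (rule schwartz_borel_measurable[OF f] schwartz_borel_measurable[OF D])+
  define e where "e x = exp (\<i> * of_real (x \<bullet> (- \<xi>)))" for x
  have d: "((\<lambda>x. e x * f x) has_derivative
      (\<lambda>v. e x * (frechet_derivative f (at x) v + \<i> * of_real (v \<bullet> (- \<xi>)) * f x))) (at x)" for x
  proof -
    have "(e has_derivative (\<lambda>v. e x * (\<i> * of_real (v \<bullet> (- \<xi>))))) (at x)"
      unfolding e_def
      by (rule has_derivative_eq_rhs, rule has_derivative_compose[OF _ DERIV_exp[unfolded has_field_derivative_def]])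
        (auto intro!: derivative_eq_intros)
    from has_derivative_mult[OF this schwartz_has_derivative[OF f]] show ?thesis
      by (simp add: algebra_simps)
  qed
  have "schwartz (\<lambda>x. e x * f x)"
    unfolding e_def by (rule schwartz_character_mult[OF f])
  from schwartz_integral_partial_eq_0[OF this b]
  have "0 = (LINT x|lborel. e x * (?D x + \<i> * of_real (b \<bullet> (- \<xi>)) * f x))"
    unfolding frechet_derivative_eq[OF d] by simp
  also have "\<dots> = (LINT x|lborel. exp (- \<i> * complex_of_real (x \<bullet> \<xi>)) * ?D x -
      (\<i> * of_real (\<xi> \<bullet> b)) * (exp (- \<i> * complex_of_real (x \<bullet> \<xi>)) * f x))"
    by (simp add: e_def algebra_simps inner_commute)
  also have "\<dots> = fourier ?D \<xi> - \<i> * of_real (\<xi> \<bullet> b) * fourier f \<xi>"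
    by (subst Bochner_Integration.integral_diff)
      (simp_all only: fourier_integrable schwartz_integrable f D integrable_mult_right integral_mult_right_zero
        fourier_lborel schwartz_borel_measurable)
  finally show ?thesis by simp
qed

text \<open>Differentiation under the integral sign with an explicit remainder: the first-order
  Taylor error of the character is at most \<open>norm v ^ 2 * norm x ^ 2\<close>, and
  \<open>f\<close> has a finite second moment.\<close>

lemma fourier_has_derivative:
  fixes f :: "'a::euclidean_space \<Rightarrow> complex"
  assumes f: "schwartz f"
  shows "(fourier f has_derivative (\<lambda>v. fourier (\<lambda>x. - \<i> * of_real (x \<bullet> v) * f x) \<xi>)) (at \<xi>)"
proof -
  have [measurable]: "f \<in> borel_measurable borel" by (rule schwartz_borel_measurable[OF f])
  have int: "integrable lborel (\<lambda>x. - \<i> * of_real (x \<bullet> v) * f x)" for v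
  proof (rule Bochner_Integration.integrable_bound)
    show "integrable lborel (\<lambda>x. norm v * (norm x ^ 1 * norm (f x)))"
      by (intro integrable_mult_right schwartz_integrable_norm_power f)
    show "AE x in lborel. norm (- \<i> * of_real (x \<bullet> v) * f x) \<le> norm (norm v * (norm x ^ 1 * norm (f x)))"
      by (intro AE_I2) (simp add: norm_mult mult.assoc[symmetric] mult.commute[of "norm v"]
          mult_right_mono Cauchy_Schwarz_ineq2)
  qed measurable
  define I1 where "I1 = (LINT x|lborel. norm x ^ 1 * norm (f x))"
  define I2 where "I2 = (LINT x|lborel. norm x ^ 2 * norm (f x))"
  let ?f' = "\<lambda>v. fourier (\<lambda>x. - \<i> * of_real (x \<bullet> v) * f x) \<xi>"
  show ?thesis
  proof (rule has_derivativeI_sandwich[of 1])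
    show "bounded_linear ?f'"
    proof (rule bounded_linear_intro[of _ I1])
      fix v w :: 'a and r :: real
      have "?f' (v + w) = (LINT x|lborel. exp (- \<i> * complex_of_real (x \<bullet> \<xi>)) * (- \<i> * of_real (x \<bullet> v) * f x) +
          exp (- \<i> * complex_of_real (x \<bullet> \<xi>)) * (- \<i> * of_real (x \<bullet> w) * f x))"
        by (subst fourier_lborel) (auto simp: algebra_simps inner_add_right)
      also have "\<dots> = ?f' v + ?f' w"
        by (subst Bochner_Integration.integral_add[OF fourier_integrable[OF int] fourier_integrable[OF int]])
          (simp add: fourier_lborel)
      finally show "?f' (v + w) = ?f' v + ?f' w" .
      have "?f' (r *\<^sub>R v) = (LINT x|lborel. r *\<^sub>R (exp (- \<i> * complex_of_real (x \<bullet> \<xi>)) * (- \<i> * of_real (x \<bullet> v) * f x)))"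
        by (subst fourier_lborel) (auto simp: algebra_simps scaleR_conv_of_real)
      also have "\<dots> = r *\<^sub>R ?f' v"
        by (subst integral_scaleR_right) (auto simp: fourier_lborel)
      finally show "?f' (r *\<^sub>R v) = r *\<^sub>R ?f' v" .
      have "norm (?f' v) \<le> (LINT x|lborel. norm (- \<i> * of_real (x \<bullet> v) * f x))"
        by (rule norm_fourier_le[OF int])
      also have "\<dots> \<le> (LINT x|lborel. norm v * (norm x ^ 1 * norm (f x)))"
        by (intro integral_mono integrable_norm int integrable_mult_right schwartz_integrable_norm_power f)
          (simp add: norm_mult mult.assoc[symmetric] mult.commute[of "norm v"]
            mult_right_mono Cauchy_Schwarz_ineq2)
      also have "\<dots> = norm v * I1" by (simp add: I1_def)
      finally show "norm (?f' v) \<le> norm v * I1" .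
    qed
    show "((\<lambda>\<eta>. norm (\<eta> - \<xi>) * I2) \<longlongrightarrow> 0) (at \<xi>)"
      by (rule tendsto_eq_intros refl)+ auto
    fix \<eta> assume "\<eta> \<noteq> \<xi>"
    let ?v = "\<eta> - \<xi>"
    have "fourier f \<eta> - fourier f \<xi> - ?f' ?v = (LINT x|lborel. exp (- \<i> * complex_of_real (x \<bullet> \<eta>)) * f x -
        exp (- \<i> * complex_of_real (x \<bullet> \<xi>)) * f x -
        exp (- \<i> * complex_of_real (x \<bullet> \<xi>)) * (- \<i> * of_real (x \<bullet> ?v) * f x))"
      using fourier_integrable[OF schwartz_integrable[OF f]] fourier_integrable[OF int]
      by (simp only: Bochner_Integration.integral_diff Bochner_Integration.integrable_diff)
        (simp add: fourier_lborel)
    also have "norm \<dots> \<le> (LINT x|lborel. norm ?v ^ 2 * (norm x ^ 2 * norm (f x)))"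
    proof (rule order.trans[OF integral_norm_bound], rule integral_mono)
      show "integrable lborel (\<lambda>x. norm ?v ^ 2 * (norm x ^ 2 * norm (f x)))"
        by (intro integrable_mult_right schwartz_integrable_norm_power f)
      show "integrable lborel (\<lambda>x. norm (exp (- \<i> * complex_of_real (x \<bullet> \<eta>)) * f x -
        exp (- \<i> * complex_of_real (x \<bullet> \<xi>)) * f x -
        exp (- \<i> * complex_of_real (x \<bullet> \<xi>)) * (- \<i> * of_real (x \<bullet> ?v) * f x)))"
        using fourier_integrable[OF schwartz_integrable[OF f]] fourier_integrable[OF int]
        by (intro integrable_norm Bochner_Integration.integrable_diff) auto
      fix x
      have "exp (- \<i> * complex_of_real (x \<bullet> \<eta>)) * f x - exp (- \<i> * complex_of_real (x \<bullet> \<xi>)) * f x -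
          exp (- \<i> * complex_of_real (x \<bullet> \<xi>)) * (- \<i> * of_real (x \<bullet> ?v) * f x) =
        exp (- \<i> * complex_of_real (x \<bullet> \<xi>)) * f x *
          (iexp (- (x \<bullet> ?v)) - (\<Sum>k\<le>1. (\<i> * complex_of_real (- (x \<bullet> ?v))) ^ k / fact k))"
        by (simp add: algebra_simps inner_diff_right flip: exp_add)
      also have "norm \<dots> \<le> norm (f x) * (\<bar>- (x \<bullet> ?v)\<bar> ^ 2 / 2)"
      proof -
        have "norm (iexp (- (x \<bullet> ?v)) - (\<Sum>k\<le>1. (\<i> * complex_of_real (- (x \<bullet> ?v))) ^ k / fact k)) \<le>
            \<bar>- (x \<bullet> ?v)\<bar> ^ 2 / 2"
          using iexp_approx1[of "- (x \<bullet> ?v)" 1] by (simp only: Suc_1 fact_2)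
        moreover have "norm (exp (- \<i> * complex_of_real (x \<bullet> \<xi>)) * f x) = norm (f x)"
          by (simp add: norm_mult)
        ultimately show ?thesis
          unfolding norm_mult[of "_ * f x"] by (simp only: mult_left_mono norm_ge_zero)
      qed
      also have "\<dots> \<le> norm (f x) * ((norm x * norm ?v) ^ 2)"
      proof (rule mult_left_mono)
        have "\<bar>x \<bullet> ?v\<bar> ^ 2 \<le> (norm x * norm ?v) ^ 2"
          by (intro power_mono Cauchy_Schwarz_ineq2) auto
        moreover have "r / 2 \<le> s" if "r \<le> s" "0 \<le> s" for r s :: real
          using that by simp
        ultimately show "\<bar>- (x \<bullet> ?v)\<bar> ^ 2 / 2 \<le> (norm x * norm ?v) ^ 2"
          unfolding abs_minus_cancel using zero_le_power2 by blast
      qed auto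
      finally show "norm (exp (- \<i> * complex_of_real (x \<bullet> \<eta>)) * f x - exp (- \<i> * complex_of_real (x \<bullet> \<xi>)) * f x -
          exp (- \<i> * complex_of_real (x \<bullet> \<xi>)) * (- \<i> * of_real (x \<bullet> ?v) * f x)) \<le>
          norm ?v ^ 2 * (norm x ^ 2 * norm (f x))"
        by (simp add: power_mult_distrib mult_ac)
    qed
    also have "\<dots> = norm ?v ^ 2 * I2" by (simp add: I2_def)
    finally show "norm (fourier f \<eta> - fourier f \<xi> - ?f' ?v) / norm ?v \<le> norm ?v * I2"
      using \<open>\<eta> \<noteq> \<xi>\<close> by (simp add: field_simps power2_eq_square)
  qed simp
qed

text \<open>The set of transforms of Schwartz functions is invariant: a partial derivative of a
  transform is, up to a constant, the transform of a coordinate times \<open>f\<close>, and powers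
  of the frequency are absorbed by derivatives of \<open>f\<close>.\<close>

theorem schwartz_fourier:
  fixes f :: "'a::euclidean_space \<Rightarrow> complex"
  assumes "schwartz f"
  shows "schwartz (fourier f)"
proof (rule schwartz_coinduct[of _ "{fourier f | f. schwartz f}"])
  fix h :: "'a \<Rightarrow> complex" assume "h \<in> {fourier f | f. schwartz f}"
  then obtain f where f: "schwartz f" and h: "h = fourier f" by blast
  show "h differentiable (at x)" for x
    unfolding h differentiable_def using fourier_has_derivative[OF f] by blast
  \<comment> \<open>\<open>f\<close> varies in the induction: one factor \<open>norm \<xi>\<close>
    is at most the sum of the absolute coordinates, and each coordinate replaces \<open>f\<close> by
    a partial derivative.\<close>
  have bdd: "\<exists>B. \<forall>\<xi>. norm \<xi> ^ k * norm (fourier f \<xi>) \<le> B" if "schwartz f" for f :: "'a \<Rightarrow> complex" and k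
    using that
  proof (induction k arbitrary: f)
    case 0
    then show ?case using norm_fourier_le[OF schwartz_integrable[OF 0]] by auto
  next
    case (Suc k)
    then have "\<forall>b\<in>Basis. \<exists>B. \<forall>\<xi>. norm \<xi> ^ k * norm (fourier (\<lambda>x. frechet_derivative f (at x) b) \<xi>) \<le> B"
      using schwartz_partial by blast
    then obtain B where B: "\<And>b \<xi>. b \<in> Basis \<Longrightarrow>
        norm \<xi> ^ k * norm (fourier (\<lambda>x. frechet_derivative f (at x) b) \<xi>) \<le> B b"
      by metis
    have "norm \<xi> ^ Suc k * norm (fourier f \<xi>) \<le> sum B Basis" for \<xi>
    proof -
      have "norm \<xi> ^ Suc k * norm (fourier f \<xi>) \<le> (\<Sum>b\<in>Basis. \<bar>\<xi> \<bullet> b\<bar>) * (norm \<xi> ^ k * norm (fourier f \<xi>))"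
        using norm_le_l1[of \<xi>] by (simp add: mult_right_mono mult.assoc)
      also have "\<dots> = (\<Sum>b\<in>Basis. norm \<xi> ^ k * norm (fourier (\<lambda>x. frechet_derivative f (at x) b) \<xi>))"
        unfolding sum_distrib_right
        by (intro sum.cong refl) (simp add: fourier_partial[OF Suc.prems] norm_mult)
      also have "\<dots> \<le> sum B Basis"
        by (intro sum_mono B)
      finally show ?thesis .
    qed
    then show ?case by blast
  qed
  show "bounded (range (\<lambda>x. norm x ^ k *\<^sub>R h x))" for k
    using bdd[OF f, of k] by (auto simp: h bounded_iff)
  fix b :: 'a
  have "schwartz (\<lambda>x. - \<i> * ((x \<bullet> b) *\<^sub>R f x))"
    by (intro schwartz_cmult schwartz_coordinate_mult f)
  then have "schwartz (\<lambda>x. - \<i> * of_real (x \<bullet> b) * f x)"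
    by (simp add: scaleR_conv_of_real mult.assoc)
  then show "(\<lambda>x. frechet_derivative h (at x) b) \<in> {fourier f | f. schwartz f}"
    unfolding h frechet_derivative_eq[OF fourier_has_derivative[OF f]]
    by (intro CollectI exI[of _ "\<lambda>x. - \<i> * of_real (x \<bullet> b) * f x"] conjI) (auto intro!: ext)
qed (use assms in blast)

theorem schwartz_fourier_inversion:
  fixes f :: "'a::euclidean_space \<Rightarrow> complex"
  assumes f: "schwartz f"
  shows "fourier (fourier f) (- y) = of_real ((2 * pi) ^ DIM('a)) * f y"
proof -
  obtain B where "\<And>x. norm x ^ 0 * norm (f x) \<le> B" by (rule schwartz_bound[OF f, where k = 0]) blast
  then show ?thesis
    by (intro fourier_inversion[of _ B] schwartz_integrable schwartz_continuous_on schwartz_fourier f) auto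
qed

section \<open>Lebesgue measurable functions, and Schwartz functions as separating test
  functions\<close>

lemma integrable_lebesgue_ex_lborel:
  fixes g :: "'a::euclidean_space \<Rightarrow> complex"
  assumes g: "integrable lebesgue g"
  obtains g' where "integrable lborel g'" "AE x in lebesgue. g x = g' x"
proof -
  have "(\<lambda>x. Re (g x)) \<in> borel_measurable lebesgue" "(\<lambda>x. Im (g x)) \<in> borel_measurable lebesgue"
    using borel_measurable_integrable[OF g] by measurable
  then obtain r i where r [measurable]: "r \<in> borel_measurable lborel" and re: "AE x in lborel. Re (g x) = r x"
    and i [measurable]: "i \<in> borel_measurable lborel" and ie: "AE x in lborel. Im (g x) = i x"
    by (metis completion_ex_borel_measurable_real)
  have eq: "AE x in lebesgue. g x = Complex (r x) (i x)"
    using re[THEN AE_completion] ie[THEN AE_completion] by eventually_elim (simp add: complex_eq_iff)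
  have m [measurable]: "(\<lambda>x. Complex (r x) (i x)) \<in> borel_measurable borel"
    unfolding Complex_eq using r i by measurable
  have "integrable lebesgue (\<lambda>x. Complex (r x) (i x))"
    by (rule integrable_cong_AE_imp[OF g _ eq]) (rule measurable_completion, use m in simp)
  then have "integrable lborel (\<lambda>x. Complex (r x) (i x))"
    by (subst (asm) integrable_completion) (use m in auto)
  with eq that show ?thesis by blast
qed

lemma fourier_cong_AE:
  fixes g :: "'a::euclidean_space \<Rightarrow> complex"
  assumes g: "integrable lebesgue g" and g': "integrable lborel g'" and eq: "AE x in lebesgue. g x = g' x"
  shows "fourier g = fourier g'"
proof
  fix \<xi> :: 'a
  have e: "(\<lambda>x. exp (- \<i> * complex_of_real (x \<bullet> \<xi>))) \<in> borel_measurable lebesgue"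
    by (intro measurable_completion) measurable
  have m: "g \<in> borel_measurable lebesgue" "g' \<in> borel_measurable lebesgue"
    using g g' by (auto intro: measurable_completion)
  show "fourier g \<xi> = fourier g' \<xi>"
    unfolding fourier_def
    by (rule integral_cong_AE[OF borel_measurable_times[OF e m(1)] borel_measurable_times[OF e m(2)]])
      (use eq in auto)
qed

text \<open>The transform of a kernel is known to be measurable only for the completed measure,
  whereas Fubini is used over Borel sets. Replacing \<open>g\<close> by a Borel version changes
  neither side.\<close>

lemma fourier_multiplication_lebesgue:
  fixes g u :: "'a::euclidean_space \<Rightarrow> complex"
  assumes g: "integrable lebesgue g" and u: "integrable lborel u"
  shows "(LINT x|lborel. fourier g (s *\<^sub>R x) * u x) = (LINT \<xi>|lebesgue. g \<xi> * fourier u (s *\<^sub>R \<xi>))"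
proof -
  obtain g' where g': "integrable lborel g'" and eq: "AE x in lebesgue. g x = g' x"
    by (rule integrable_lebesgue_ex_lborel[OF g])
  have [measurable]: "g' \<in> borel_measurable borel" "u \<in> borel_measurable borel" using g' u by auto
  have [measurable]: "fourier u \<in> borel_measurable borel" by (rule fourier_borel_measurable) measurable
  have "(LINT x|lborel. fourier g (s *\<^sub>R x) * u x) = (LINT \<xi>|lborel. g' \<xi> * fourier u (s *\<^sub>R \<xi>))"
    unfolding fourier_cong_AE[OF g g' eq] by (rule fourier_multiplication[OF g' u])
  also have "\<dots> = (LINT \<xi>|lebesgue. g' \<xi> * fourier u (s *\<^sub>R \<xi>))"
    by (rule integral_completion[symmetric]) measurable
  also have "\<dots> = (LINT \<xi>|lebesgue. g \<xi> * fourier u (s *\<^sub>R \<xi>))"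
  proof (rule integral_cong_AE)
    show "(\<lambda>\<xi>. g' \<xi> * fourier u (s *\<^sub>R \<xi>)) \<in> borel_measurable lebesgue"
      by (rule measurable_completion) measurable
    have "(\<lambda>\<xi>. fourier u (s *\<^sub>R \<xi>)) \<in> borel_measurable lebesgue"
      by (rule measurable_completion) measurable
    then show "(\<lambda>\<xi>. g \<xi> * fourier u (s *\<^sub>R \<xi>)) \<in> borel_measurable lebesgue"
      using borel_measurable_integrable[OF g] by measurable
  qed (use eq in auto)
  finally show ?thesis .
qed

text \<open>Multiplying the difference by a Gaussian makes it integrable, and the transform of the
  product at \<open>\<xi>\<close> is a pairing with a Gaussian times a character, again a Schwartz
  function. So this transform vanishes, and the Gaussian can be divided out.\<close>

lemma schwartz_test_functions_separate:
  fixes h k :: "'a::euclidean_space \<Rightarrow> complex"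
  assumes h: "\<And>\<phi>. schwartz \<phi> \<Longrightarrow> integrable lebesgue (\<lambda>x. h x * \<phi> x)"
    and k: "\<And>\<phi>. schwartz \<phi> \<Longrightarrow> integrable lebesgue (\<lambda>x. k x * \<phi> x)"
    and eq: "\<And>\<phi>. schwartz \<phi> \<Longrightarrow> (LINT x|lebesgue. h x * \<phi> x) = (LINT x|lebesgue. k x * \<phi> x)"
  shows "AE x in lebesgue. h x = k x"
proof -
  define \<gamma> where "\<gamma> x = complex_of_real (exp (- 1 * norm x ^ 2))" for x :: 'a
  have \<gamma>: "schwartz \<gamma>"
    unfolding \<gamma>_def by (intro schwartz_of_real schwartz_gaussian) simp
  define g where "g x = h x * \<gamma> x - k x * \<gamma> x" for x
  have g: "integrable lebesgue g"
    unfolding g_def by (intro Bochner_Integration.integrable_diff h k \<gamma>)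
  obtain g' where g': "integrable lborel g'" and eq': "AE x in lebesgue. g x = g' x"
    by (rule integrable_lebesgue_ex_lborel[OF g])
  have "fourier g \<xi> = 0" for \<xi>
  proof -
    let ?e = "\<lambda>x. exp (\<i> * complex_of_real (x \<bullet> (- \<xi>)))"
    have e: "schwartz (\<lambda>x. ?e x * \<gamma> x)" by (rule schwartz_character_mult[OF \<gamma>])
    have "fourier g \<xi> = (LINT x|lebesgue. h x * (?e x * \<gamma> x) - k x * (?e x * \<gamma> x))"
      unfolding fourier_def g_def by (simp add: algebra_simps)
    also have "\<dots> = 0"
      using h[OF e] k[OF e] eq[OF e] by (subst Bochner_Integration.integral_diff) simp_all
    finally show ?thesis .
  qed
  then have "AE x in lborel. g' x = 0"
    using fourier_cong_AE[OF g g' eq'] by (intro fourier_eq_zero_imp_AE_zero[OF g']) simp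
  then have "AE x in lebesgue. g x = 0"
    using eq' AE_completion by fastforce
  then show ?thesis
    by eventually_elim (simp add: g_def \<gamma>_def)
qed

section \<open>Convolution with a distribution\<close>

lemma induces_induced_distribution: "\<exists>T. induces K T \<Longrightarrow> induces K (induced_distribution K)"
  unfolding induced_distribution_def by (rule someI_ex[of "induces K"])

text \<open>Whichever distribution the choice operator picks, \<open>induces\<close> fixes its value
  wherever the product with \<open>K\<close> is integrable. Real and imaginary parts are evaluated
  separately because distributions act on real functions.\<close>

lemma complex_extension_induced_distribution:
  fixes \<psi> :: "'a::euclidean_space \<Rightarrow> complex"
  assumes K: "\<exists>T. induces K T" and \<psi>: "schwartz \<psi>"
    and int: "integrable lebesgue (\<lambda>x. complex_of_real (K x) * \<psi> x)"
  shows "complex_extension (induced_distribution K) \<psi> = (LINT x|lebesgue. complex_of_real (K x) * \<psi> x)"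
proof -
  have eval: "induced_distribution K \<phi> = (LINT x|lebesgue. K x * \<phi> x)"
    if "schwartz \<phi>" "integrable lebesgue (\<lambda>x. K x * \<phi> x)" for \<phi>
    using induces_induced_distribution[OF K] that unfolding induces_def by blast
  have "induced_distribution K (\<lambda>x. Re (\<psi> x)) = (LINT x|lebesgue. Re (complex_of_real (K x) * \<psi> x))"
    using integrable_Re[OF int] by (subst eval) (auto intro: schwartz_Re \<psi>)
  moreover have "induced_distribution K (\<lambda>x. Im (\<psi> x)) = (LINT x|lebesgue. Im (complex_of_real (K x) * \<psi> x))"
    using integrable_Im[OF int] by (subst eval) (auto intro: schwartz_Im \<psi>)
  ultimately show ?thesis
    unfolding complex_extension_def using integral_Re[OF int] integral_Im[OF int] by (simp add: complex_eq_iff)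
qed

lemma has_fourier_transform_integrable:
  "has_fourier_transform K k \<Longrightarrow> schwartz \<phi> \<Longrightarrow> integrable lebesgue (\<lambda>x. k x * \<phi> x)"
  unfolding has_fourier_transform_def by blast

lemma has_fourier_transform_eq:
  "has_fourier_transform K k \<Longrightarrow> schwartz \<phi> \<Longrightarrow>
    complex_extension (induced_distribution K) (fourier \<phi>) = (LINT x|lebesgue. k x * \<phi> x)"
  unfolding has_fourier_transform_def by blast

lemma has_fourier_transform_unique:
  assumes "has_fourier_transform K k" "has_fourier_transform K l"
  shows "AE x in lebesgue. k x = l x"
  by (rule schwartz_test_functions_separate)
    (use assms has_fourier_transform_integrable has_fourier_transform_eq in \<open>metis+\<close>)

text \<open>By Fourier inversion the translate \<open>f (x - \<cdot>)\<close> is itself a Fourier transform of a Schwartz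
  function, so the convolution is determined by the Fourier transform of the kernel.\<close>

lemma convolution_eq_fourier:
  fixes K f :: "'a::euclidean_space \<Rightarrow> real"
  assumes K: "has_fourier_transform K k" and f: "schwartz f"
  shows "complex_of_real (convolution K f x) =
    fourier (\<lambda>\<xi>. k \<xi> * (of_real (1 / (2 * pi) ^ DIM('a)) * fourier (\<lambda>x. complex_of_real (f x)) \<xi>)) (- x)"
proof -
  define c where "c = complex_of_real (1 / (2 * pi) ^ DIM('a))"
  define F where "F = fourier (\<lambda>x. complex_of_real (f x))"
  have cf: "schwartz (\<lambda>x. complex_of_real (f x))" by (rule schwartz_of_real[OF f])
  have F: "schwartz F" unfolding F_def by (rule schwartz_fourier[OF cf])
  \<comment> \<open>This is the inverse transform of the translate: the character produces the shift
    by \<open>x\<close>, and \<open>c\<close> cancels the factor \<open>(2 * pi) ^ DIM('a)\<close>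
    of the double transform.\<close>
  define \<psi> where "\<psi> \<xi> = exp (\<i> * of_real (\<xi> \<bullet> x)) * (c * F \<xi>)" for \<xi>
  have \<psi>: "schwartz \<psi>"
    unfolding \<psi>_def by (intro schwartz_character_mult schwartz_cmult F)
  have "fourier \<psi> y = complex_of_real (f (x - y))" for y
  proof -
    have "fourier \<psi> y = (LINT \<xi>|lebesgue. c * (exp (- \<i> * complex_of_real (\<xi> \<bullet> (- (x - y)))) * F \<xi>))"
      unfolding fourier_def \<psi>_def
      by (intro Bochner_Integration.integral_cong refl) (simp add: algebra_simps inner_diff_right flip: exp_add)
    also have "\<dots> = c * fourier F (- (x - y))"
      unfolding fourier_def by simp
    also have "\<dots> = complex_of_real (f (x - y))"
      unfolding F_def schwartz_fourier_inversion[OF cf] by (simp add: c_def)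
    finally show ?thesis .
  qed
  then have \<psi>_eq: "fourier \<psi> = (\<lambda>y. complex_of_real (f (x - y)))" by blast
  have "tempered_distribution (induced_distribution K)"
    using induces_induced_distribution K unfolding has_fourier_transform_def induces_def by blast
  \<comment> \<open>The translate is real, so its imaginary part is the zero function; linearity
    with both coefficients 0 shows that the distribution vanishes there.\<close>
  then have "induced_distribution K (\<lambda>x. 0 * f x + 0 * f x) = 0 * induced_distribution K f + 0 * induced_distribution K f"
    using f unfolding tempered_distribution_def by blast
  then have "complex_of_real (convolution K f x) = complex_extension (induced_distribution K) (fourier \<psi>)"
    by (simp add: \<psi>_eq complex_extension_def convolution_def complex_eq_iff)
  also have "\<dots> = (LINT \<xi>|lebesgue. k \<xi> * \<psi> \<xi>)"
    by (rule has_fourier_transform_eq[OF K \<psi>])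
  also have "\<dots> = fourier (\<lambda>\<xi>. k \<xi> * (c * F \<xi>)) (- x)"
    unfolding fourier_def \<psi>_def by (simp add: mult_ac)
  finally show ?thesis unfolding c_def F_def .
qed

text \<open>\<open>convolution K f\<close> is the reflected transform of the integrable function
  \<open>g\<close>, hence bounded, so its pairing with \<open>fourier \<phi>\<close> is a genuine
  integral. The multiplication formula moves the transform onto \<open>fourier \<phi>\<close>, and
  inversion returns \<open>\<phi>\<close>.\<close>

theorem fourier_transform_convolution:
  fixes K f :: "'a::euclidean_space \<Rightarrow> real"
  assumes K: "has_fourier_transform K k" and f: "schwartz f"
    and l: "has_fourier_transform (convolution K f) l"
  shows "AE x in lebesgue. l x = k x * fourier (\<lambda>x. complex_of_real (f x)) x"
proof -
  define c where "c = complex_of_real (1 / (2 * pi) ^ DIM('a))"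
  define F where "F = fourier (\<lambda>x. complex_of_real (f x))"
  have cf: "schwartz (\<lambda>x. complex_of_real (f x))" by (rule schwartz_of_real[OF f])
  have F: "schwartz F" unfolding F_def by (rule schwartz_fourier[OF cf])
  have [measurable]: "F \<in> borel_measurable lebesgue"
    by (intro measurable_completion) (simp add: schwartz_borel_measurable[OF F])
  obtain B where B: "\<And>x. norm x ^ 0 * norm (F x) \<le> B"
    by (rule schwartz_bound[OF F, where k = 0]) blast
  define g where "g \<xi> = k \<xi> * (c * F \<xi>)" for \<xi>
  have g: "integrable lebesgue g"
    unfolding g_def by (intro has_fourier_transform_integrable[OF K] schwartz_cmult F)
  have conv: "complex_of_real (convolution K f x) = fourier g (- x)" for x
    unfolding g_def c_def F_def by (rule convolution_eq_fourier[OF K f])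
  obtain g' where g': "integrable lborel g'" and gg': "AE x in lebesgue. g x = g' x"
    by (rule integrable_lebesgue_ex_lborel[OF g])
  have fg: "fourier g = fourier g'" by (rule fourier_cong_AE[OF g g' gg'])
  have [measurable]: "fourier g' \<in> borel_measurable borel"
    using g' by (intro fourier_borel_measurable) auto
  have kF: "integrable lebesgue (\<lambda>x. k x * F x * \<phi> x)" if \<phi>: "schwartz \<phi>" for \<phi>
  proof (rule Bochner_Integration.integrable_bound)
    have i: "integrable lebesgue (\<lambda>x. k x * \<phi> x)" by (rule has_fourier_transform_integrable[OF K \<phi>])
    then show "integrable lebesgue (\<lambda>x. of_real B * (k x * \<phi> x))" by simp
    have "(\<lambda>x. k x * \<phi> x * F x) \<in> borel_measurable lebesgue"
      using borel_measurable_integrable[OF i] by measurable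
    then show "(\<lambda>x. k x * F x * \<phi> x) \<in> borel_measurable lebesgue" by (simp add: mult_ac)
    have "norm (k x * F x * \<phi> x) \<le> norm (of_real B * (k x * \<phi> x))" for x
    proof -
      have "norm (F x) * norm (k x * \<phi> x) \<le> \<bar>B\<bar> * norm (k x * \<phi> x)"
        using B[of x] by (intro mult_right_mono) auto
      then show ?thesis by (simp add: norm_mult mult_ac)
    qed
    then show "AE x in lebesgue. norm (k x * F x * \<phi> x) \<le> norm (of_real B * (k x * \<phi> x))" by simp
  qed
  have "(LINT x|lebesgue. l x * \<phi> x) = (LINT x|lebesgue. k x * F x * \<phi> x)" if \<phi>: "schwartz \<phi>" for \<phi>
  proof -
    have f\<phi>: "schwartz (fourier \<phi>)" by (rule schwartz_fourier[OF \<phi>])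
    have i\<phi>: "integrable lborel (fourier \<phi>)" by (rule schwartz_integrable[OF f\<phi>])
    have [measurable]: "fourier \<phi> \<in> borel_measurable borel" by (rule schwartz_borel_measurable[OF f\<phi>])
    have m: "(\<lambda>x. fourier g' (- x) * fourier \<phi> x) \<in> borel_measurable borel" by measurable
    have int: "integrable lborel (\<lambda>x. fourier g' (- x) * fourier \<phi> x)"
    proof (rule Bochner_Integration.integrable_bound)
      show "integrable lborel (\<lambda>x. of_real (LINT x|lborel. norm (g' x)) * fourier \<phi> x)"
        using i\<phi> by simp
      show "AE x in lborel. norm (fourier g' (- x) * fourier \<phi> x) \<le>
          norm (of_real (LINT x|lborel. norm (g' x)) * fourier \<phi> x)"
        using norm_fourier_le[OF g'] by (auto simp: norm_mult intro!: mult_right_mono)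
    qed measurable
    have "(LINT x|lebesgue. l x * \<phi> x) = complex_extension (induced_distribution (convolution K f)) (fourier \<phi>)"
      by (rule has_fourier_transform_eq[OF l \<phi>, symmetric])
    also have "\<dots> = (LINT x|lebesgue. complex_of_real (convolution K f x) * fourier \<phi> x)"
      using l int m unfolding has_fourier_transform_def
      by (intro complex_extension_induced_distribution f\<phi>) (auto simp: conv fg integrable_completion)
    also have "\<dots> = (LINT x|lborel. fourier g' (- x) * fourier \<phi> x)"
      unfolding conv fg using m by (intro integral_completion) simp
    \<comment> \<open>The scale - 1 matches the reflection in \<open>conv\<close> and gives exactly
      the double transform at \<open>- \<xi>\<close> that inversion evaluates; the constant
      \<open>c\<close> inside \<open>g\<close> cancels its factor.\<close>
    also have "\<dots> = (LINT \<xi>|lebesgue. g \<xi> * fourier (fourier \<phi>) (- \<xi>))"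
      using fourier_multiplication_lebesgue[OF g i\<phi>, of "- 1"] by (simp add: fg)
    also have "\<dots> = (LINT x|lebesgue. k x * F x * \<phi> x)"
      unfolding schwartz_fourier_inversion[OF \<phi>] by (simp add: g_def c_def mult_ac)
    finally show ?thesis .
  qed
  then show ?thesis
    unfolding F_def[symmetric]
    by (intro schwartz_test_functions_separate has_fourier_transform_integrable[OF l] kF)
qed

lemma fourier_gaussian_nonzero:
  "t > 0 \<Longrightarrow> fourier (\<lambda>x. complex_of_real (exp (- t * norm x ^ 2))) \<xi> \<noteq> 0"
  using integral_gaussian_character[of t \<xi>] by (subst fourier_lborel) auto

text \<open>Tested on a Gaussian with transform \<open>F\<close>, the law reads
  \<open>m * F = k * l * F\<close> almost everywhere, and \<open>F\<close> has no zeros. The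
  unspecified \<open>k'\<close> and \<open>l'\<close> of \<open>is_convolution\<close> agree with
  \<open>k\<close> and \<open>l * F\<close> almost everywhere.\<close>

theorem is_convolution_imp_multiplicative:
  fixes K L M :: "'a::euclidean_space \<Rightarrow> real"
  assumes K: "has_fourier_transform K k" and L: "has_fourier_transform L l" and M: "has_fourier_transform M m"
    and conv: "\<And>f. schwartz f \<Longrightarrow> is_convolution K (convolution L f) (convolution M f)"
  shows "AE x in lebesgue. m x = k x * l x"
proof -
  define \<gamma> where "\<gamma> = (\<lambda>x::'a. exp (- 1 * norm x ^ 2))"
  define F where "F = fourier (\<lambda>x. complex_of_real (\<gamma> x))"
  have \<gamma>: "schwartz \<gamma>" unfolding \<gamma>_def by (rule schwartz_gaussian) simp
  obtain k' l' where k': "has_fourier_transform K k'" and l': "has_fourier_transform (convolution L \<gamma>) l'"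
    and m': "has_fourier_transform (convolution M \<gamma>) (\<lambda>x. k' x * l' x)"
    using conv[OF \<gamma>] unfolding is_convolution_def by blast
  have F0: "F \<xi> \<noteq> 0" for \<xi>
    unfolding F_def \<gamma>_def by (rule fourier_gaussian_nonzero) simp
  show ?thesis
    using has_fourier_transform_unique[OF K k'] fourier_transform_convolution[OF L \<gamma> l']
      fourier_transform_convolution[OF M \<gamma> m']
    unfolding F_def[symmetric] by eventually_elim (use F0 in auto)
qed

section \<open>The Fourier transform of the Riesz kernel\<close>

lemma has_integral_indicator_UNIV:
  fixes f :: "'a::euclidean_space \<Rightarrow> real"
  shows "((\<lambda>t. indicator S t * f t) has_integral I) UNIV \<longleftrightarrow> (f has_integral I) S"
proof -
  have "(\<lambda>t. indicator S t * f t) = (\<lambda>t. if t \<in> S then f t else 0)"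
    by (auto simp: fun_eq_iff)
  then show ?thesis by (simp add: has_integral_restrict_UNIV)
qed

text \<open>Rescaling of the Gamma integral. With \<open>r = norm y ^ 2\<close> it writes a negative
  power of the norm as a mixture of Gaussians; the nonnegative integral delivers value and
  finiteness together.\<close>

lemma nn_integral_gamma_kernel:
  assumes a: "a > 0" and r: "r > 0"
  shows "(\<integral>\<^sup>+t. ennreal (indicator {0<..} t * (t powr (a - 1) * exp (- (r * t)))) \<partial>lborel) =
    ennreal (Gamma a * r powr (- a))" (is "?I = _")
proof -
  define f where "f t = indicator {0<..} t * (t powr (a - 1) * exp (- t))" for t :: real
  \<comment> \<open>At 0 both sides vanish because \<open>0 powr x\<close> is 0 by convention, so
    the closed half line may be traded for the open one.\<close>
  have feq: "(if t \<in> {0..} then t powr (a - 1) / exp t else 0) = f t" for t :: real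
    by (auto simp: f_def indicator_def exp_minus divide_inverse)
  have [measurable]: "f \<in> borel_measurable borel"
    unfolding f_def by measurable
  have "(f has_integral Gamma a) UNIV"
    using Gamma_integral_real[OF a] unfolding has_integral_restrict_UNIV[of "{0..}", symmetric] feq .
  moreover have "f t \<ge> 0" for t by (simp add: f_def)
  ultimately have "(\<integral>\<^sup>+t. ennreal (f t) \<partial>lborel) = Gamma a"
    by (intro nn_integral_has_integral_lborel) auto
  moreover have "(\<integral>\<^sup>+t. ennreal (f t) \<partial>lborel) = \<bar>r\<bar> * (\<integral>\<^sup>+t. ennreal (f (0 + r * t)) \<partial>lborel)"
    using r by (intro nn_integral_real_affine) (auto simp: f_def)
  moreover have "f (0 + r * t) = r powr (a - 1) * (indicator {0<..} t * (t powr (a - 1) * exp (- (r * t))))" for t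
    using r by (auto simp: f_def indicator_def powr_mult zero_less_mult_iff)
  ultimately have "ennreal (Gamma a) = ennreal r * (\<integral>\<^sup>+t. ennreal (r powr (a - 1) *
      (indicator {0<..} t * (t powr (a - 1) * exp (- (r * t))))) \<partial>lborel)"
    using r by simp
  also have "\<dots> = ennreal r * (ennreal (r powr (a - 1)) * ?I)"
    by (subst nn_integral_cmult[symmetric]) (simp_all add: ennreal_mult')
  also have "\<dots> = ennreal (r * r powr (a - 1)) * ?I"
    using r by (simp add: ennreal_mult' mult.assoc)
  also have "r * r powr (a - 1) = r powr a"
    using r by (simp add: powr_diff)
  finally have G: "ennreal (Gamma a) = ennreal (r powr a) * ?I" .
  have "ennreal (Gamma a * r powr (- a)) = ennreal (r powr (- a)) * ennreal (Gamma a)"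
    by (subst mult.commute) (simp add: ennreal_mult')
  also have "\<dots> = ennreal (r powr (- a) * r powr a) * ?I"
    unfolding G by (simp add: ennreal_mult' mult.assoc)
  also have "r powr (- a) * r powr a = 1"
    using r by (simp add: powr_minus)
  finally show ?thesis by simp
qed

text \<open>Substituting \<open>inverse t\<close> in the previous mixture brings the Jacobian
  \<open>t powr (- 2)\<close>, which turns the exponent \<open>a - 1\<close> into
  \<open>- a - 1\<close>. Transforming a Gaussian inverts its width parameter, so transformed
  mixtures have this shape.\<close>

lemma nn_integral_inverse_gamma_kernel:
  assumes a: "a > 0" and r: "r > 0"
  shows "(\<integral>\<^sup>+t. ennreal (indicator {0<..} t * (t powr (- a - 1) * exp (- (r / t)))) \<partial>lborel) =
    ennreal (Gamma a * r powr (- a))"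
proof -
  let ?f = "\<lambda>t. t powr (a - 1) * exp (- (r * t))"
  have im: "inverse ` {0<..} = ({0<..} :: real set)"
    by (auto intro!: image_eqI[of _ _ "inverse _"])
  have "(\<lambda>t. indicator {0<..} t * ?f t) \<in> borel_measurable borel" by measurable
  then have "((\<lambda>t. indicator {0<..} t * ?f t) has_integral Gamma a * r powr (- a)) UNIV"
    using nn_integral_gamma_kernel[OF a r] a r
    by (intro nn_integral_has_integral) (auto simp: Gamma_real_pos less_imp_le)
  then have "(?f has_integral Gamma a * r powr (- a)) {0<..}"
    unfolding has_integral_indicator_UNIV .
  then have "?f absolutely_integrable_on (inverse ` {0<..}) \<and> integral (inverse ` {0<..}) ?f = Gamma a * r powr (- a)"
    unfolding im by (auto simp: has_integral_iff intro!: nonnegative_absolutely_integrable_1)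
  then have "(\<lambda>t. \<bar>- (inverse t ^ 2)\<bar> * ?f (inverse t)) absolutely_integrable_on {0<..} \<and>
      integral {0<..} (\<lambda>t. \<bar>- (inverse t ^ 2)\<bar> * ?f (inverse t)) = Gamma a * r powr (- a)"
    by (subst has_absolute_integral_change_of_variables_1')
      (auto intro!: derivative_eq_intros simp: inj_on_def power2_eq_square)
  then have "((\<lambda>t. \<bar>- (inverse t ^ 2)\<bar> * ?f (inverse t)) has_integral Gamma a * r powr (- a)) {0<..}"
    using set_lebesgue_integral_eq_integral(1) has_integral_iff by blast
  then have "((\<lambda>t. t powr (- a - 1) * exp (- (r / t))) has_integral Gamma a * r powr (- a)) {0<..}"
  proof (rule has_integral_eq[rotated])
    fix t :: real assume "t \<in> {0<..}"
    then have t: "t > 0" by simp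
    have e1: "\<bar>- (inverse t ^ 2)\<bar> = t powr (- 2)"
      using t by (simp add: powr_minus power_inverse)
    have e2: "inverse t powr (a - 1) = t powr (1 - a)"
      using t powr_minus[of t "a - 1"] by (simp add: inverse_powr)
    have e3: "t powr (- 2) * t powr (1 - a) = t powr (- a - 1)"
    proof -
      have "t powr (- 2) * t powr (1 - a) = t powr (- 2 + (1 - a))"
        by (rule powr_add[symmetric])
      also have "- 2 + (1 - a) = - a - 1" by linarith
      finally show ?thesis .
    qed
    show "\<bar>- (inverse t ^ 2)\<bar> * ?f (inverse t) = t powr (- a - 1) * exp (- (r / t))"
      unfolding e1 e2 mult.assoc[symmetric] e3 divide_inverse ..
  qed
  then have "((\<lambda>t. indicator {0<..} t * (t powr (- a - 1) * exp (- (r / t)))) has_integral Gamma a * r powr (- a)) UNIV"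
    unfolding has_integral_indicator_UNIV .
  then show ?thesis
    by (intro nn_integral_has_integral_lborel) auto
qed

text \<open>In place of polar coordinates, the power is written as a mixture of Gaussians and
  Tonelli integrates over \<open>x\<close> first. The remaining function of \<open>t\<close> is
  bounded by multiples of \<open>t powr (s / 2 - 1)\<close> up to 1 and
  \<open>t powr (s / 2 - 1 - ?n / 2)\<close> beyond; these are integrable because
  \<open>0 < s\<close> and \<open>s < ?n\<close>.\<close>

lemma integrable_norm_powr_gaussian:
  fixes s :: real
  assumes s: "0 < s" "s < real DIM('a::euclidean_space)"
  shows "integrable lborel (\<lambda>x::'a. norm x powr (- s) * exp (- (norm x ^ 2)))"
proof (rule integrableI_bounded)
  let ?n = "real DIM('a)"
  define k where "k t x = indicator {0<..} t * (t powr (s / 2 - 1) * exp (- (norm x ^ 2 * t))) * exp (- (norm x ^ 2))"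
    for t :: real and x :: 'a
  have [measurable]: "(\<lambda>(t, x). k t x) \<in> borel_measurable (lborel \<Otimes>\<^sub>M lborel)"
    unfolding k_def by measurable
  have G: "Gamma (s / 2) > 0" using s by (intro Gamma_real_pos) simp
  have inner: "ennreal (Gamma (s / 2) * (norm x powr (- s) * exp (- (norm x ^ 2)))) = (\<integral>\<^sup>+t. ennreal (k t x) \<partial>lborel)"
    if "x \<noteq> 0" for x :: 'a
  proof -
    have "(norm x ^ 2) powr (- (s / 2)) = norm x powr (- s)"
      using that by (simp add: powr_powr flip: powr_numeral)
    moreover have "(\<integral>\<^sup>+t. ennreal (k t x) \<partial>lborel) =
      (\<integral>\<^sup>+t. ennreal (indicator {0<..} t * (t powr (s / 2 - 1) * exp (- (norm x ^ 2 * t)))) * ennreal (exp (- (norm x ^ 2))) \<partial>lborel)"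
      unfolding k_def by (intro nn_integral_cong ennreal_mult) auto
    moreover have "\<dots> = (\<integral>\<^sup>+t. ennreal (indicator {0<..} t * (t powr (s / 2 - 1) * exp (- (norm x ^ 2 * t)))) \<partial>lborel) *
        ennreal (exp (- (norm x ^ 2)))"
      by (rule nn_integral_multc) measurable
    moreover have "\<dots> = ennreal (Gamma (s / 2) * (norm x ^ 2) powr (- (s / 2))) * ennreal (exp (- (norm x ^ 2)))"
      using that s by (subst nn_integral_gamma_kernel) auto
    moreover have "\<dots> = ennreal (Gamma (s / 2) * (norm x ^ 2) powr (- (s / 2)) * exp (- (norm x ^ 2)))"
      by (rule ennreal_mult''[symmetric]) simp
    ultimately show ?thesis
      by (simp only: mult.assoc)
  qed
  have outer: "(\<integral>\<^sup>+x. ennreal (k t x) \<partial>lborel) \<le> ennreal (sqrt pi ^ DIM('a)) *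
      (ennreal (indicator {0..1} t * t powr (s / 2 - 1)) + ennreal (indicator {1..} t * t powr (s / 2 - 1 - ?n / 2)))"
    if t: "t > 0" for t
  proof -
    have "(\<integral>\<^sup>+x. ennreal (k t x) \<partial>lborel) =
        (\<integral>\<^sup>+x. ennreal (t powr (s / 2 - 1)) * ennreal (exp (- (t + 1) * norm (x::'a) ^ 2)) \<partial>lborel)"
    proof (rule nn_integral_cong)
      fix x :: 'a
      have "exp (- (norm x ^ 2 * t)) * exp (- (norm x ^ 2)) = exp (- (t + 1) * norm x ^ 2)"
        unfolding mult_exp_exp by (simp add: algebra_simps)
      then have "k t x = t powr (s / 2 - 1) * exp (- (t + 1) * norm x ^ 2)"
        using t unfolding k_def by (simp only: mult.assoc indicator_simps greaterThan_iff mult_1)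
      then show "ennreal (k t x) = ennreal (t powr (s / 2 - 1)) * ennreal (exp (- (t + 1) * norm x ^ 2))"
        by (simp only: ennreal_mult'' exp_ge_zero)
    qed
    also have "\<dots> = ennreal (t powr (s / 2 - 1)) * ennreal (sqrt (pi / (t + 1)) ^ DIM('a))"
      using t integral_gaussian[of "t + 1", where 'a='a] integrable_gaussian[of "t + 1", where 'a='a]
      by (subst nn_integral_cmult) (auto simp: nn_integral_eq_integral simp del: minus_add_distrib)
    also have "\<dots> = ennreal (t powr (s / 2 - 1) * sqrt (pi / (t + 1)) ^ DIM('a))"
      using t by (simp add: ennreal_mult)
    also have "\<dots> \<le> ennreal (sqrt pi ^ DIM('a) *
        (indicator {0..1} t * t powr (s / 2 - 1) + indicator {1..} t * t powr (s / 2 - 1 - ?n / 2)))"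
    proof (rule ennreal_leI, cases "t \<le> 1")
      case True
      have "sqrt (pi / (t + 1)) ^ DIM('a) \<le> sqrt pi ^ DIM('a)"
        using t by (intro power_mono real_sqrt_le_mono) (auto simp: field_simps)
      then have "t powr (s / 2 - 1) * sqrt (pi / (t + 1)) ^ DIM('a) \<le> t powr (s / 2 - 1) * sqrt pi ^ DIM('a)"
        by (intro mult_left_mono) auto
      also have "\<dots> \<le> sqrt pi ^ DIM('a) *
        (indicator {0..1} t * t powr (s / 2 - 1) + indicator {1..} t * t powr (s / 2 - 1 - ?n / 2))"
        using True t by (simp add: indicator_def distrib_left mult.commute)
      finally show "t powr (s / 2 - 1) * sqrt (pi / (t + 1)) ^ DIM('a) \<le> sqrt pi ^ DIM('a) *
        (indicator {0..1} t * t powr (s / 2 - 1) + indicator {1..} t * t powr (s / 2 - 1 - ?n / 2))" .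
    next
      case False
      have "sqrt (pi / (t + 1)) ^ DIM('a) \<le> sqrt (pi / t) ^ DIM('a)"
        using t by (intro power_mono real_sqrt_le_mono frac_le real_sqrt_ge_zero) simp_all
      also have "\<dots> = sqrt pi ^ DIM('a) * t powr (- ?n / 2)"
      proof -
        have "sqrt (pi / t) = sqrt pi * t powr (- 1 / 2)"
          using t powr_minus_divide[of t "1 / 2"] by (simp add: real_sqrt_divide powr_half_sqrt)
        moreover have "(t powr (- 1 / 2)) ^ DIM('a) = t powr (- ?n / 2)"
          using t by (subst powr_realpow[symmetric]) (simp_all add: powr_powr)
        ultimately show ?thesis by (simp only: power_mult_distrib)
      qed
      finally have "t powr (s / 2 - 1) * sqrt (pi / (t + 1)) ^ DIM('a) \<le>
          t powr (s / 2 - 1) * (sqrt pi ^ DIM('a) * t powr (- ?n / 2))"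
        by (rule mult_left_mono) simp
      also have "\<dots> = sqrt pi ^ DIM('a) * (t powr (s / 2 - 1) * t powr (- ?n / 2))"
        by (rule mult.left_commute)
      also have "t powr (s / 2 - 1) * t powr (- ?n / 2) = t powr (s / 2 - 1 + - ?n / 2)"
        by (rule powr_add[symmetric])
      also have "s / 2 - 1 + - ?n / 2 = s / 2 - 1 - ?n / 2" by simp
      finally show "t powr (s / 2 - 1) * sqrt (pi / (t + 1)) ^ DIM('a) \<le> sqrt pi ^ DIM('a) *
        (indicator {0..1} t * t powr (s / 2 - 1) + indicator {1..} t * t powr (s / 2 - 1 - ?n / 2))"
        using False by simp
    qed
    finally show ?thesis by (simp add: ennreal_mult)
  qed
  have fin1: "(\<integral>\<^sup>+t. ennreal (indicator {0..1} t * t powr (s / 2 - 1)) \<partial>lborel) < \<infinity>"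
    using has_integral_powr_from_0[of "s / 2 - 1" 1] s
    by (subst nn_integral_has_integral_lborel) (auto simp: has_integral_indicator_UNIV)
  have fin2: "(\<integral>\<^sup>+t. ennreal (indicator {1..} t * t powr (s / 2 - 1 - ?n / 2)) \<partial>lborel) < \<infinity>"
    using has_integral_powr_to_inf[of "s / 2 - 1 - ?n / 2" 1] s
    by (subst nn_integral_has_integral_lborel) (auto simp: has_integral_indicator_UNIV)
  have "ennreal (Gamma (s / 2)) * (\<integral>\<^sup>+x. ennreal (norm (x::'a) powr (- s) * exp (- (norm x ^ 2))) \<partial>lborel) =
      (\<integral>\<^sup>+x. ennreal (Gamma (s / 2) * (norm (x::'a) powr (- s) * exp (- (norm x ^ 2)))) \<partial>lborel)"
    using G by (simp add: ennreal_mult nn_integral_cmult)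
  also have "\<dots> = (\<integral>\<^sup>+x. (\<integral>\<^sup>+t. ennreal (k t x) \<partial>lborel) \<partial>lborel)"
    using AE_lborel_singleton[of 0] by (intro nn_integral_cong_AE) (auto simp: inner)
  also have "\<dots> = (\<integral>\<^sup>+t. (\<integral>\<^sup>+x. ennreal (k t x) \<partial>lborel) \<partial>lborel)"
    by (intro lborel_pair.Fubini') measurable
  also have "\<dots> \<le> (\<integral>\<^sup>+t. ennreal (sqrt pi ^ DIM('a)) *
      (ennreal (indicator {0..1} t * t powr (s / 2 - 1)) + ennreal (indicator {1..} t * t powr (s / 2 - 1 - ?n / 2))) \<partial>lborel)"
  proof (rule nn_integral_mono)
    fix t :: real
    show "(\<integral>\<^sup>+x. ennreal (k t x) \<partial>lborel) \<le> ennreal (sqrt pi ^ DIM('a)) *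
      (ennreal (indicator {0..1} t * t powr (s / 2 - 1)) + ennreal (indicator {1..} t * t powr (s / 2 - 1 - ?n / 2)))"
      by (cases "t > 0") (use outer in \<open>auto simp: k_def\<close>)
  qed
  also have "\<dots> = ennreal (sqrt pi ^ DIM('a)) * ((\<integral>\<^sup>+t. ennreal (indicator {0..1} t * t powr (s / 2 - 1)) \<partial>lborel) +
      (\<integral>\<^sup>+t. ennreal (indicator {1..} t * t powr (s / 2 - 1 - ?n / 2)) \<partial>lborel))"
    by (simp add: nn_integral_cmult nn_integral_add)
  also have "\<dots> < \<infinity>"
    using fin1 fin2 by (simp add: ennreal_mult_less_top)
  finally show "(\<integral>\<^sup>+x. ennreal (norm (norm (x::'a) powr (- s) * exp (- (norm x ^ 2)))) \<partial>lborel) < \<infinity>"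
    using G by (auto simp: ennreal_mult_less_top)
qed measurable

lemma integrable_norm_powr_japanese:
  fixes s :: real
  assumes s: "0 < s" "s < real DIM('a::euclidean_space)"
  shows "integrable lborel (\<lambda>x::'a. norm x powr (- s) * (1 / (1 + norm x ^ 2) ^ DIM('a)))"
proof (rule Bochner_Integration.integrable_bound)
  \<comment> \<open>On the unit ball \<open>exp 1\<close> compensates the decay of the Gaussian;
    outside it the power of the norm is at most 1.\<close>
  show "integrable lborel (\<lambda>x::'a. 1 / (1 + norm x ^ 2) ^ DIM('a) + exp 1 * (norm x powr (- s) * exp (- (norm x ^ 2))))"
    by (intro Bochner_Integration.integrable_add integrable_inverse_japanese integrable_mult_right
        integrable_norm_powr_gaussian s)
  have "norm x powr (- s) * (1 / (1 + norm x ^ 2) ^ DIM('a)) \<le>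
      1 / (1 + norm x ^ 2) ^ DIM('a) + exp 1 * (norm x powr (- s) * exp (- (norm x ^ 2)))" for x :: 'a
  proof (cases "norm x \<le> 1")
    case True
    have "1 / (1 + norm x ^ 2) ^ DIM('a) \<le> 1"
      by (simp add: divide_le_eq one_le_power)
    also have "1 \<le> exp 1 * exp (- (norm x ^ 2))"
      using power_le_one[OF norm_ge_zero True, of 2] by (simp flip: exp_add)
    finally have "norm x powr (- s) * (1 / (1 + norm x ^ 2) ^ DIM('a)) \<le> norm x powr (- s) * (exp 1 * exp (- (norm x ^ 2)))"
      by (intro mult_left_mono) auto
    then show ?thesis by (simp add: mult_ac add_increasing)
  next
    case False
    then have "norm x powr (- s) \<le> 1 powr (- s)"
      using s by (intro powr_mono2') auto
    then have "norm x powr (- s) * (1 / (1 + norm x ^ 2) ^ DIM('a)) \<le> 1 * (1 / (1 + norm x ^ 2) ^ DIM('a))"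
      by (intro mult_right_mono) auto
    then show ?thesis by (simp add: add_increasing2)
  qed
  then show "AE x::'a in lborel. norm (norm x powr (- s) * (1 / (1 + norm x ^ 2) ^ DIM('a))) \<le>
      norm (1 / (1 + norm x ^ 2) ^ DIM('a) + exp 1 * (norm x powr (- s) * exp (- (norm x ^ 2))))"
    by (auto simp: abs_mult intro: order.trans)
qed measurable

lemma integrable_norm_powr_schwartz:
  fixes f :: "'a::euclidean_space \<Rightarrow> 'b::{banach, second_countable_topology}"
  assumes s: "0 < s" "s < real DIM('a)" and f: "schwartz f"
  shows "integrable lborel (\<lambda>x. norm x powr (- s) *\<^sub>R f x)"
proof -
  have [measurable]: "f \<in> borel_measurable borel" by (rule schwartz_borel_measurable[OF f])
  obtain B where B: "B > 0" "\<And>x. norm x ^ 0 * norm (f x) \<le> B * (1 / (1 + norm x ^ 2) ^ DIM('a))"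
    by (rule schwartz_decay[OF f]) blast
  show ?thesis
  proof (rule Bochner_Integration.integrable_bound)
    show "integrable lborel (\<lambda>x::'a. B * (norm x powr (- s) * (1 / (1 + norm x ^ 2) ^ DIM('a))))"
      by (intro integrable_mult_right integrable_norm_powr_japanese s)
    have "norm (norm x powr (- s) *\<^sub>R f x) \<le> B * (norm x powr (- s) * (1 / (1 + norm x ^ 2) ^ DIM('a)))" for x
      using mult_left_mono[OF B(2)[of x], of "norm x powr (- s)"] by (simp add: mult_ac)
    then show "AE x in lborel. norm (norm x powr (- s) *\<^sub>R f x) \<le>
        norm (B * (norm x powr (- s) * (1 / (1 + norm x ^ 2) ^ DIM('a))))"
      unfolding real_norm_def by (intro AE_I2) (rule order.trans[OF _ abs_ge_self])
  qed measurable
qed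

text \<open>Fubini, with absolute convergence read off from \<open>m\<close>: as \<open>k\<close> is
  nonnegative, integrating the norm over \<open>t\<close> gives \<open>m y\<close> times the norm of
  \<open>\<psi> y\<close>. The origin, a null set, is excluded because the Gaussian mixtures diverge
  there.\<close>

lemma integral_subordination:
  fixes k :: "real \<Rightarrow> 'a::euclidean_space \<Rightarrow> real" and \<psi> :: "'a \<Rightarrow> complex"
  assumes k [measurable]: "(\<lambda>(t, y). k t y) \<in> borel_measurable (lborel \<Otimes>\<^sub>M lborel)"
    and k_nonneg: "\<And>t y. k t y \<ge> 0"
    and m: "\<And>y. y \<noteq> 0 \<Longrightarrow> (\<integral>\<^sup>+t. ennreal (k t y) \<partial>lborel) = ennreal (m y)"
    and m_nonneg: "\<And>y. m y \<ge> 0"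
    and \<psi> [measurable]: "\<psi> \<in> borel_measurable borel"
    and int: "integrable lborel (\<lambda>y. m y *\<^sub>R \<psi> y)"
  shows "(LINT y|lborel. m y *\<^sub>R \<psi> y) = (LINT t|lborel. (LINT y|lborel. k t y *\<^sub>R \<psi> y))"
proof -
  have k1 [measurable]: "(\<lambda>t. k t y) \<in> borel_measurable lborel" for y
    using measurable_compose[OF measurable_Pair2' k] by simp
  have ik: "integrable lborel (\<lambda>t. k t y)" and Ik: "(LINT t|lborel. k t y) = m y" if "y \<noteq> 0" for y
    using nn_integral_eq_integrable[of "\<lambda>t. k t y" lborel "m y"] m[OF that] m_nonneg[of y] k_nonneg by auto
  have y0: "AE y in lborel. y \<noteq> (0::'a)" by (rule AE_lborel_singleton)
  let ?F = "\<lambda>(t, y). k t y *\<^sub>R \<psi> y"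
  have "integrable (lborel \<Otimes>\<^sub>M lborel) (\<lambda>(y, t). ?F (t, y))"
  proof (rule lborel_pair.Fubini_integrable)
    show "(\<lambda>(y, t). ?F (t, y)) \<in> borel_measurable (lborel \<Otimes>\<^sub>M lborel)"
      using k by measurable
    have "AE y in lborel. norm (m y *\<^sub>R \<psi> y) = (LINT t|lborel. norm (case (y, t) of (y, t) \<Rightarrow> ?F (t, y)))"
      using y0 by eventually_elim (simp add: Ik k_nonneg m_nonneg)
    then show "integrable lborel (\<lambda>y. LINT t|lborel. norm (case (y, t) of (y, t) \<Rightarrow> ?F (t, y)))"
      by (rule integrable_cong_AE_imp[OF integrable_norm[OF int], rotated]) (use k in measurable)
    show "AE y in lborel. integrable lborel (\<lambda>t. case (y, t) of (y, t) \<Rightarrow> ?F (t, y))"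
      using y0 by eventually_elim (simp add: ik)
  qed
  then have "(LINT t|lborel. (LINT y|lborel. k t y *\<^sub>R \<psi> y)) = (LINT y|lborel. (LINT t|lborel. k t y *\<^sub>R \<psi> y))"
    using lborel_pair.Fubini_integral[of "\<lambda>y t. ?F (t, y)"] by simp
  also have "\<dots> = (LINT y|lborel. m y *\<^sub>R \<psi> y)"
  proof (rule integral_cong_AE)
    show "(\<lambda>y. LINT t|lborel. k t y *\<^sub>R \<psi> y) \<in> borel_measurable lborel"
      using k by measurable
    show "AE y in lborel. (LINT t|lborel. k t y *\<^sub>R \<psi> y) = m y *\<^sub>R \<psi> y"
      using y0 by eventually_elim (simp add: Ik ik)
  qed (use int in auto)
  finally show ?thesis ..
qed

lemma fourier_gaussian:
  "t > 0 \<Longrightarrow> fourier (\<lambda>x::'a::euclidean_space. complex_of_real (exp (- t * norm x ^ 2))) \<xi> =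
    of_real (sqrt (pi / t) ^ DIM('a) * exp (- (norm \<xi> ^ 2) / (4 * t)))"
  using integral_gaussian_character[of t \<xi>] by (subst fourier_lborel) auto

text \<open>Both powers of the norm are superpositions of Gaussians, whose Fourier transforms are Gaussians
  again.\<close>

lemma fourier_norm_powr:
  fixes \<phi> :: "'a::euclidean_space \<Rightarrow> complex"
  assumes \<alpha>: "0 < \<alpha>" "\<alpha> < real DIM('a)" and \<phi>: "schwartz \<phi>"
  shows "Gamma ((real DIM('a) - \<alpha>) / 2) *\<^sub>R (LINT y|lborel. norm y powr (\<alpha> - real DIM('a)) *\<^sub>R fourier \<phi> y) =
    (sqrt pi ^ DIM('a) * (Gamma (\<alpha> / 2) * 4 powr (\<alpha> / 2))) *\<^sub>R (LINT \<xi>|lborel. norm \<xi> powr (- \<alpha>) *\<^sub>R \<phi> \<xi>)"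
proof -
  let ?n = "real DIM('a)"
  define b where "b = (?n - \<alpha>) / 2"
  have b: "b > 0" using \<alpha> by (simp add: b_def)
  have f\<phi>: "schwartz (fourier \<phi>)" by (rule schwartz_fourier[OF \<phi>])
  have [measurable]: "\<phi> \<in> borel_measurable borel" "fourier \<phi> \<in> borel_measurable borel"
    by (rule schwartz_borel_measurable[OF \<phi>] schwartz_borel_measurable[OF f\<phi>])+
  \<comment> \<open>Up to Gamma factors, \<open>k1\<close> mixes to
    \<open>norm y powr (\<alpha> - ?n)\<close> and \<open>k2\<close> to
    \<open>norm y powr (- \<alpha>)\<close>. The 4 in \<open>k2\<close> is that of the transformed
    Gaussian and becomes the factor \<open>4 powr (\<alpha> / 2)\<close>.\<close>
  define k1 where "k1 t y = indicator {0<..} t * (t powr (b - 1) * exp (- (norm y ^ 2 * t)))" for t :: real and y :: 'a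
  define k2 where "k2 t y = indicator {0<..} t * (t powr (- (\<alpha> / 2) - 1) * exp (- (norm y ^ 2 / 4 / t)))" for t :: real and y :: 'a
  have sq: "(norm y ^ 2) powr r = norm y powr (2 * r)" for r and y :: 'a
    by (cases "y = 0") (simp_all add: powr_powr flip: powr_numeral)
  have e1: "Gamma b *\<^sub>R (LINT y|lborel. norm y powr (\<alpha> - ?n) *\<^sub>R fourier \<phi> y) =
      (LINT t|lborel. (LINT y|lborel. k1 t y *\<^sub>R fourier \<phi> y))"
  proof -
    have "Gamma b *\<^sub>R (LINT y|lborel. norm y powr (\<alpha> - ?n) *\<^sub>R fourier \<phi> y) =
        (LINT y|lborel. (Gamma b * norm y powr (\<alpha> - ?n)) *\<^sub>R fourier \<phi> y)"
      by (simp flip: scaleR_scaleR)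
    also have "\<dots> = (LINT t|lborel. (LINT y|lborel. k1 t y *\<^sub>R fourier \<phi> y))"
    proof (rule integral_subordination)
      show "(\<lambda>(t, y). k1 t y) \<in> borel_measurable (lborel \<Otimes>\<^sub>M lborel)"
        unfolding k1_def by measurable
      show "k1 t y \<ge> 0" for t y by (simp add: k1_def)
      show "(\<integral>\<^sup>+t. ennreal (k1 t y) \<partial>lborel) = ennreal (Gamma b * norm y powr (\<alpha> - ?n))" if "y \<noteq> 0" for y
      proof -
        have "2 * b = ?n - \<alpha>" by (simp add: b_def)
        then have e: "2 * - b = \<alpha> - ?n" by (simp only: mult_minus_right minus_diff_eq)
        have "norm y ^ 2 > 0" using that by simp
        from nn_integral_gamma_kernel[OF b this] show ?thesis
          unfolding k1_def sq e .
      qed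
      show "Gamma b * norm y powr (\<alpha> - ?n) \<ge> 0" for y :: 'a
        using Gamma_real_pos[OF b] by simp
      have "integrable lborel (\<lambda>y. norm y powr (- (?n - \<alpha>)) *\<^sub>R fourier \<phi> y)"
        using \<alpha> by (intro integrable_norm_powr_schwartz f\<phi>) auto
      then show "integrable lborel (\<lambda>y. (Gamma b * norm y powr (\<alpha> - ?n)) *\<^sub>R fourier \<phi> y)"
        by (simp flip: scaleR_scaleR)
    qed measurable
    finally show ?thesis .
  qed
  have e2: "(Gamma (\<alpha> / 2) * 4 powr (\<alpha> / 2)) *\<^sub>R (LINT y|lborel. norm y powr (- \<alpha>) *\<^sub>R \<phi> y) =
      (LINT t|lborel. (LINT y|lborel. k2 t y *\<^sub>R \<phi> y))"
  proof -
    have "(Gamma (\<alpha> / 2) * 4 powr (\<alpha> / 2)) *\<^sub>R (LINT y|lborel. norm y powr (- \<alpha>) *\<^sub>R \<phi> y) =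
        (LINT y|lborel. (Gamma (\<alpha> / 2) * 4 powr (\<alpha> / 2) * norm y powr (- \<alpha>)) *\<^sub>R \<phi> y)"
      by (simp only: scaleR_scaleR[symmetric] integral_scaleR_right)
    also have "\<dots> = (LINT t|lborel. (LINT y|lborel. k2 t y *\<^sub>R \<phi> y))"
    proof (rule integral_subordination)
      show "(\<lambda>(t, y). k2 t y) \<in> borel_measurable (lborel \<Otimes>\<^sub>M lborel)"
        unfolding k2_def by measurable
      show "k2 t y \<ge> 0" for t y by (simp add: k2_def)
      show "(\<integral>\<^sup>+t. ennreal (k2 t y) \<partial>lborel) = ennreal (Gamma (\<alpha> / 2) * 4 powr (\<alpha> / 2) * norm y powr (- \<alpha>))"
        if "y \<noteq> 0" for y
      proof -
        have e: "(norm y ^ 2 / 4) powr (- (\<alpha> / 2)) = 4 powr (\<alpha> / 2) * norm y powr (- \<alpha>)"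
        proof -
          have "(norm y ^ 2 / 4) powr (- (\<alpha> / 2)) = (norm y ^ 2) powr (- (\<alpha> / 2)) / 4 powr (- (\<alpha> / 2))"
            by (rule powr_divide)
          also have "(norm y ^ 2) powr (- (\<alpha> / 2)) = norm y powr (- \<alpha>)"
            unfolding sq by simp
          also have "norm y powr (- \<alpha>) / 4 powr (- (\<alpha> / 2)) = 4 powr (\<alpha> / 2) * norm y powr (- \<alpha>)"
          proof -
            have "u / inverse v = v * u" for u v :: real
              by (simp add: divide_inverse)
            then show ?thesis unfolding powr_minus[of 4] .
          qed
          finally show ?thesis .
        qed
        have "norm y ^ 2 / 4 > 0" "\<alpha> / 2 > 0" using that \<alpha> by auto
        from nn_integral_inverse_gamma_kernel[OF this(2,1)] show ?thesis
          unfolding k2_def e by (simp only: mult.assoc)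
      qed
      show "Gamma (\<alpha> / 2) * 4 powr (\<alpha> / 2) * norm y powr (- \<alpha>) \<ge> 0" for y :: 'a
        using Gamma_real_pos[of "\<alpha> / 2"] \<alpha> by simp
      show "integrable lborel (\<lambda>y. (Gamma (\<alpha> / 2) * 4 powr (\<alpha> / 2) * norm y powr (- \<alpha>)) *\<^sub>R \<phi> y)"
        unfolding scaleR_scaleR[symmetric]
        using \<alpha> by (intro integrable_scaleR_right integrable_norm_powr_schwartz \<phi>)
    qed measurable
    finally show ?thesis .
  qed
  \<comment> \<open>For fixed \<open>t\<close> the transform moves from \<open>\<phi>\<close> to the
    Gaussian. The powers of \<open>t\<close> agree because
    \<open>b - 1 - ?n / 2 = - (\<alpha> / 2) - 1\<close>.\<close>
  have "(LINT y|lborel. k1 t y *\<^sub>R fourier \<phi> y) = sqrt pi ^ DIM('a) *\<^sub>R (LINT y|lborel. k2 t y *\<^sub>R \<phi> y)" for t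
  proof (cases "t > 0")
    case True
    let ?\<gamma> = "\<lambda>x::'a. complex_of_real (exp (- t * norm x ^ 2))"
    have \<gamma>: "integrable lborel ?\<gamma>"
      using True by (intro integrable_of_real integrable_gaussian)
    have tp: "t powr (b - 1) * sqrt (pi / t) ^ DIM('a) = sqrt pi ^ DIM('a) * t powr (- (\<alpha> / 2) - 1)"
    proof -
      have "sqrt (pi / t) = sqrt pi * t powr (- 1 / 2)"
        using True powr_minus_divide[of t "1 / 2"] by (simp add: real_sqrt_divide powr_half_sqrt)
      moreover have "(t powr (- 1 / 2)) ^ DIM('a) = t powr (- ?n / 2)"
        using True by (subst powr_realpow[symmetric]) (simp_all add: powr_powr)
      moreover have "t powr (b - 1) * t powr (- ?n / 2) = t powr (b - 1 + - ?n / 2)"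
        by (rule powr_add[symmetric])
      moreover have "b - 1 + - ?n / 2 = - (\<alpha> / 2) - 1"
        by (simp add: b_def field_simps)
      ultimately show ?thesis
        by (simp only: power_mult_distrib mult.left_commute)
    qed
    have "(LINT y|lborel. k1 t y *\<^sub>R fourier \<phi> y) = (LINT y|lborel. t powr (b - 1) *\<^sub>R (?\<gamma> y * fourier \<phi> y))"
      using True by (intro Bochner_Integration.integral_cong refl) (simp add: k1_def scaleR_conv_of_real mult_ac)
    also have "\<dots> = t powr (b - 1) *\<^sub>R (LINT y|lborel. ?\<gamma> y * fourier \<phi> y)"
      by (rule integral_scaleR_right)
    also have "(LINT y|lborel. ?\<gamma> y * fourier \<phi> y) = (LINT y|lborel. fourier ?\<gamma> y * \<phi> y)"
      using fourier_multiplication[OF \<gamma> schwartz_integrable[OF \<phi>], of 1] by simp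
    also have "t powr (b - 1) *\<^sub>R (LINT y|lborel. fourier ?\<gamma> y * \<phi> y) =
        (LINT y|lborel. t powr (b - 1) *\<^sub>R (fourier ?\<gamma> y * \<phi> y))"
      by (rule integral_scaleR_right[symmetric])
    also have "\<dots> = (LINT y|lborel. sqrt pi ^ DIM('a) *\<^sub>R (k2 t y *\<^sub>R \<phi> y))"
    proof (rule Bochner_Integration.integral_cong[OF refl])
      fix y :: 'a
      have "t powr (b - 1) *\<^sub>R (fourier ?\<gamma> y * \<phi> y) =
          ((t powr (b - 1) * sqrt (pi / t) ^ DIM('a)) * exp (- (norm y ^ 2) / (4 * t))) *\<^sub>R \<phi> y"
        unfolding fourier_gaussian[OF True] by (simp add: scaleR_conv_of_real mult_ac)
      also have "\<dots> = sqrt pi ^ DIM('a) *\<^sub>R (k2 t y *\<^sub>R \<phi> y)"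
        unfolding tp using True by (simp add: k2_def mult.assoc)
      finally show "t powr (b - 1) *\<^sub>R (fourier ?\<gamma> y * \<phi> y) = sqrt pi ^ DIM('a) *\<^sub>R (k2 t y *\<^sub>R \<phi> y)" .
    qed
    also have "\<dots> = sqrt pi ^ DIM('a) *\<^sub>R (LINT y|lborel. k2 t y *\<^sub>R \<phi> y)"
      by (rule integral_scaleR_right)
    finally show ?thesis .
  qed (simp add: k1_def k2_def)
  then have "Gamma b *\<^sub>R (LINT y|lborel. norm y powr (\<alpha> - ?n) *\<^sub>R fourier \<phi> y) =
      sqrt pi ^ DIM('a) *\<^sub>R ((Gamma (\<alpha> / 2) * 4 powr (\<alpha> / 2)) *\<^sub>R (LINT y|lborel. norm y powr (- \<alpha>) *\<^sub>R \<phi> y))"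
    unfolding e1 e2 by simp
  then show ?thesis unfolding b_def scaleR_scaleR .
qed

section \<open>Powers of the norm as tempered distributions\<close>

lemma schwartz_seminorm_upper:
  assumes "schwartz f" "set vs \<subseteq> Basis"
  shows "norm x ^ k * norm (iter_partial vs f x) \<le> schwartz_seminorm k vs f"
  unfolding schwartz_seminorm_def
proof (rule cSUP_upper)
  have "bounded (range (\<lambda>x. norm x ^ k *\<^sub>R iter_partial vs f x))"
    using assms unfolding schwartz_def by blast
  then show "bdd_above (range (\<lambda>x. norm x ^ k * norm (iter_partial vs f x)))"
    unfolding bounded_iff bdd_above_def by auto
qed simp

lemma schwartz_seminorm_nonneg:
  assumes "schwartz f" "set vs \<subseteq> Basis"
  shows "schwartz_seminorm k vs f \<ge> 0"
proof -
  have "0 \<le> norm (0::'a) ^ k * norm (iter_partial vs f 0)" by simp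
  also have "\<dots> \<le> schwartz_seminorm k vs f" by (rule schwartz_seminorm_upper[OF assms])
  finally show ?thesis .
qed

text \<open>Temperedness requires a decay constant made of seminorms. Those without derivatives give
  the bound, and the others enter the sum as nonnegative terms; \<open>2 ^ N\<close> comes from the
  polynomial weight and a further 2 from its two summands.\<close>

lemma schwartz_decay_seminorm:
  fixes f :: "'a::euclidean_space \<Rightarrow> real"
  assumes f: "schwartz f"
  shows "\<bar>f x\<bar> \<le> 2 ^ Suc N * (\<Sum>k\<le>2 * N. \<Sum>vs | set vs \<subseteq> Basis \<and> length vs \<le> 2 * N. schwartz_seminorm k vs f) *
    (1 / (1 + norm x ^ 2) ^ N)"
proof -
  let ?V = "{vs::'a list. set vs \<subseteq> Basis \<and> length vs \<le> 2 * N}"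
  let ?S = "\<Sum>k\<le>2 * N. \<Sum>vs\<in>?V. schwartz_seminorm k vs f"
  have V: "finite ?V" by (intro finite_lists_length_le) auto
  have le: "norm x ^ k * \<bar>f x\<bar> \<le> ?S" if "k \<le> 2 * N" for k
  proof -
    have "norm x ^ k * \<bar>f x\<bar> \<le> schwartz_seminorm k [] f"
      using schwartz_seminorm_upper[OF f, of "[]" x k] by simp
    also have "\<dots> \<le> (\<Sum>vs\<in>?V. schwartz_seminorm k vs f)"
      using V by (intro member_le_sum) (auto intro: schwartz_seminorm_nonneg[OF f])
    also have "\<dots> \<le> ?S"
      using that by (intro member_le_sum[of k _ "\<lambda>k. \<Sum>vs\<in>?V. schwartz_seminorm k vs f"])
        (auto intro!: sum_nonneg schwartz_seminorm_nonneg[OF f])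
    finally show ?thesis .
  qed
  have "(1 + norm x ^ 2) ^ N * \<bar>f x\<bar> \<le> 2 ^ N * (1 + norm x ^ (2 * N)) * \<bar>f x\<bar>"
    by (intro mult_right_mono japanese_power_le) auto
  also have "\<dots> = 2 ^ N * (norm x ^ 0 * \<bar>f x\<bar> + norm x ^ (2 * N) * \<bar>f x\<bar>)"
    by (simp add: algebra_simps)
  also have "\<dots> \<le> 2 ^ N * (?S + ?S)"
    by (intro mult_left_mono add_mono le) auto
  finally show ?thesis by (simp add: field_simps add_pos_nonneg)
qed

text \<open>The integrable weight \<open>?w\<close> dominates the kernel on compact sets, and
  dominates the kernel times any Schwartz function with a constant given by seminorms. This yields
  local integrability and temperedness alike.\<close>

lemma induces_norm_powr:
  fixes c s :: real
  assumes s: "0 < s" "s < real DIM('a::euclidean_space)"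
  shows "\<exists>T. induces (\<lambda>y::'a. c * norm y powr (- s)) T"
proof
  let ?K = "\<lambda>y::'a. c * norm y powr (- s)"
  let ?w = "\<lambda>y::'a. norm y powr (- s) * (1 / (1 + norm y ^ 2) ^ DIM('a))"
  define T where "T f = (LINT y|lebesgue. ?K y * f y)" for f :: "'a \<Rightarrow> real"
  have iw: "integrable lborel ?w" by (rule integrable_norm_powr_japanese[OF s])
  have int: "integrable lborel (\<lambda>y. ?K y * f y)" if f: "schwartz f" for f
    using integrable_mult_right[OF integrable_norm_powr_schwartz[OF s f], of c] by (simp add: mult.assoc)
  have T: "T f = (LINT y|lborel. ?K y * f y)" if f: "schwartz f" for f
    unfolding T_def using borel_measurable_integrable[OF int[OF f]] by (rule integral_completion)
  show "induces ?K T"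
    unfolding induces_def
  proof (intro conjI allI impI)
    show "locally_integrable ?K"
      unfolding locally_integrable_def
    proof (intro allI impI)
      fix S :: "'a set" assume S: "compact S"
      then obtain R where R: "\<And>x. x \<in> S \<Longrightarrow> norm x \<le> R"
        using compact_imp_bounded bounded_iff by metis
      have [measurable]: "S \<in> sets borel" using S by (simp add: borel_compact)
      have "integrable lborel (\<lambda>y. indicator S y *\<^sub>R ?K y)"
      proof (rule Bochner_Integration.integrable_bound)
        show "integrable lborel (\<lambda>y. (\<bar>c\<bar> * (1 + R ^ 2) ^ DIM('a)) * ?w y)"
          by (intro integrable_mult_right iw)
        have "norm (indicator S y *\<^sub>R ?K y) \<le> (\<bar>c\<bar> * (1 + R ^ 2) ^ DIM('a)) * ?w y" for y
        proof (cases "y \<in> S")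
          case True
          have "(1 + norm y ^ 2) ^ DIM('a) \<le> (1 + R ^ 2) ^ DIM('a)"
            using R[OF True] by (intro power_mono add_left_mono) auto
          then have "1 \<le> (1 + R ^ 2) ^ DIM('a) * (1 / (1 + norm y ^ 2) ^ DIM('a))"
            by (simp add: add_pos_nonneg)
          then have "(\<bar>c\<bar> * norm y powr (- s)) * 1 \<le>
              (\<bar>c\<bar> * norm y powr (- s)) * ((1 + R ^ 2) ^ DIM('a) * (1 / (1 + norm y ^ 2) ^ DIM('a)))"
            by (intro mult_left_mono) auto
          then show ?thesis using True by (simp add: abs_mult mult_ac)
        qed simp
        then show "AE y in lborel. norm (indicator S y *\<^sub>R ?K y) \<le> norm ((\<bar>c\<bar> * (1 + R ^ 2) ^ DIM('a)) * ?w y)"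
          unfolding real_norm_def by (intro AE_I2) (rule order.trans[OF _ abs_ge_self])
      qed measurable
      then show "?K absolutely_integrable_on S"
        unfolding set_integrable_def by (subst integrable_completion) auto
    qed
    show "tempered_distribution T"
      unfolding tempered_distribution_def
    proof (intro conjI allI impI)
      fix f g :: "'a \<Rightarrow> real" and a b :: real
      assume fg: "schwartz f \<and> schwartz g"
      then have "schwartz (\<lambda>x. a * f x + b * g x)"
        by (intro schwartz_add schwartz_cmult) auto
      then have "T (\<lambda>x. a * f x + b * g x) = (LINT y|lborel. a * (?K y * f y) + b * (?K y * g y))"
        by (simp add: T algebra_simps)
      also have "\<dots> = a * T f + b * T g"
        using fg int by (subst Bochner_Integration.integral_add) (simp_all add: T)
      finally show "T (\<lambda>x. a * f x + b * g x) = a * T f + b * T g" .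
    next
      let ?N = "2 * DIM('a)"
      let ?S = "\<lambda>f. \<Sum>k\<le>?N. \<Sum>vs | set vs \<subseteq> Basis \<and> length vs \<le> ?N. schwartz_seminorm k vs f"
      let ?C = "\<bar>c\<bar> * 2 ^ Suc DIM('a) * (LINT y|lborel. ?w y)"
      have "\<bar>T f\<bar> \<le> ?C * ?S f" if f: "schwartz f" for f
      proof -
        have "\<bar>T f\<bar> \<le> (LINT y|lborel. \<bar>?K y * f y\<bar>)"
          unfolding T[OF f] by (rule integral_abs_bound)
        also have "\<dots> \<le> (LINT y|lborel. (\<bar>c\<bar> * 2 ^ Suc DIM('a) * ?S f) * ?w y)"
        proof (rule integral_mono)
          show "integrable lborel (\<lambda>y. \<bar>?K y * f y\<bar>)" by (intro integrable_abs int f)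
          show "integrable lborel (\<lambda>y. (\<bar>c\<bar> * 2 ^ Suc DIM('a) * ?S f) * ?w y)"
            by (intro integrable_mult_right iw)
          fix y :: 'a
          have "(\<bar>c\<bar> * norm y powr (- s)) * \<bar>f y\<bar> \<le>
              (\<bar>c\<bar> * norm y powr (- s)) * (2 ^ Suc DIM('a) * ?S f * (1 / (1 + norm y ^ 2) ^ DIM('a)))"
            by (intro mult_left_mono schwartz_decay_seminorm f) auto
          then show "\<bar>?K y * f y\<bar> \<le> (\<bar>c\<bar> * 2 ^ Suc DIM('a) * ?S f) * ?w y"
            by (simp add: abs_mult mult_ac)
        qed
        also have "\<dots> = ?C * ?S f"
          by (subst integral_mult_right_zero) (simp add: mult_ac)
        finally show ?thesis .
      qed
      then show "\<exists>C N. \<forall>f. schwartz f \<longrightarrow>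
          \<bar>T f\<bar> \<le> C * (\<Sum>k\<le>N. \<Sum>vs | set vs \<subseteq> Basis \<and> length vs \<le> N. schwartz_seminorm k vs f)"
        by blast
    qed
  qed (simp add: T_def)
qed

text \<open>An equivalence in \<open>c'\<close>, because \<open>riesz_kernel\<close> selects its
  constant by \<open>THE\<close>, which demands uniqueness as well as existence. Existence rescales
  the mixture formula; uniqueness tests on one Gaussian, whose pairing with a positive power of
  positive norm is nonzero.\<close>

lemma has_fourier_transform_norm_powr:
  fixes \<alpha> :: real
  assumes \<alpha>: "0 < \<alpha>" "\<alpha> < real DIM('a::euclidean_space)"
  defines "c \<equiv> Gamma ((real DIM('a) - \<alpha>) / 2) / (sqrt pi ^ DIM('a) * (Gamma (\<alpha> / 2) * 4 powr (\<alpha> / 2)))"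
  shows "has_fourier_transform (\<lambda>y::'a. c' * norm y powr (\<alpha> - real DIM('a)))
      (\<lambda>\<xi>. complex_of_real (1 / norm \<xi> powr \<alpha>)) \<longleftrightarrow> c' = c"
proof -
  let ?n = "real DIM('a)"
  let ?K = "\<lambda>y::'a. c' * norm y powr (\<alpha> - ?n)"
  have K: "\<exists>T. induces ?K T"
    using induces_norm_powr[of "?n - \<alpha>" c', where 'a='a] \<alpha> by simp
  have G: "Gamma ((?n - \<alpha>) / 2) > 0" "Gamma (\<alpha> / 2) > 0"
    using \<alpha> by (auto intro!: Gamma_real_pos)
  have c: "c > 0" unfolding c_def using G by simp
  have R: "complex_of_real (1 / norm \<xi> powr \<alpha>) * \<phi> \<xi> = norm \<xi> powr (- \<alpha>) *\<^sub>R \<phi> \<xi>" for \<phi> :: "'a \<Rightarrow> complex" and \<xi>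
    by (simp add: powr_minus scaleR_conv_of_real divide_inverse)
  have iR: "integrable lborel (\<lambda>\<xi>. norm \<xi> powr (- \<alpha>) *\<^sub>R \<phi> \<xi>)" if "schwartz \<phi>" for \<phi> :: "'a \<Rightarrow> complex"
    by (rule integrable_norm_powr_schwartz[OF \<alpha> that])
  have iR': "integrable lebesgue (\<lambda>\<xi>. complex_of_real (1 / norm \<xi> powr \<alpha>) * \<phi> \<xi>)" if "schwartz \<phi>" for \<phi> :: "'a \<Rightarrow> complex"
    unfolding R using iR[OF that] by (subst integrable_completion) auto
  have IR: "(LINT \<xi>|lebesgue. complex_of_real (1 / norm \<xi> powr \<alpha>) * \<phi> \<xi>) =
      (LINT \<xi>|lborel. norm \<xi> powr (- \<alpha>) *\<^sub>R \<phi> \<xi>)" if "schwartz \<phi>" for \<phi> :: "'a \<Rightarrow> complex"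
    unfolding R using iR[OF that] by (intro integral_completion) auto
  have lhs: "complex_extension (induced_distribution ?K) (fourier \<phi>) =
      (c' / c) *\<^sub>R (LINT \<xi>|lborel. norm \<xi> powr (- \<alpha>) *\<^sub>R \<phi> \<xi>)" if \<phi>: "schwartz \<phi>" for \<phi> :: "'a \<Rightarrow> complex"
  proof -
    let ?I = "LINT y|lborel. norm y powr (\<alpha> - ?n) *\<^sub>R fourier \<phi> y"
    let ?J = "LINT \<xi>|lborel. norm \<xi> powr (- \<alpha>) *\<^sub>R \<phi> \<xi>"
    have f\<phi>: "schwartz (fourier \<phi>)" by (rule schwartz_fourier[OF \<phi>])
    have "integrable lborel (\<lambda>y. norm y powr (- (?n - \<alpha>)) *\<^sub>R fourier \<phi> y)"
      using \<alpha> by (intro integrable_norm_powr_schwartz f\<phi>) auto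
    then have i: "integrable lborel (\<lambda>y. norm y powr (\<alpha> - ?n) *\<^sub>R fourier \<phi> y)"
      by simp
    have eq: "complex_of_real (?K y) * fourier \<phi> y = c' *\<^sub>R (norm y powr (\<alpha> - ?n) *\<^sub>R fourier \<phi> y)" for y
      by (simp add: scaleR_conv_of_real)
    have m: "(\<lambda>y. c' *\<^sub>R (norm y powr (\<alpha> - ?n) *\<^sub>R fourier \<phi> y)) \<in> borel_measurable lborel"
      by (intro borel_measurable_integrable integrable_scaleR_right i)
    have "integrable lebesgue (\<lambda>y. complex_of_real (?K y) * fourier \<phi> y)"
      unfolding eq integrable_completion[OF m] by (intro integrable_scaleR_right i)
    then have "complex_extension (induced_distribution ?K) (fourier \<phi>) =
        (LINT y|lebesgue. complex_of_real (?K y) * fourier \<phi> y)"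
      by (rule complex_extension_induced_distribution[OF K f\<phi>])
    also have "\<dots> = c' *\<^sub>R ?I"
      unfolding eq integral_completion[OF m] by (rule integral_scaleR_right)
    also have "?I = (1 / Gamma ((?n - \<alpha>) / 2)) *\<^sub>R (Gamma ((?n - \<alpha>) / 2) *\<^sub>R ?I)"
      using G by simp
    also have "\<dots> = (1 / c) *\<^sub>R ?J"
      unfolding fourier_norm_powr[OF \<alpha> \<phi>] c_def by simp
    finally show ?thesis by simp
  qed
  show ?thesis
  proof
    assume ft: "has_fourier_transform ?K (\<lambda>\<xi>. complex_of_real (1 / norm \<xi> powr \<alpha>))"
    define \<gamma> where "\<gamma> x = exp (- 1 * norm x ^ 2)" for x :: 'a
    have \<gamma>: "schwartz (\<lambda>x. complex_of_real (\<gamma> x))"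
      unfolding \<gamma>_def by (intro schwartz_of_real schwartz_gaussian) simp
    let ?J = "LINT \<xi>|lborel. norm \<xi> powr (- \<alpha>) *\<^sub>R complex_of_real (\<gamma> \<xi>)"
    have "(c' / c) *\<^sub>R ?J = complex_extension (induced_distribution ?K) (fourier (\<lambda>x. complex_of_real (\<gamma> x)))"
      by (rule lhs[OF \<gamma>, symmetric])
    also have "\<dots> = ?J"
      using has_fourier_transform_eq[OF ft \<gamma>] IR[OF \<gamma>] by (rule trans)
    finally have "(c' / c) *\<^sub>R ?J = ?J" .
    moreover have "?J \<noteq> 0"
    proof
      assume "?J = 0"
      then have "complex_of_real (LINT \<xi>|lborel. norm \<xi> powr (- \<alpha>) * \<gamma> \<xi>) = 0"
        by (simp add: scaleR_conv_of_real flip: of_real_mult)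
      then have "(LINT \<xi>|lborel. norm \<xi> powr (- \<alpha>) * \<gamma> \<xi>) = 0" by simp
      moreover have "integrable lborel (\<lambda>\<xi>. norm \<xi> powr (- \<alpha>) * \<gamma> \<xi>)"
        using integrable_norm_powr_gaussian[OF \<alpha>] by (simp add: \<gamma>_def)
      ultimately have "AE \<xi> in lborel. norm \<xi> powr (- \<alpha>) * \<gamma> \<xi> = 0"
        by (subst (asm) integral_nonneg_eq_0_iff_AE) (auto simp: \<gamma>_def)
      moreover have "AE \<xi> in lborel. \<xi> \<noteq> (0::'a)" by (rule AE_lborel_singleton)
      ultimately have "AE \<xi> in (lborel :: 'a measure). False"
        by eventually_elim (simp add: \<gamma>_def)
      then show False by (simp add: AE_iff_null null_sets_def)
    qed
    moreover have "r = 1" if "r *\<^sub>R z = z" "z \<noteq> 0" for r and z :: complex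
      using that by (metis scaleR_cancel_right scaleR_one)
    ultimately have "c' / c = 1" by blast
    then show "c' = c" using c by simp
  next
    assume "c' = c"
    then show "has_fourier_transform ?K (\<lambda>\<xi>. complex_of_real (1 / norm \<xi> powr \<alpha>))"
      unfolding has_fourier_transform_def
    proof (intro conjI K allI impI iR')
      fix \<phi> :: "'a \<Rightarrow> complex" assume \<phi>: "schwartz \<phi>"
      have "c' / c = 1" using c \<open>c' = c\<close> by simp
      then show "complex_extension (induced_distribution ?K) (fourier \<phi>) =
          (LINT \<xi>|lebesgue. complex_of_real (1 / norm \<xi> powr \<alpha>) * \<phi> \<xi>)"
        unfolding lhs[OF \<phi>] IR[OF \<phi>] by (simp only: scaleR_one)
    qed
  qed
qed

section \<open>Cauchy's functional equation on a countable set of exponents\<close>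

text \<open>Boundedness near a single point suffices for Cauchy's functional equation: if \<open>ln (g \<alpha>) \<noteq> 0\<close>,
  then some \<open>m \<alpha> + r \<beta>\<close> with \<open>m\<close> an integer and \<open>r\<close> rational lies near that point, while
  \<open>ln \<circ> g\<close> takes the large value \<open>m ln (g \<alpha>)\<close> there.\<close>

lemma multiplicative_eq_one:
  fixes g :: "real \<Rightarrow> real" and \<alpha> \<beta> n a \<delta> M :: real
  defines "G \<equiv> {p * \<alpha> + q * \<beta> | p q. p \<in> \<rat> \<and> q \<in> \<rat>}"
  assumes mult: "\<And>x y. x \<in> G \<Longrightarrow> y \<in> G \<Longrightarrow> 0 < x \<Longrightarrow> 0 < y \<Longrightarrow> x + y < n \<Longrightarrow> g (x + y) = g x * g y"
    and \<alpha>: "0 < \<alpha>" "\<alpha> < n" and \<beta>: "0 < \<beta>" "\<beta> < n" and one: "g \<beta> = 1"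
    and a: "0 < a" "a < n" and \<delta>: "\<delta> > 0"
    and bound: "\<And>y. y \<in> G \<Longrightarrow> 0 < y \<Longrightarrow> y < n \<Longrightarrow> \<bar>y - a\<bar> < \<delta> \<Longrightarrow> g y \<le> M"
  shows "g \<alpha> = 1"
proof -
  have G_scale: "c * x \<in> G" if "x \<in> G" "c \<in> \<rat>" for c x
  proof -
    from that obtain p q where "p \<in> \<rat>" "q \<in> \<rat>" "x = p * \<alpha> + q * \<beta>" unfolding G_def by blast
    then show ?thesis unfolding G_def using \<open>c \<in> \<rat>\<close>
      by (intro CollectI exI[of _ "c * p"] exI[of _ "c * q"]) (auto simp: algebra_simps)
  qed
  have G_add: "x + y \<in> G" if "x \<in> G" "y \<in> G" for x y
  proof -
    from that obtain p q p' q' where "p \<in> \<rat>" "q \<in> \<rat>" "x = p * \<alpha> + q * \<beta>"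
      "p' \<in> \<rat>" "q' \<in> \<rat>" "y = p' * \<alpha> + q' * \<beta>" unfolding G_def by blast
    then show ?thesis unfolding G_def
      by (intro CollectI exI[of _ "p + p'"] exI[of _ "q + q'"]) (auto simp: algebra_simps)
  qed
  have G_div: "x / real k \<in> G" if "x \<in> G" for x k
    using G_scale[OF that, of "1 / real k"] by simp
  have G_minus: "x - y \<in> G" if "x \<in> G" "y \<in> G" for x y
    using G_add[OF that(1) G_scale[OF that(2), of "- 1"]] by simp
  have G_\<alpha>: "\<alpha> \<in> G" unfolding G_def by (intro CollectI exI[of _ 1] exI[of _ 0]) auto
  have G_\<beta>: "\<beta> \<in> G" unfolding G_def by (intro CollectI exI[of _ 0] exI[of _ 1]) auto
  have power: "g (real k * x) = g x ^ k" if "x \<in> G" "0 < x" "k > 0" "real k * x < n" for k x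
    using that(3,4)
  proof (induction k)
    case (Suc k)
    show ?case
    proof (cases "k = 0")
      case False
      have "real (Suc k) * x = real k * x + x" by (simp add: algebra_simps)
      moreover have "g (real k * x + x) = g (real k * x) * g x"
        using that(1,2) Suc.prems False by (intro mult G_scale) (auto simp: algebra_simps)
      ultimately show ?thesis
        using Suc False that(2) by (simp add: algebra_simps)
    qed simp
  qed simp
  have power_div: "g x = g (x / real k) ^ k" if "x \<in> G" "0 < x" "x < n" "k > 0" for x k
    using power[of "x / real k" k] that G_div by simp
  have pos: "g x > 0" if x: "x \<in> G" "0 < x" "x < n" for x
  proof -
    have "g x \<ge> 0" using power_div[OF x, of 2] by simp
    \<comment> \<open>For \<open>?y = x / k\<close> below \<open>\<beta>\<close> the value
      \<open>g \<beta> = 1\<close> splits as \<open>g ?y * g (\<beta> - ?y)\<close>, so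
      \<open>g ?y\<close> and its power \<open>g x\<close> are nonzero.\<close>
    moreover have "g x \<noteq> 0"
    proof -
      obtain k :: nat where k: "real k * \<beta> > x"
        using reals_Archimedean3[OF \<beta>(1)] by blast
      then have "k > 0" using x by (cases k) auto
      let ?y = "x / real k"
      have y: "?y \<in> G" "0 < ?y" "?y < \<beta>"
        using x k \<open>k > 0\<close> G_div by (auto simp: field_simps)
      have "g ?y * g (\<beta> - ?y) = g (?y + (\<beta> - ?y))"
        using y \<beta> by (intro mult[symmetric] G_minus G_\<beta>) auto
      then have "g ?y \<noteq> 0" using one by auto
      then show ?thesis using power_div[OF x \<open>k > 0\<close>] by simp
    qed
    ultimately show ?thesis by simp
  qed
  define L where "L x = ln (g x)" for x
  have L_add: "L (x + y) = L x + L y" if "x \<in> G" "y \<in> G" "0 < x" "0 < y" "x + y < n" for x y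
    unfolding L_def using mult[OF that] pos[of x] pos[of y] that by (simp add: ln_mult)
  have L_mult: "L (real k * x) = real k * L x" if "x \<in> G" "0 < x" "k > 0" "real k * x < n" for k x
  proof -
    have "x \<le> real k * x" using that by simp
    then have "x < n" using that(4) by linarith
    then show ?thesis
      unfolding L_def power[OF that] using pos[OF that(1,2)] by (simp add: ln_realpow)
  qed
  have L_div: "L x = real k * L (x / real k)" if "x \<in> G" "0 < x" "x < n" "k > 0" for x k
    using L_mult[of "x / real k" k] that G_div by simp
  have L_\<beta>: "L (r * \<beta>) = 0" if r: "r \<in> \<rat>" "r > 0" "r * \<beta> < n" for r
  proof -
    obtain i j :: nat where j: "j \<noteq> 0" and ij: "\<bar>r\<bar> = real i / real j"
      using Rats_abs_nat_div_natE[OF r(1)] by metis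
    then have "i > 0" using r by (cases i) auto
    have "real j * L (\<beta> / real j) = 0"
      using L_div[OF G_\<beta> \<beta>, of j] j one by (simp add: L_def)
    moreover have "r * \<beta> = real i * (\<beta> / real j)" using ij r by simp
    moreover have "L (real i * (\<beta> / real j)) = real i * L (\<beta> / real j)"
      using \<open>i > 0\<close> j r \<beta> \<open>r * \<beta> = real i * (\<beta> / real j)\<close> by (intro L_mult G_div G_\<beta>) auto
    ultimately show ?thesis using j by simp
  qed
  \<comment> \<open>\<open>L\<close> is additive only while arguments are positive and sums stay
    below \<open>n\<close>, whereas \<open>m\<close> and \<open>r\<close> may be negative. Negative
    parts are therefore moved to the other side of the equation, and everything is divided by a
    large \<open>k\<close>.\<close>
  have L_comb: "L (of_int m * \<alpha> + r * \<beta>) = of_int m * L \<alpha>"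
    if r: "r \<in> \<rat>" and y: "0 < of_int m * \<alpha> + r * \<beta>" "of_int m * \<alpha> + r * \<beta> < n" for m :: int and r
  proof -
    define y where "y = of_int m * \<alpha> + r * \<beta>"
    \<comment> \<open>The added 1 makes \<open>p\<close> and \<open>q\<close> strictly positive
      while their difference stays \<open>m\<close>; \<open>r1\<close> and \<open>r2\<close> split
      \<open>r\<close> in the same way.\<close>
    define p where "p = nat (max m 0) + 1"
    define q where "q = nat (max (- m) 0) + 1"
    have pq: "real p - real q = of_int m" "p > 0" "q > 0" by (auto simp: p_def q_def)
    define r1 where "r1 = \<bar>r\<bar> + 1"
    define r2 where "r2 = \<bar>r\<bar> + 1 - r"
    have r12: "r1 \<in> \<rat>" "r2 \<in> \<rat>" "r1 > 0" "r2 > 0" "r1 - r2 = r"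
      using r by (auto simp: r1_def r2_def)
    have yG: "y \<in> G" unfolding y_def by (intro G_add G_scale G_\<alpha> G_\<beta> r) auto
    have eq: "y + real q * \<alpha> + r2 * \<beta> = real p * \<alpha> + r1 * \<beta>"
      unfolding y_def pq(1)[symmetric] r12(5)[symmetric] by (simp add: algebra_simps)
    obtain k :: nat where k: "real k * n > real p * \<alpha> + r1 * \<beta>"
      using reals_Archimedean3[of n] \<alpha> by force
    have "real p * \<alpha> + r1 * \<beta> > 0" using pq r12 \<alpha> \<beta> by (intro add_pos_pos mult_pos_pos) auto
    then have k0: "k > 0" using k by (cases k) auto
    have small: "(real p * \<alpha> + r1 * \<beta>) / real k < n"
      using k k0 by (simp add: field_simps)
    have q0: "real q * (\<alpha> / real k) > 0" "r2 / real k * \<beta> > 0" "real p * (\<alpha> / real k) > 0" "r1 / real k * \<beta> > 0"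
      using pq r12 \<alpha> \<beta> k0 by auto
    have y0: "y / real k > 0" using y k0 by (simp add: y_def)
    have r12k: "r1 / real k \<in> \<rat>" "r2 / real k \<in> \<rat>" using r12 by auto
    have eqk: "(y / real k + real q * (\<alpha> / real k)) + r2 / real k * \<beta> = real p * (\<alpha> / real k) + r1 / real k * \<beta>"
      using eq k0 by (simp add: field_simps)
    have smallk: "real p * (\<alpha> / real k) + r1 / real k * \<beta> < n"
      using small by (simp add: add_divide_distrib)
    have "L (real p * (\<alpha> / real k) + r1 / real k * \<beta>) = real p * L (\<alpha> / real k) + 0"
    proof -
      have G': "real p * (\<alpha> / real k) \<in> G" "r1 / real k * \<beta> \<in> G"
        using r12k(1) by (intro G_scale G_div G_\<alpha> G_\<beta>; simp)+
      have "L (real p * (\<alpha> / real k) + r1 / real k * \<beta>) = L (real p * (\<alpha> / real k)) + L (r1 / real k * \<beta>)"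
        using G' smallk q0 by (intro L_add) auto
      also have "L (r1 / real k * \<beta>) = 0"
        using r12k r12 k0 smallk q0 by (intro L_\<beta>) auto
      also have "L (real p * (\<alpha> / real k)) = real p * L (\<alpha> / real k)"
        using smallk q0 pq \<alpha> k0 by (intro L_mult G_div G_\<alpha>) auto
      finally show ?thesis .
    qed
    moreover have "L ((y / real k + real q * (\<alpha> / real k)) + r2 / real k * \<beta>) =
        (L (y / real k) + real q * L (\<alpha> / real k)) + 0"
    proof -
      have lt: "(y / real k + real q * (\<alpha> / real k)) + r2 / real k * \<beta> < n" using eqk smallk by simp
      have G': "y / real k \<in> G" "real q * (\<alpha> / real k) \<in> G" "r2 / real k * \<beta> \<in> G"
        using r12k(2) by (intro G_scale G_div G_\<alpha> G_\<beta> yG; simp)+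
      have "L ((y / real k + real q * (\<alpha> / real k)) + r2 / real k * \<beta>) =
          L (y / real k + real q * (\<alpha> / real k)) + L (r2 / real k * \<beta>)"
        using G' lt q0 y0 by (intro L_add G_add) auto
      also have "L (r2 / real k * \<beta>) = 0"
        using r12k r12 k0 lt q0 y0 by (intro L_\<beta>) auto
      also have "L (y / real k + real q * (\<alpha> / real k)) = L (y / real k) + L (real q * (\<alpha> / real k))"
        using G' lt q0 y0 by (intro L_add) auto
      also have "L (real q * (\<alpha> / real k)) = real q * L (\<alpha> / real k)"
        using lt q0 y0 pq \<alpha> k0 by (intro L_mult G_div G_\<alpha>) auto
      finally show ?thesis .
    qed
    ultimately have "L (y / real k) = (real p - real q) * L (\<alpha> / real k)"
      unfolding eqk by (simp add: algebra_simps)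
    then have "real k * L (y / real k) = of_int m * (real k * L (\<alpha> / real k))"
      unfolding pq(1) by simp
    then show ?thesis
      using L_div[OF yG _ _ k0] L_div[OF G_\<alpha> \<alpha> k0] y unfolding y_def by simp
  qed
  have "L \<alpha> = 0"
  proof (rule ccontr)
    assume nz: "L \<alpha> \<noteq> 0"
    \<comment> \<open>The maximum with 1 keeps the argument of \<open>ln\<close> positive for any
      \<open>M\<close>.\<close>
    define B where "B = ln (max M 1)"
    obtain z :: int where z: "B / \<bar>L \<alpha>\<bar> < of_int z"
      using ex_less_of_int by blast
    \<comment> \<open>The sign of \<open>m\<close> follows that of \<open>L \<alpha>\<close>, so an
      upper bound on \<open>g\<close> refutes either sign.\<close>
    define m where "m = (if L \<alpha> > 0 then z else - z)"
    have m: "of_int m * L \<alpha> > B"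
      using z nz by (auto simp: m_def field_simps abs_if split: if_splits)
    define lo where "lo = max (a - \<delta>) 0"
    define hi where "hi = min (a + \<delta>) n"
    have "lo < hi" using a \<delta> by (auto simp: lo_def hi_def)
    then have "(lo - of_int m * \<alpha>) / \<beta> < (hi - of_int m * \<alpha>) / \<beta>"
      using \<beta> by (simp add: divide_strict_right_mono)
    then obtain r where r: "r \<in> \<rat>" "(lo - of_int m * \<alpha>) / \<beta> < r" "r < (hi - of_int m * \<alpha>) / \<beta>"
      using Rats_dense_in_real by blast
    define y where "y = of_int m * \<alpha> + r * \<beta>"
    have y: "lo < y" "y < hi"
      using r \<beta> by (auto simp: y_def field_simps)
    have yG: "y \<in> G" unfolding y_def by (intro G_add G_scale G_\<alpha> G_\<beta> r) auto
    have y': "0 < y" "y < n" "\<bar>y - a\<bar> < \<delta>" using y by (auto simp: lo_def hi_def)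
    have "g y \<le> max M 1" using bound[OF yG y'] by simp
    then have "L y \<le> B"
      unfolding L_def B_def using pos[OF yG y'(1,2)] by (intro ln_mono) auto
    moreover have "L y = of_int m * L \<alpha>"
      using L_comb[OF r(1)] y' unfolding y_def by blast
    ultimately show False using m by simp
  qed
  then show ?thesis
    using pos[OF G_\<alpha> \<alpha>] unfolding L_def by simp
qed

section \<open>Characterization of the Riesz potential\<close>

text \<open>In the formula of \<open>convolution_eq_fourier\<close> the transform of the kernel
  stands under an integral, so a null set does not matter and the convolutions agree at every
  point.\<close>

lemma convolution_cong_AE:
  fixes K L :: "'a::euclidean_space \<Rightarrow> real"
  assumes K: "has_fourier_transform K k" and L: "has_fourier_transform L l"
    and eq: "AE x in lebesgue. k x = l x" and f: "schwartz f"
  shows "convolution K f = convolution L f"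
proof
  fix x :: 'a
  define F where "F \<xi> = of_real (1 / (2 * pi) ^ DIM('a)) * fourier (\<lambda>x. complex_of_real (f x)) \<xi>" for \<xi>
  have F: "schwartz F"
    unfolding F_def by (intro schwartz_cmult schwartz_fourier schwartz_of_real f)
  have e: "(\<lambda>\<xi>. exp (- \<i> * complex_of_real (\<xi> \<bullet> (- x)))) \<in> borel_measurable lebesgue"
    by (intro measurable_completion) measurable
  have "fourier (\<lambda>\<xi>. k \<xi> * F \<xi>) (- x) = fourier (\<lambda>\<xi>. l \<xi> * F \<xi>) (- x)"
    unfolding fourier_def
    by (intro integral_cong_AE borel_measurable_times e borel_measurable_integrable
        has_fourier_transform_integrable[OF K F] has_fourier_transform_integrable[OF L F])
      (use eq in auto)
  then show "convolution K f x = convolution L f x"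
    using convolution_eq_fourier[OF K f, of x] convolution_eq_fourier[OF L f, of x]
    unfolding F_def by (metis of_real_eq_iff)
qed

lemma has_fourier_transform_riesz_kernel:
  assumes \<alpha>: "0 < \<alpha>" "\<alpha> < real CARD('n)"
  shows "has_fourier_transform (riesz_kernel \<alpha> :: real ^ 'n \<Rightarrow> real)
    (\<lambda>\<xi>. complex_of_real (1 / norm \<xi> powr \<alpha>))"
proof -
  let ?P = "\<lambda>c. has_fourier_transform (\<lambda>y :: real ^ 'n. c * norm y powr (\<alpha> - real CARD('n)))
    (\<lambda>\<xi>. complex_of_real (1 / norm \<xi> powr \<alpha>))"
  have dim: "real DIM(real ^ 'n) = real CARD('n)" by simp
  obtain c where c: "\<And>c'. ?P c' \<longleftrightarrow> c' = c"
    using has_fourier_transform_norm_powr[where 'a = "real ^ 'n", OF \<alpha>(1)] \<alpha>(2) unfolding dim by blast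
  then have "(THE c. ?P c) = c" by simp
  then have "riesz_kernel \<alpha> = (\<lambda>y :: real ^ 'n. c * norm y powr (\<alpha> - real CARD('n)))"
    unfolding riesz_kernel_def by (simp only:)
  with c[of c] show ?thesis by simp
qed

theorem theorem6p1:
  fixes K :: "real \<Rightarrow> real ^ 'n \<Rightarrow> real"
    and Khat :: "real \<Rightarrow> real ^ 'n \<Rightarrow> real"
    and J :: "real \<Rightarrow> (real ^ 'n \<Rightarrow> real) \<Rightarrow> real ^ 'n \<Rightarrow> real"
    and \<alpha>\<^sub>0 :: real
  assumes loc: "\<And>\<alpha>. \<alpha> \<in> {0<..<real CARD('n)} \<Longrightarrow> locally_integrable (K \<alpha>)"
    and fourier: "\<And>\<alpha>. \<alpha> \<in> {0<..<real CARD('n)} \<Longrightarrow>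
      has_fourier_transform (K \<alpha>) (\<lambda>x. complex_of_real (Khat \<alpha> x))"
    and J: "\<And>\<alpha> f. \<alpha> \<in> {0<..<real CARD('n)} \<Longrightarrow> schwartz f \<Longrightarrow> J \<alpha> f = convolution (K \<alpha>) f"
    and alpha0: "\<alpha>\<^sub>0 \<in> {0<..<real CARD('n)}"
    and ident: "\<And>x. x \<noteq> 0 \<Longrightarrow> Khat \<alpha>\<^sub>0 x = 1 / norm x powr \<alpha>\<^sub>0"
    and index_law: "\<And>\<alpha> \<beta> f. 0 < \<alpha> \<Longrightarrow> 0 < \<beta> \<Longrightarrow> \<alpha> + \<beta> < real CARD('n) \<Longrightarrow> schwartz f \<Longrightarrow>
      is_convolution (K \<alpha>) (J \<beta> f) (J (\<alpha> + \<beta>) f)"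
    and cont: "\<And>x. x \<noteq> 0 \<Longrightarrow> \<exists>a\<in>{0<..<real CARD('n)}. isCont (\<lambda>\<alpha>. Khat \<alpha> x) a"
  shows "\<forall>\<alpha>\<in>{0<..<real CARD('n)}. \<forall>f. schwartz f \<longrightarrow> J \<alpha> f = riesz_potential \<alpha> f"
proof (intro ballI allI impI)
  fix \<alpha> :: real and f :: "real ^ 'n \<Rightarrow> real"
  assume \<alpha>: "\<alpha> \<in> {0<..<real CARD('n)}" and f: "schwartz f"
  let ?n = "real CARD('n)"
  \<comment> \<open>Coefficients of both signs allow a large multiple of \<open>\<alpha>\<close> to
    be brought back into the interval by a multiple of \<open>\<alpha>\<^sub>0\<close>.\<close>
  define G where "G = {p * \<alpha> + q * \<alpha>\<^sub>0 | p q. p \<in> \<rat> \<and> q \<in> \<rat>}"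
  define X where "X = {(x, y). x \<in> G \<and> y \<in> G \<and> 0 < x \<and> 0 < y \<and> x + y < ?n}"
  have "G = (\<lambda>(p, q). p * \<alpha> + q * \<alpha>\<^sub>0) ` (\<rat> \<times> \<rat>)"
    unfolding G_def by auto
  then have "countable G"
    by (simp add: countable_rat)
  then have "countable (G \<times> G)"
    by (intro countable_SIGMA)
  then have "countable X"
    by (rule countable_subset[rotated]) (auto simp: X_def)
  moreover have "AE \<xi> in lebesgue. Khat (x + y) \<xi> = Khat x \<xi> * Khat y \<xi>" if "(x, y) \<in> X" for x y
  proof -
    have xy: "0 < x" "0 < y" "x + y < ?n" using that by (auto simp: X_def)
    have "AE \<xi> in lebesgue. complex_of_real (Khat (x + y) \<xi>) = complex_of_real (Khat x \<xi>) * complex_of_real (Khat y \<xi>)"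
    proof (rule is_convolution_imp_multiplicative)
      show "is_convolution (K x) (convolution (K y) f) (convolution (K (x + y)) f)" if "schwartz f" for f
        using index_law[OF xy that] xy J[OF _ that] by simp
    qed (use fourier xy in auto)
    then show ?thesis
      by eventually_elim (simp flip: of_real_mult)
  qed
  \<comment> \<open>Countability of \<open>X\<close> makes one exceptional set serve all pairs of
    exponents; the point of continuity is then chosen separately for each remaining
    \<open>\<xi>\<close>.\<close>
  ultimately have "AE \<xi> in lebesgue. \<forall>(x, y)\<in>X. Khat (x + y) \<xi> = Khat x \<xi> * Khat y \<xi>"
    by (subst AE_ball_countable) auto
  moreover have "AE \<xi> in lebesgue. \<xi> \<noteq> (0 :: real ^ 'n)"
    by (intro AE_completion AE_lborel_singleton)
  ultimately have "AE \<xi> in lebesgue. complex_of_real (Khat \<alpha> \<xi>) = complex_of_real (1 / norm \<xi> powr \<alpha>)"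
  proof eventually_elim
    fix \<xi> :: "real ^ 'n"
    assume mult: "\<forall>(x, y)\<in>X. Khat (x + y) \<xi> = Khat x \<xi> * Khat y \<xi>" and \<xi>: "\<xi> \<noteq> 0"
    obtain a where a: "0 < a" "a < ?n" and isc: "isCont (\<lambda>\<alpha>. Khat \<alpha> \<xi>) a"
      using cont[OF \<xi>] by auto
    obtain \<delta> where \<delta>: "\<delta> > 0" "\<And>y. \<bar>y - a\<bar> < \<delta> \<Longrightarrow> \<bar>Khat y \<xi> - Khat a \<xi>\<bar> < 1"
      using isc unfolding continuous_at_eps_delta dist_real_def by (metis zero_less_one)
    \<comment> \<open>The factor \<open>norm \<xi> powr y\<close> is multiplicative in
      \<open>y\<close> and normalises the value at \<open>\<alpha>\<^sub>0\<close> to 1.\<close>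
    let ?g = "\<lambda>y. Khat y \<xi> * norm \<xi> powr y"
    have "?g \<alpha> = 1"
    \<comment> \<open>The bound joins the variation of \<open>Khat\<close> by less than 1 near
      \<open>a\<close> with a bound on the power of the norm uniform in the exponent;
      \<open>max 1\<close> covers norms below 1.\<close>
    proof (rule multiplicative_eq_one[of \<alpha> \<alpha>\<^sub>0 ?n ?g a \<delta> "(\<bar>Khat a \<xi>\<bar> + 1) * max 1 (norm \<xi>) powr ?n",
          folded G_def])
      fix x y assume "x \<in> G" "y \<in> G" "0 < x" "0 < y" "x + y < ?n"
      then have "(x, y) \<in> X" by (simp add: X_def)
      then have "Khat (x + y) \<xi> = Khat x \<xi> * Khat y \<xi>" using mult by blast
      then show "?g (x + y) = ?g x * ?g y" by (simp add: powr_add)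
    next
      fix y assume y: "0 < y" "y < ?n" "\<bar>y - a\<bar> < \<delta>"
      have "Khat y \<xi> \<le> \<bar>Khat a \<xi>\<bar> + 1" using \<delta>(2)[OF y(3)] by linarith
      moreover have "norm \<xi> powr y \<le> max 1 (norm \<xi>) powr ?n"
      proof -
        have "norm \<xi> powr y \<le> max 1 (norm \<xi>) powr y"
          using y by (intro powr_mono2) auto
        also have "\<dots> \<le> max 1 (norm \<xi>) powr ?n"
          using y by (intro powr_mono) auto
        finally show ?thesis .
      qed
      ultimately show "?g y \<le> (\<bar>Khat a \<xi>\<bar> + 1) * max 1 (norm \<xi>) powr ?n"
        by (intro mult_mono) auto
    next
      show "?g \<alpha>\<^sub>0 = 1" using ident[OF \<xi>] \<xi> by simp
    qed (use \<alpha> alpha0 a \<delta> in auto)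
    then have "Khat \<alpha> \<xi> = 1 / norm \<xi> powr \<alpha>"
      using \<xi> by (simp add: field_simps)
    then show "complex_of_real (Khat \<alpha> \<xi>) = complex_of_real (1 / norm \<xi> powr \<alpha>)"
      by simp
  qed
  then have "convolution (K \<alpha>) f = convolution (riesz_kernel \<alpha>) f"
    using \<alpha> by (intro convolution_cong_AE[OF fourier has_fourier_transform_riesz_kernel _ f]) auto
  then show "J \<alpha> f = riesz_potential \<alpha> f"
    using J[OF \<alpha> f] by (simp add: riesz_potential_def)
qed

end
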